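(* Let $H$ be a Hopf algebra over a field $k$ and let $A$ be a left $H$-Galois object. There exist two functors $\mathrm{Bimod}(A)\to\mathrm{Bimod}(H)$, $M\mapsto M'$ and $M\mapsto M''$, such that for any $A$-bimodule $M$ and all $n\ge0$, $$H_n(A,M)\cong H_n(H,M')\quad\text{and}\quad H^n(A,M)\cong H^n(H,M'').$$
   Context: $\mathrm{Bimod}(A)$ is the category of $A$-bimodules. $H_*(A,M)$ and $H^*(A,M)$ denote Hochschild homology and cohomology of the $k$-algebra $A$ with coefficients in the $A$-bimodule $M$. A left $H$-Galois object is a left $H$-comodule algebra $A\neq(0)$ with coaction $\alpha:A\to H\otimes A$ such that $(1_H\otimes m)(\alpha\otimes1_A):A\otimes A\to H\otimes A$ is bijective, $m$ being the multiplication of $A$. *)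

theory Defs
  imports "HOL-Algebra.Module" "HOL-Algebra.AbelCoset"
begin

section \<open>Linear maps, quotients and presented modules\<close>

text \<open>
  Modules are \<^typ>\<open>('k, 'm) module\<close> records of HOL-Algebra. Such a record also has ring fields
  \<^const>\<open>mult\<close> and \<^const>\<open>one\<close>; they are meaningful for algebras only, and are
  \<^const>\<open>undefined\<close> or irrelevant for plain modules.
\<close>

definition lin_maps ::
  "('k, 'r) ring_scheme \<Rightarrow> ('k, 'm, 's) module_scheme \<Rightarrow> ('k, 'n, 't) module_scheme \<Rightarrow> ('m \<Rightarrow> 'n) set"
where
  "lin_maps K M N = {f. f \<in> carrier M \<rightarrow> carrier N \<and>
     (\<forall>x\<in>carrier M. \<forall>y\<in>carrier M. f (x \<oplus>\<^bsub>M\<^esub> y) = f x \<oplus>\<^bsub>N\<^esub> f y) \<and>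
     (\<forall>c\<in>carrier K. \<forall>x\<in>carrier M. f (c \<odot>\<^bsub>M\<^esub> x) = c \<odot>\<^bsub>N\<^esub> f x)}"

definition mod_isomorphic ::
  "('k, 'r) ring_scheme \<Rightarrow> ('k, 'm, 's) module_scheme \<Rightarrow> ('k, 'n, 't) module_scheme \<Rightarrow> bool"
where
  "mod_isomorphic K M N \<longleftrightarrow> (\<exists>f\<in>lin_maps K M N. bij_betw f (carrier M) (carrier N))"

definition quot_mod :: "('k, 'm, 's) module_scheme \<Rightarrow> 'm set \<Rightarrow> ('k, 'm set) module" where
  "quot_mod M N = \<lparr>carrier = a_rcosets\<^bsub>M\<^esub> N, mult = undefined, one = undefined,
     zero = N, add = (<+>\<^bsub>M\<^esub>), smult = (\<lambda>c X. \<Union>x\<in>X. N +>\<^bsub>M\<^esub> (c \<odot>\<^bsub>M\<^esub> x))\<rparr>"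

definition submod_span ::
  "('k, 'r) ring_scheme \<Rightarrow> ('k, 'm, 's) module_scheme \<Rightarrow> 'm set \<Rightarrow> 'm set"
where
  "submod_span K M R = \<Inter>{N. submodule N K M \<and> R \<subseteq> N}"

definition free_mod :: "('k, 'r) ring_scheme \<Rightarrow> 's set \<Rightarrow> ('k, 's \<Rightarrow> 'k) module" where
  "free_mod K S =
     \<lparr>carrier = {x. (\<forall>s. x s \<in> carrier K) \<and> finite {s. x s \<noteq> \<zero>\<^bsub>K\<^esub>} \<and> {s. x s \<noteq> \<zero>\<^bsub>K\<^esub>} \<subseteq> S},
      mult = undefined, one = undefined,
      zero = (\<lambda>s. \<zero>\<^bsub>K\<^esub>), add = (\<lambda>x y s. x s \<oplus>\<^bsub>K\<^esub> y s), smult = (\<lambda>c x s. c \<otimes>\<^bsub>K\<^esub> x s)\<rparr>"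

definition free_gen :: "('k, 'r) ring_scheme \<Rightarrow> 's \<Rightarrow> 's \<Rightarrow> 'k" where
  "free_gen K s = (\<lambda>t. if t = s then \<one>\<^bsub>K\<^esub> else \<zero>\<^bsub>K\<^esub>)"

definition pres_mod :: "('k, 'r) ring_scheme \<Rightarrow> 's set \<Rightarrow> ('s \<Rightarrow> 'k) set \<Rightarrow> ('k, ('s \<Rightarrow> 'k) set) module" where
  "pres_mod K S R = quot_mod (free_mod K S) (submod_span K (free_mod K S) R)"

definition pres_gen :: "('k, 'r) ring_scheme \<Rightarrow> 's set \<Rightarrow> ('s \<Rightarrow> 'k) set \<Rightarrow> 's \<Rightarrow> ('s \<Rightarrow> 'k) set" where
  "pres_gen K S R s =
     submod_span K (free_mod K S) R +>\<^bsub>free_mod K S\<^esub> free_gen K s"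

text \<open>
  The linear map out of a presented module that sends the class of each generator \<open>s\<close> to \<open>\<phi> s\<close>.
  The choice of a representative of the coset \<open>X\<close> is immaterial when \<open>\<phi>\<close> respects the relations,
  which is the case at every use below.
\<close>

definition pres_lift ::
  "('k, 'r) ring_scheme \<Rightarrow> ('k, 'p, 't) module_scheme \<Rightarrow> ('s \<Rightarrow> 'p) \<Rightarrow> ('s \<Rightarrow> 'k) set \<Rightarrow> 'p"
where
  "pres_lift K P \<phi> X =
     (let x = (SOME x. x \<in> X) in \<Oplus>\<^bsub>P\<^esub>s\<in>{s. x s \<noteq> \<zero>\<^bsub>K\<^esub>}. x s \<odot>\<^bsub>P\<^esub> \<phi> s)"


section \<open>Algebras and tensor products\<close>

text \<open>The library locale \<^locale>\<open>algebra\<close> is restricted to commutative algebras.\<close>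

locale assoc_algebra = K?: field K + A?: module K A + A?: ring A
  for K :: "('k, 'r) ring_scheme" and A :: "('k, 'a, 's) module_scheme" +
  assumes smult_mult_l:
      "\<lbrakk>c \<in> carrier K; x \<in> carrier A; y \<in> carrier A\<rbrakk> \<Longrightarrow>
        (c \<odot>\<^bsub>A\<^esub> x) \<otimes>\<^bsub>A\<^esub> y = c \<odot>\<^bsub>A\<^esub> (x \<otimes>\<^bsub>A\<^esub> y)"
    and smult_mult_r:
      "\<lbrakk>c \<in> carrier K; x \<in> carrier A; y \<in> carrier A\<rbrakk> \<Longrightarrow>
        x \<otimes>\<^bsub>A\<^esub> (c \<odot>\<^bsub>A\<^esub> y) = c \<odot>\<^bsub>A\<^esub> (x \<otimes>\<^bsub>A\<^esub> y)"

definition alg_hom ::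
  "('k, 'r) ring_scheme \<Rightarrow> ('k, 'a, 's) module_scheme \<Rightarrow> ('k, 'b, 't) module_scheme \<Rightarrow> ('a \<Rightarrow> 'b) set"
where
  "alg_hom K A B = ring_hom A B \<inter> lin_maps K A B"

definition tensor_rels ::
  "('k, 'r) ring_scheme \<Rightarrow> ('k, 'm, 's) module_scheme \<Rightarrow> ('k, 'n, 't) module_scheme \<Rightarrow> ('m \<times> 'n \<Rightarrow> 'k) set"
where
  "tensor_rels K M N =
    (let F = free_mod K (carrier M \<times> carrier N); g = free_gen K in
      {g (x \<oplus>\<^bsub>M\<^esub> x', y) \<ominus>\<^bsub>F\<^esub> (g (x, y) \<oplus>\<^bsub>F\<^esub> g (x', y)) | x x' y.
         x \<in> carrier M \<and> x' \<in> carrier M \<and> y \<in> carrier N} \<union>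
      {g (x, y \<oplus>\<^bsub>N\<^esub> y') \<ominus>\<^bsub>F\<^esub> (g (x, y) \<oplus>\<^bsub>F\<^esub> g (x, y')) | x y y'.
         x \<in> carrier M \<and> y \<in> carrier N \<and> y' \<in> carrier N} \<union>
      {g (c \<odot>\<^bsub>M\<^esub> x, y) \<ominus>\<^bsub>F\<^esub> c \<odot>\<^bsub>F\<^esub> g (x, y) | c x y.
         c \<in> carrier K \<and> x \<in> carrier M \<and> y \<in> carrier N} \<union>
      {g (x, c \<odot>\<^bsub>N\<^esub> y) \<ominus>\<^bsub>F\<^esub> c \<odot>\<^bsub>F\<^esub> g (x, y) | c x y.
         c \<in> carrier K \<and> x \<in> carrier M \<and> y \<in> carrier N})"

definition tensor_mod ::
  "('k, 'r) ring_scheme \<Rightarrow> ('k, 'm, 's) module_scheme \<Rightarrow> ('k, 'n, 't) module_scheme \<Rightarrow>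
    ('k, ('m \<times> 'n \<Rightarrow> 'k) set) module"
where
  "tensor_mod K M N = pres_mod K (carrier M \<times> carrier N) (tensor_rels K M N)"

definition pure_tensor ::
  "('k, 'r) ring_scheme \<Rightarrow> ('k, 'm, 's) module_scheme \<Rightarrow> ('k, 'n, 't) module_scheme \<Rightarrow>
    'm \<Rightarrow> 'n \<Rightarrow> ('m \<times> 'n \<Rightarrow> 'k) set"
where
  "pure_tensor K M N x y = pres_gen K (carrier M \<times> carrier N) (tensor_rels K M N) (x, y)"

text \<open>
  \<open>M \<otimes>\<^sub>K N\<close>, with the multiplication \<open>(x \<otimes> y)(x' \<otimes> y') = xx' \<otimes> yy'\<close> and unit \<open>1 \<otimes> 1\<close>, which make it
  an algebra when \<open>M\<close> and \<open>N\<close> are algebras; for plain modules these two fields carry no meaning.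
\<close>

definition tensor ::
  "('k, 'r) ring_scheme \<Rightarrow> ('k, 'm, 's) module_scheme \<Rightarrow> ('k, 'n, 't) module_scheme \<Rightarrow>
    ('k, ('m \<times> 'n \<Rightarrow> 'k) set) module"
where
  "tensor K M N = (tensor_mod K M N)
     \<lparr>mult := (\<lambda>X Y. pres_lift K (tensor_mod K M N) (\<lambda>(x, y).
                pres_lift K (tensor_mod K M N) (\<lambda>(x', y').
                  pure_tensor K M N (x \<otimes>\<^bsub>M\<^esub> x') (y \<otimes>\<^bsub>N\<^esub> y')) Y) X),
      one := pure_tensor K M N \<one>\<^bsub>M\<^esub> \<one>\<^bsub>N\<^esub>\<rparr>"

text \<open>\<open>f \<otimes> g\<close> with values in \<open>M \<otimes> N\<close>.\<close>

definition tensor_map ::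
  "('k, 'r) ring_scheme \<Rightarrow> ('k, 'm, 's) module_scheme \<Rightarrow> ('k, 'n, 't) module_scheme \<Rightarrow>
    ('x \<Rightarrow> 'm) \<Rightarrow> ('y \<Rightarrow> 'n) \<Rightarrow> ('x \<times> 'y \<Rightarrow> 'k) set \<Rightarrow> ('m \<times> 'n \<Rightarrow> 'k) set"
where
  "tensor_map K M N f g =
     pres_lift K (tensor K M N) (\<lambda>(x, y). pure_tensor K M N (f x) (g y))"

text \<open>The associativity isomorphism \<open>(L \<otimes> M) \<otimes> N \<rightarrow> L \<otimes> (M \<otimes> N)\<close>.\<close>

definition tensor_assoc ::
  "('k, 'r) ring_scheme \<Rightarrow> ('k, 'l, 'q) module_scheme \<Rightarrow> ('k, 'm, 's) module_scheme \<Rightarrow>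
    ('k, 'n, 't) module_scheme \<Rightarrow>
    (('l \<times> 'm \<Rightarrow> 'k) set \<times> 'n \<Rightarrow> 'k) set \<Rightarrow> ('l \<times> ('m \<times> 'n \<Rightarrow> 'k) set \<Rightarrow> 'k) set"
where
  "tensor_assoc K L M N =
     pres_lift K (tensor K L (tensor K M N)) (\<lambda>(t, z).
       pres_lift K (tensor K L (tensor K M N)) (\<lambda>(x, y).
         pure_tensor K L (tensor K M N) x (pure_tensor K M N y z)) t)"

text \<open>The multiplication of \<open>A\<close> as a linear map \<open>A \<otimes> A \<rightarrow> A\<close>.\<close>

definition mult_map ::
  "('k, 'r) ring_scheme \<Rightarrow> ('k, 'a, 's) module_scheme \<Rightarrow> ('a \<times> 'a \<Rightarrow> 'k) set \<Rightarrow> 'a"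
where
  "mult_map K A = pres_lift K A (\<lambda>(x, y). x \<otimes>\<^bsub>A\<^esub> y)"


section \<open>Hopf algebras and Galois objects\<close>

text \<open>The identifications \<open>K \<otimes> H = H = H \<otimes> K\<close> are built into the counit axioms.\<close>

locale hopf_algebra = assoc_algebra K H
  for K :: "('k, 'r) ring_scheme" and H :: "('k, 'h, 's) module_scheme" +
  fixes comult :: "'h \<Rightarrow> ('h \<times> 'h \<Rightarrow> 'k) set"
    and counit :: "'h \<Rightarrow> 'k"
    and antipode :: "'h \<Rightarrow> 'h"
  assumes comult_hom: "comult \<in> alg_hom K H (tensor K H H)"
    and counit_hom: "counit \<in> ring_hom H K"
    and counit_smult:
      "\<lbrakk>c \<in> carrier K; x \<in> carrier H\<rbrakk> \<Longrightarrow> counit (c \<odot>\<^bsub>H\<^esub> x) = c \<otimes>\<^bsub>K\<^esub> counit x"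
    and coassoc:
      "x \<in> carrier H \<Longrightarrow>
        tensor_assoc K H H H (tensor_map K (tensor K H H) H comult (\<lambda>y. y) (comult x)) =
        tensor_map K H (tensor K H H) (\<lambda>y. y) comult (comult x)"
    and counit_l: "x \<in> carrier H \<Longrightarrow> pres_lift K H (\<lambda>(y, z). counit y \<odot>\<^bsub>H\<^esub> z) (comult x) = x"
    and counit_r: "x \<in> carrier H \<Longrightarrow> pres_lift K H (\<lambda>(y, z). counit z \<odot>\<^bsub>H\<^esub> y) (comult x) = x"
    and antipode_lin: "antipode \<in> lin_maps K H H"
    and antipode_l:
      "x \<in> carrier H \<Longrightarrow>
        mult_map K H (tensor_map K H H antipode (\<lambda>y. y) (comult x)) = counit x \<odot>\<^bsub>H\<^esub> \<one>\<^bsub>H\<^esub>"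
    and antipode_r:
      "x \<in> carrier H \<Longrightarrow>
        mult_map K H (tensor_map K H H (\<lambda>y. y) antipode (comult x)) = counit x \<odot>\<^bsub>H\<^esub> \<one>\<^bsub>H\<^esub>"

locale left_comodule_algebra = H: hopf_algebra K H comult counit antipode + A: assoc_algebra K A
  for K :: "('k, 'r) ring_scheme" and H :: "('k, 'h, 's) module_scheme"
    and comult counit antipode and A :: "('k, 'a, 't) module_scheme" +
  fixes coact :: "'a \<Rightarrow> ('h \<times> 'a \<Rightarrow> 'k) set"
  assumes coact_hom: "coact \<in> alg_hom K A (tensor K H A)"
    and coact_coassoc:
      "a \<in> carrier A \<Longrightarrow>
        tensor_assoc K H H A (tensor_map K (tensor K H H) A comult (\<lambda>b. b) (coact a)) =
        tensor_map K H (tensor K H A) (\<lambda>h. h) coact (coact a)"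
    and coact_counit:
      "a \<in> carrier A \<Longrightarrow> pres_lift K A (\<lambda>(h, b). counit h \<odot>\<^bsub>A\<^esub> b) (coact a) = a"

text \<open>\<open>(1\<^sub>H \<otimes> m) \<circ> (\<alpha> \<otimes> 1\<^sub>A)\<close>, where \<open>\<alpha> \<otimes> 1\<^sub>A\<close> takes values in \<open>(H \<otimes> A) \<otimes> A\<close>.\<close>

definition galois_map ::
  "('k, 'r) ring_scheme \<Rightarrow> ('k, 'h, 's) module_scheme \<Rightarrow> ('k, 'a, 't) module_scheme \<Rightarrow>
    ('a \<Rightarrow> ('h \<times> 'a \<Rightarrow> 'k) set) \<Rightarrow> ('a \<times> 'a \<Rightarrow> 'k) set \<Rightarrow> ('h \<times> 'a \<Rightarrow> 'k) set"
where
  "galois_map K H A coact X =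
     tensor_map K H A (\<lambda>h. h) (mult_map K A)
       (tensor_assoc K H A A (tensor_map K (tensor K H A) A coact (\<lambda>b. b) X))"

locale left_galois_object = left_comodule_algebra +
  assumes nonzero: "carrier A \<noteq> {\<zero>\<^bsub>A\<^esub>}"
    and galois_bij:
      "bij_betw (galois_map K H A coact) (carrier (tensor K A A)) (carrier (tensor K H A))"


section \<open>Bimodules\<close>

record ('k, 'm, 'a) bimodule = "('k, 'm) module" +
  lact :: "'a \<Rightarrow> 'm \<Rightarrow> 'm"
  ract :: "'m \<Rightarrow> 'a \<Rightarrow> 'm"

text \<open>
  Bimodules are \<open>K\<close>-central: the scalars act in the same way through the left and the right action.
\<close>

locale alg_bimodule = A: assoc_algebra K A + M: module K M
  for K :: "('k, 'r) ring_scheme" and A :: "('k, 'a, 's) module_scheme"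
    and M :: "('k, 'm, 'a, 't) bimodule_scheme" +
  assumes lact_closed: "\<lbrakk>a \<in> carrier A; m \<in> carrier M\<rbrakk> \<Longrightarrow> lact M a m \<in> carrier M"
    and lact_add_l: "\<lbrakk>a \<in> carrier A; b \<in> carrier A; m \<in> carrier M\<rbrakk> \<Longrightarrow>
      lact M (a \<oplus>\<^bsub>A\<^esub> b) m = lact M a m \<oplus>\<^bsub>M\<^esub> lact M b m"
    and lact_add_r: "\<lbrakk>a \<in> carrier A; m \<in> carrier M; m' \<in> carrier M\<rbrakk> \<Longrightarrow>
      lact M a (m \<oplus>\<^bsub>M\<^esub> m') = lact M a m \<oplus>\<^bsub>M\<^esub> lact M a m'"
    and lact_smult_l: "\<lbrakk>c \<in> carrier K; a \<in> carrier A; m \<in> carrier M\<rbrakk> \<Longrightarrow>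
      lact M (c \<odot>\<^bsub>A\<^esub> a) m = c \<odot>\<^bsub>M\<^esub> lact M a m"
    and lact_smult_r: "\<lbrakk>c \<in> carrier K; a \<in> carrier A; m \<in> carrier M\<rbrakk> \<Longrightarrow>
      lact M a (c \<odot>\<^bsub>M\<^esub> m) = c \<odot>\<^bsub>M\<^esub> lact M a m"
    and lact_one: "m \<in> carrier M \<Longrightarrow> lact M \<one>\<^bsub>A\<^esub> m = m"
    and lact_mult: "\<lbrakk>a \<in> carrier A; b \<in> carrier A; m \<in> carrier M\<rbrakk> \<Longrightarrow>
      lact M (a \<otimes>\<^bsub>A\<^esub> b) m = lact M a (lact M b m)"
    and ract_closed: "\<lbrakk>m \<in> carrier M; a \<in> carrier A\<rbrakk> \<Longrightarrow> ract M m a \<in> carrier M"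
    and ract_add_l: "\<lbrakk>m \<in> carrier M; m' \<in> carrier M; a \<in> carrier A\<rbrakk> \<Longrightarrow>
      ract M (m \<oplus>\<^bsub>M\<^esub> m') a = ract M m a \<oplus>\<^bsub>M\<^esub> ract M m' a"
    and ract_add_r: "\<lbrakk>m \<in> carrier M; a \<in> carrier A; b \<in> carrier A\<rbrakk> \<Longrightarrow>
      ract M m (a \<oplus>\<^bsub>A\<^esub> b) = ract M m a \<oplus>\<^bsub>M\<^esub> ract M m b"
    and ract_smult_l: "\<lbrakk>c \<in> carrier K; m \<in> carrier M; a \<in> carrier A\<rbrakk> \<Longrightarrow>
      ract M (c \<odot>\<^bsub>M\<^esub> m) a = c \<odot>\<^bsub>M\<^esub> ract M m a"
    and ract_smult_r: "\<lbrakk>c \<in> carrier K; m \<in> carrier M; a \<in> carrier A\<rbrakk> \<Longrightarrow>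
      ract M m (c \<odot>\<^bsub>A\<^esub> a) = c \<odot>\<^bsub>M\<^esub> ract M m a"
    and ract_one: "m \<in> carrier M \<Longrightarrow> ract M m \<one>\<^bsub>A\<^esub> = m"
    and ract_mult: "\<lbrakk>m \<in> carrier M; a \<in> carrier A; b \<in> carrier A\<rbrakk> \<Longrightarrow>
      ract M m (a \<otimes>\<^bsub>A\<^esub> b) = ract M (ract M m a) b"
    and act_commute: "\<lbrakk>a \<in> carrier A; m \<in> carrier M; b \<in> carrier A\<rbrakk> \<Longrightarrow>
      ract M (lact M a m) b = lact M a (ract M m b)"

text \<open>
  Morphisms are extensional functions, so that equality of morphisms is equality of functions,
  identities are restrictions of the identity and composition is \<^const>\<open>compose\<close>.
\<close>

definition bimod_hom ::
  "('k, 'r) ring_scheme \<Rightarrow> ('k, 'a, 's) module_scheme \<Rightarrow>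
    ('k, 'm, 'a, 't) bimodule_scheme \<Rightarrow> ('k, 'n, 'a, 'u) bimodule_scheme \<Rightarrow> ('m \<Rightarrow> 'n) set"
where
  "bimod_hom K A M N = {f \<in> lin_maps K M N. f \<in> extensional (carrier M) \<and>
     (\<forall>a\<in>carrier A. \<forall>m\<in>carrier M. f (lact M a m) = lact N a (f m) \<and> f (ract M m a) = ract N (f m) a)}"

text \<open>
  \<open>Fo\<close> (on objects) and \<open>Fm\<close> (on morphisms) form a functor from the category of \<open>A\<close>-bimodules to the
  category of \<open>B\<close>-bimodules. The objects of both categories are the bimodules whose underlying set
  is contained in one type \<^typ>\<open>'m\<close>, which plays the role of the universe. The morphism part also
  takes the source and the target, since a function does not determine its codomain.
\<close>

definition bimod_functor ::
  "('k, 'r) ring_scheme \<Rightarrow> ('k, 'a, 's) module_scheme \<Rightarrow> ('k, 'b, 't) module_scheme \<Rightarrow>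
    (('k, 'm, 'a) bimodule \<Rightarrow> ('k, 'm, 'b) bimodule) \<Rightarrow>
    (('k, 'm, 'a) bimodule \<Rightarrow> ('k, 'm, 'a) bimodule \<Rightarrow> ('m \<Rightarrow> 'm) \<Rightarrow> ('m \<Rightarrow> 'm)) \<Rightarrow> bool"
where
  "bimod_functor K A B Fo Fm \<longleftrightarrow>
     (\<forall>M. alg_bimodule K A M \<longrightarrow> alg_bimodule K B (Fo M)) \<and>
     (\<forall>M N. alg_bimodule K A M \<longrightarrow> alg_bimodule K A N \<longrightarrow>
        (\<forall>f\<in>bimod_hom K A M N. Fm M N f \<in> bimod_hom K B (Fo M) (Fo N))) \<and>
     (\<forall>M. alg_bimodule K A M \<longrightarrow> Fm M M (\<lambda>x\<in>carrier M. x) = (\<lambda>x\<in>carrier (Fo M). x)) \<and>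
     (\<forall>L M N. alg_bimodule K A L \<longrightarrow> alg_bimodule K A M \<longrightarrow> alg_bimodule K A N \<longrightarrow>
        (\<forall>f\<in>bimod_hom K A L M. \<forall>g\<in>bimod_hom K A M N.
           Fm L N (compose (carrier L) g f) = compose (carrier (Fo L)) (Fm M N g) (Fm L M f)))"


section \<open>Hochschild homology and cohomology\<close>

definition tuples :: "('a, 's) ring_scheme \<Rightarrow> nat \<Rightarrow> 'a list set" where
  "tuples A n = {as. length as = n \<and> set as \<subseteq> carrier A}"

text \<open>
  The chains \<open>M \<otimes> A \<otimes> \<dots> \<otimes> A\<close> (with \<open>n\<close> factors \<open>A\<close>) form the \<open>(n + 1)\<close>-fold tensor product, presented
  by the generators \<open>m \<otimes> a\<^sub>1 \<otimes> \<dots> \<otimes> a\<^sub>n\<close> (encoded as \<open>(m, [a\<^sub>1, \<dots>, a\<^sub>n])\<close>) and multilinearity.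
\<close>

definition hoch_rels ::
  "('k, 'r) ring_scheme \<Rightarrow> ('k, 'a, 's) module_scheme \<Rightarrow> ('k, 'm, 't) module_scheme \<Rightarrow> nat \<Rightarrow>
    ('m \<times> 'a list \<Rightarrow> 'k) set"
where
  "hoch_rels K A M n =
    (let F = free_mod K (carrier M \<times> tuples A n); g = free_gen K in
      {g (x \<oplus>\<^bsub>M\<^esub> x', as) \<ominus>\<^bsub>F\<^esub> (g (x, as) \<oplus>\<^bsub>F\<^esub> g (x', as)) | x x' as.
         x \<in> carrier M \<and> x' \<in> carrier M \<and> as \<in> tuples A n} \<union>
      {g (c \<odot>\<^bsub>M\<^esub> x, as) \<ominus>\<^bsub>F\<^esub> c \<odot>\<^bsub>F\<^esub> g (x, as) | c x as.
         c \<in> carrier K \<and> x \<in> carrier M \<and> as \<in> tuples A n} \<union>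
      {g (x, as[i := a \<oplus>\<^bsub>A\<^esub> b]) \<ominus>\<^bsub>F\<^esub> (g (x, as[i := a]) \<oplus>\<^bsub>F\<^esub> g (x, as[i := b])) | x as i a b.
         x \<in> carrier M \<and> as \<in> tuples A n \<and> i < n \<and> a \<in> carrier A \<and> b \<in> carrier A} \<union>
      {g (x, as[i := c \<odot>\<^bsub>A\<^esub> a]) \<ominus>\<^bsub>F\<^esub> c \<odot>\<^bsub>F\<^esub> g (x, as[i := a]) | x as i c a.
         x \<in> carrier M \<and> as \<in> tuples A n \<and> i < n \<and> c \<in> carrier K \<and> a \<in> carrier A})"

definition hoch_chains ::
  "('k, 'r) ring_scheme \<Rightarrow> ('k, 'a, 's) module_scheme \<Rightarrow> ('k, 'm, 't) module_scheme \<Rightarrow> nat \<Rightarrow>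
    ('k, ('m \<times> 'a list \<Rightarrow> 'k) set) module"
where
  "hoch_chains K A M n = pres_mod K (carrier M \<times> tuples A n) (hoch_rels K A M n)"

definition hoch_pure ::
  "('k, 'r) ring_scheme \<Rightarrow> ('k, 'a, 's) module_scheme \<Rightarrow> ('k, 'm, 't) module_scheme \<Rightarrow> nat \<Rightarrow>
    'm \<times> 'a list \<Rightarrow> ('m \<times> 'a list \<Rightarrow> 'k) set"
where
  "hoch_pure K A M n = pres_gen K (carrier M \<times> tuples A n) (hoch_rels K A M n)"

text \<open>
  \<open>mult_adj A i [a\<^sub>1, \<dots>, a\<^sub>n] = [a\<^sub>1, \<dots>, a\<^sub>i a\<^sub>i\<^sub>+\<^sub>1, \<dots>, a\<^sub>n]\<close> for \<open>1 \<le> i < n\<close> (list positions start at \<open>0\<close>).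
\<close>

definition mult_adj :: "('a, 's) ring_scheme \<Rightarrow> nat \<Rightarrow> 'a list \<Rightarrow> 'a list" where
  "mult_adj A i as = take (i - 1) as @ [as ! (i - 1) \<otimes>\<^bsub>A\<^esub> as ! i] @ drop (i + 1) as"

definition hoch_face ::
  "('a, 's) ring_scheme \<Rightarrow> ('k, 'm, 'a, 't) bimodule_scheme \<Rightarrow> nat \<Rightarrow> 'm \<times> 'a list \<Rightarrow> 'm \<times> 'a list"
where
  "hoch_face A M i = (\<lambda>(m, as).
     if i = 0 then (ract M m (hd as), tl as)
     else if i = length as then (lact M (last as) m, butlast as)
     else (m, mult_adj A i as))"

definition sgn_pow :: "('k, 'r) ring_scheme \<Rightarrow> nat \<Rightarrow> 'k" where
  "sgn_pow K i = (\<ominus>\<^bsub>K\<^esub> \<one>\<^bsub>K\<^esub>) [^]\<^bsub>K\<^esub> i"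

text \<open>
  The differential from degree \<open>n\<close> to degree \<open>n - 1\<close>. In degree \<open>0\<close>, where natural subtraction gives
  \<open>0 - 1 = 0\<close>, it is the zero map.
\<close>

definition hoch_bdry ::
  "('k, 'r) ring_scheme \<Rightarrow> ('k, 'a, 's) module_scheme \<Rightarrow> ('k, 'm, 'a, 't) bimodule_scheme \<Rightarrow> nat \<Rightarrow>
    ('m \<times> 'a list \<Rightarrow> 'k) set \<Rightarrow> ('m \<times> 'a list \<Rightarrow> 'k) set"
where
  "hoch_bdry K A M n X =
    (if n = 0 then \<zero>\<^bsub>hoch_chains K A M 0\<^esub>
     else pres_lift K (hoch_chains K A M (n - 1))
       (\<lambda>g. \<Oplus>\<^bsub>hoch_chains K A M (n - 1)\<^esub>i\<in>{0..n}.
          sgn_pow K i \<odot>\<^bsub>hoch_chains K A M (n - 1)\<^esub> hoch_pure K A M (n - 1) (hoch_face A M i g)) X)"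

definition hoch_homology ::
  "('k, 'r) ring_scheme \<Rightarrow> ('k, 'a, 's) module_scheme \<Rightarrow> ('k, 'm, 'a, 't) bimodule_scheme \<Rightarrow> nat \<Rightarrow>
    ('k, ('m \<times> 'a list \<Rightarrow> 'k) set set) module"
where
  "hoch_homology K A M n =
    quot_mod
      ((hoch_chains K A M n)\<lparr>carrier :=
         {X \<in> carrier (hoch_chains K A M n). hoch_bdry K A M n X = \<zero>\<^bsub>hoch_chains K A M (n - 1)\<^esub>}\<rparr>)
      (hoch_bdry K A M (Suc n) ` carrier (hoch_chains K A M (Suc n)))"

text \<open>The cochains \<open>Hom\<^sub>K(A \<otimes> \<dots> \<otimes> A, M)\<close>, as multilinear maps of \<open>n\<close> variables.\<close>

definition hoch_cochains ::
  "('k, 'r) ring_scheme \<Rightarrow> ('k, 'a, 's) module_scheme \<Rightarrow> ('k, 'm, 't) module_scheme \<Rightarrow> nat \<Rightarrow>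
    ('k, 'a list \<Rightarrow> 'm) module"
where
  "hoch_cochains K A M n =
    \<lparr>carrier = {f \<in> tuples A n \<rightarrow>\<^sub>E carrier M. \<forall>as\<in>tuples A n. \<forall>i<n.
       (\<forall>a\<in>carrier A. \<forall>b\<in>carrier A.
          f (as[i := a \<oplus>\<^bsub>A\<^esub> b]) = f (as[i := a]) \<oplus>\<^bsub>M\<^esub> f (as[i := b])) \<and>
       (\<forall>c\<in>carrier K. \<forall>a\<in>carrier A. f (as[i := c \<odot>\<^bsub>A\<^esub> a]) = c \<odot>\<^bsub>M\<^esub> f (as[i := a]))},
     mult = undefined, one = undefined,
     zero = (\<lambda>as\<in>tuples A n. \<zero>\<^bsub>M\<^esub>),
     add = (\<lambda>f g. \<lambda>as\<in>tuples A n. f as \<oplus>\<^bsub>M\<^esub> g as),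
     smult = (\<lambda>c f. \<lambda>as\<in>tuples A n. c \<odot>\<^bsub>M\<^esub> f as)\<rparr>"

text \<open>The differential from degree \<open>n\<close> to degree \<open>n + 1\<close>.\<close>

definition hoch_cobdry ::
  "('k, 'r) ring_scheme \<Rightarrow> ('k, 'a, 's) module_scheme \<Rightarrow> ('k, 'm, 'a, 't) bimodule_scheme \<Rightarrow> nat \<Rightarrow>
    ('a list \<Rightarrow> 'm) \<Rightarrow> 'a list \<Rightarrow> 'm"
where
  "hoch_cobdry K A M n f = (\<lambda>as\<in>tuples A (Suc n).
     lact M (hd as) (f (tl as)) \<oplus>\<^bsub>M\<^esub>
     (\<Oplus>\<^bsub>M\<^esub>i\<in>{1..n}. sgn_pow K i \<odot>\<^bsub>M\<^esub> f (mult_adj A i as)) \<oplus>\<^bsub>M\<^esub>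
     sgn_pow K (Suc n) \<odot>\<^bsub>M\<^esub> ract M (f (butlast as)) (last as))"

definition hoch_cohomology ::
  "('k, 'r) ring_scheme \<Rightarrow> ('k, 'a, 's) module_scheme \<Rightarrow> ('k, 'm, 'a, 't) bimodule_scheme \<Rightarrow> nat \<Rightarrow>
    ('k, ('a list \<Rightarrow> 'm) set) module"
where
  "hoch_cohomology K A M n =
    quot_mod
      ((hoch_cochains K A M n)\<lparr>carrier :=
         {f \<in> carrier (hoch_cochains K A M n). hoch_cobdry K A M n f = \<zero>\<^bsub>hoch_cochains K A M (Suc n)\<^esub>}\<rparr>)
      (if n = 0 then {\<zero>\<^bsub>hoch_cochains K A M 0\<^esub>}
       else hoch_cobdry K A M (n - 1) ` carrier (hoch_cochains K A M (n - 1)))"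

end

theory Submission
  imports Defs
begin

text \<open>
  The Hochschild complexes of \<open>A\<close> and of \<open>H\<close> turn out to be isomorphic as complexes, by explicit
  formulas, so resolutions and derived functors do not appear.

  Write the coaction as \<open>a \<mapsto> a\<^sub>- \<otimes> a\<^sub>0\<close>, so that the Galois map is \<open>a \<otimes> b \<mapsto> a\<^sub>- \<otimes> a\<^sub>0 b\<close>, and let
  \<open>\<kappa>(h) = h\<^sub>1 \<otimes> h\<^sub>2\<close> in \<open>A \<otimes> A\<close> be the preimage of \<open>h \<otimes> 1\<close> under it (the translation map).
  That \<open>\<kappa>\<close> is inverse to the Galois map amounts to two identities (\<open>kappa_coact\<close> and
  \<open>coact_kappa\<close>), and applying the injective Galois map to both sides shows
  \<open>\<kappa>(h k) = h\<^sub>1 k\<^sub>1 \<otimes> k\<^sub>2 h\<^sub>2\<close> (\<open>kappa_mult\<close>). Hence every \<open>A\<close>-bimodule \<open>M\<close> becomes a right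
  \<open>H\<close>-module by \<open>m \<triangleleft> h = h\<^sub>2 m h\<^sub>1\<close> and a left one by \<open>h \<triangleright> m = h\<^sub>1 m h\<^sub>2\<close>. The bimodule \<open>M'\<close> has
  the first action on the right and the trivial action, through the counit, on the left; \<open>M''\<close> has
  the second one on the left and the trivial one on the right. Neither construction changes the
  underlying space, and bimodule maps commute with both actions, so the functors are the identity on
  morphisms.

  On chains consider \<open>m \<otimes> a \<otimes> b \<otimes> \<dots> \<mapsto> a\<^sub>0 b\<^sub>0 \<dots> m \<otimes> a\<^sub>- \<otimes> b\<^sub>- \<otimes> \<dots>\<close>. It is bijective because it
  applies the Galois map to one factor after the other; its inverse applies \<open>\<kappa>\<close>. It commutes with
  each face separately: with the inner ones because the coaction is multiplicative, with the one that
  lets the last factor act on \<open>m\<close> because of the counit axiom, and with the one that lets the first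
  factor act because \<open>(a\<^sub>0 m) \<triangleleft> a\<^sub>- = m a\<close>. On cochains the corresponding map sends \<open>f\<close> to
  \<open>(a, b, \<dots>) \<mapsto> f(a\<^sub>-, b\<^sub>-, \<dots>) a\<^sub>0 b\<^sub>0 \<dots>\<close>, and \<open>(a\<^sub>- \<triangleright> m) a\<^sub>0 = a m\<close> takes care of the first coface.

  Both maps are instances of one operation on multilinear maps, \<open>transfer\<close>: homology uses it for the
  left \<open>A\<close>-module \<open>M\<close>, cohomology for \<open>A\<close> itself. Sweedler sums are evaluated by \<open>tlift\<close>: for a
  bilinear \<open>B\<close>, the sum of \<open>B(a\<^sub>-, a\<^sub>0)\<close> is the value of \<open>tlift B\<close> at the coaction of \<open>a\<close>.
\<close>


section \<open>Linear maps\<close>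

lemma lin_mapsI:
  assumes "\<And>x. x \<in> carrier M \<Longrightarrow> f x \<in> carrier N"
    and "\<And>x y. x \<in> carrier M \<Longrightarrow> y \<in> carrier M \<Longrightarrow> f (x \<oplus>\<^bsub>M\<^esub> y) = f x \<oplus>\<^bsub>N\<^esub> f y"
    and "\<And>c x. c \<in> carrier K \<Longrightarrow> x \<in> carrier M \<Longrightarrow> f (c \<odot>\<^bsub>M\<^esub> x) = c \<odot>\<^bsub>N\<^esub> f x"
  shows "f \<in> lin_maps K M N"
  using assms unfolding lin_maps_def by auto

lemma lin_closed: "f \<in> lin_maps K M N \<Longrightarrow> x \<in> carrier M \<Longrightarrow> f x \<in> carrier N"
  and lin_add: "f \<in> lin_maps K M N \<Longrightarrow> x \<in> carrier M \<Longrightarrow> y \<in> carrier M \<Longrightarrow>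
    f (x \<oplus>\<^bsub>M\<^esub> y) = f x \<oplus>\<^bsub>N\<^esub> f y"
  and lin_smult: "f \<in> lin_maps K M N \<Longrightarrow> c \<in> carrier K \<Longrightarrow> x \<in> carrier M \<Longrightarrow>
    f (c \<odot>\<^bsub>M\<^esub> x) = c \<odot>\<^bsub>N\<^esub> f x"
  unfolding lin_maps_def by auto

lemma lin_zero:
  assumes "module K M" "module K N" "f \<in> lin_maps K M N"
  shows "f \<zero>\<^bsub>M\<^esub> = \<zero>\<^bsub>N\<^esub>"
proof -
  interpret M: module K M by fact
  interpret N: module K N by fact
  have "f (\<zero>\<^bsub>K\<^esub> \<odot>\<^bsub>M\<^esub> \<zero>\<^bsub>M\<^esub>) = \<zero>\<^bsub>K\<^esub> \<odot>\<^bsub>N\<^esub> f \<zero>\<^bsub>M\<^esub>"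
    by (rule lin_smult[OF assms(3)]) auto
  then show ?thesis using lin_closed[OF assms(3), of "\<zero>\<^bsub>M\<^esub>"] by simp
qed

lemma lin_uminus:
  assumes "module K M" "module K N" "f \<in> lin_maps K M N" "x \<in> carrier M"
  shows "f (\<ominus>\<^bsub>M\<^esub> x) = \<ominus>\<^bsub>N\<^esub> f x"
proof -
  interpret M: module K M by fact
  interpret N: module K N by fact
  have "f (\<ominus>\<^bsub>M\<^esub> x) \<oplus>\<^bsub>N\<^esub> f x = \<zero>\<^bsub>N\<^esub>"
    using lin_add[OF assms(3), of "\<ominus>\<^bsub>M\<^esub> x" x] assms(4) lin_zero[OF assms(1-3)]
    by (simp add: M.M.l_neg)
  then show ?thesis
    using assms lin_closed[OF assms(3)] by (metis M.M.a_inv_closed N.M.minus_equality)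
qed

lemma lin_minus:
  assumes "module K M" "module K N" "f \<in> lin_maps K M N" "x \<in> carrier M" "y \<in> carrier M"
  shows "f (x \<ominus>\<^bsub>M\<^esub> y) = f x \<ominus>\<^bsub>N\<^esub> f y"
proof -
  interpret M: module K M by fact
  show ?thesis
    using assms lin_add[OF assms(3), of x "\<ominus>\<^bsub>M\<^esub> y"] lin_uminus[OF assms(1-3), of y]
    by (simp add: a_minus_def)
qed

lemma lin_id: "(\<lambda>x. x) \<in> lin_maps K M M"
  by (auto simp: lin_maps_def)

lemma lin_comp:
  "f \<in> lin_maps K M N \<Longrightarrow> g \<in> lin_maps K N P \<Longrightarrow> (\<lambda>x. g (f x)) \<in> lin_maps K M P"
  by (intro lin_mapsI) (simp_all add: lin_closed lin_add lin_smult)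

lemma lin_cong:
  assumes "module K M" "f \<in> lin_maps K M N" "\<And>x. x \<in> carrier M \<Longrightarrow> g x = f x"
  shows "g \<in> lin_maps K M N"
proof -
  interpret M: module K M by fact
  show ?thesis using assms(2,3) by (auto simp: lin_maps_def)
qed

lemma lin_add_maps:
  assumes "module K N" "f \<in> lin_maps K M N" "g \<in> lin_maps K M N"
  shows "(\<lambda>x. f x \<oplus>\<^bsub>N\<^esub> g x) \<in> lin_maps K M N"
proof -
  interpret N: module K N by fact
  show ?thesis
    using assms(2,3)
    by (intro lin_mapsI) (simp_all add: lin_closed lin_add lin_smult N.smult_r_distr N.M.a_ac)
qed

lemma lin_smult_map:
  assumes "module K N" "c \<in> carrier K"
  shows "(\<lambda>x. c \<odot>\<^bsub>N\<^esub> x) \<in> lin_maps K N N"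
proof -
  interpret N: module K N by fact
  show ?thesis
    using assms(2) by (intro lin_mapsI)
      (simp_all add: N.smult_r_distr N.smult_assoc1[symmetric] N.R.m_comm)
qed

lemma lin_finsum_maps:
  assumes "module K M" "module K N" "finite I" "\<And>i. i \<in> I \<Longrightarrow> f i \<in> lin_maps K M N"
  shows "(\<lambda>x. \<Oplus>\<^bsub>N\<^esub>i\<in>I. f i x) \<in> lin_maps K M N"
proof -
  interpret N: module K N by fact
  show ?thesis
    using assms(3,4)
  proof (induction I)
    case empty
    show ?case by (intro lin_mapsI) simp_all
  next
    case (insert i I)
    have 1: "(\<lambda>x. f i x \<oplus>\<^bsub>N\<^esub> (\<Oplus>\<^bsub>N\<^esub>i\<in>I. f i x)) \<in> lin_maps K M N"
      using insert by (intro lin_add_maps assms(2)) auto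
    have 2: "(\<Oplus>\<^bsub>N\<^esub>i\<in>insert i I. f i x) = f i x \<oplus>\<^bsub>N\<^esub> (\<Oplus>\<^bsub>N\<^esub>i\<in>I. f i x)"
      if "x \<in> carrier M" for x
      using that insert by (intro N.M.finsum_insert) (auto intro: lin_closed)
    show ?case by (rule lin_cong[OF assms(1) 1 2])
  qed
qed

lemma lin_finsum:
  assumes "module K M" "module K N" "f \<in> lin_maps K M N" "finite I"
    and "\<And>i. i \<in> I \<Longrightarrow> g i \<in> carrier M"
  shows "f (\<Oplus>\<^bsub>M\<^esub>i\<in>I. g i) = (\<Oplus>\<^bsub>N\<^esub>i\<in>I. f (g i))"
proof -
  interpret M: module K M by fact
  interpret N: module K N by fact
  show ?thesis
    using assms(4,5)
  proof (induction I)
    case empty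
    show ?case using lin_zero[OF assms(1-3)] by simp
  next
    case (insert i I)
    then show ?case
      using lin_closed[OF assms(3)] lin_add[OF assms(3)]
      by (simp add: Pi_def)
  qed
qed


section \<open>Quotient modules\<close>

lemma submodule_abelian_subgroup:
  assumes "module K M" "submodule N K M"
  shows "abelian_subgroup N M"
proof -
  interpret M: module K M by fact
  show ?thesis
    using module.axioms(2)[OF assms(1)] assms(2) by (intro abelian_subgroupI3)
      (auto simp: additive_subgroup_def submodule_def)
qed

lemma quot_smult_coset:
  assumes "module K M" "submodule N K M" "c \<in> carrier K" "x \<in> carrier M"
  shows "c \<odot>\<^bsub>quot_mod M N\<^esub> (N +>\<^bsub>M\<^esub> x) = N +>\<^bsub>M\<^esub> (c \<odot>\<^bsub>M\<^esub> x)"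
proof -
  interpret M: module K M by fact
  interpret N: abelian_subgroup N M by (rule submodule_abelian_subgroup[OF assms(1,2)])
  have NE: "\<And>n. n \<in> N \<Longrightarrow> c \<odot>\<^bsub>M\<^esub> n \<in> N" "N \<subseteq> carrier M"
    using M.submoduleE[OF assms(2)] assms(3) by auto
  have "N +>\<^bsub>M\<^esub> (c \<odot>\<^bsub>M\<^esub> y) = N +>\<^bsub>M\<^esub> (c \<odot>\<^bsub>M\<^esub> x)" if y: "y \<in> N +>\<^bsub>M\<^esub> x" for y
  proof -
    obtain n where n: "n \<in> N" "y = n \<oplus>\<^bsub>M\<^esub> x" using y by (auto simp: a_r_coset_def')
    have "c \<odot>\<^bsub>M\<^esub> y = c \<odot>\<^bsub>M\<^esub> n \<oplus>\<^bsub>M\<^esub> c \<odot>\<^bsub>M\<^esub> x"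
      using n NE assms(3,4) by (auto simp: M.smult_r_distr)
    then have "c \<odot>\<^bsub>M\<^esub> y \<in> N +>\<^bsub>M\<^esub> (c \<odot>\<^bsub>M\<^esub> x)"
      using n NE by (auto simp: a_r_coset_def')
    then show ?thesis
      using assms(3,4) by (metis M.smult_closed N.a_repr_independence')
  qed
  then have "(\<Union>y\<in>N +>\<^bsub>M\<^esub> x. N +>\<^bsub>M\<^esub> (c \<odot>\<^bsub>M\<^esub> y)) = (\<Union>y\<in>N +>\<^bsub>M\<^esub> x. N +>\<^bsub>M\<^esub> (c \<odot>\<^bsub>M\<^esub> x))"
    by (rule SUP_cong[OF refl])
  moreover have "N +>\<^bsub>M\<^esub> x \<noteq> {}" using N.a_rcos_self[OF assms(4)] by blast
  ultimately show ?thesis by (simp add: quot_mod_def)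
qed

lemma quot_carrierE:
  assumes "X \<in> carrier (quot_mod M N)"
  obtains x where "x \<in> carrier M" "X = N +>\<^bsub>M\<^esub> x"
  using assms by (auto simp: quot_mod_def A_RCOSETS_def')

lemma quot_proj_lin:
  assumes "module K M" "submodule N K M"
  shows "(\<lambda>x. N +>\<^bsub>M\<^esub> x) \<in> lin_maps K M (quot_mod M N)"
proof -
  interpret M: module K M by fact
  interpret N: abelian_subgroup N M by (rule submodule_abelian_subgroup[OF assms(1,2)])
  show ?thesis
    by (intro lin_mapsI; (simp only: quot_smult_coset[OF assms])?)
      (auto simp: N.a_rcos_sum quot_mod_def A_RCOSETS_def')
qed

lemma quot_module:
  assumes "module K M" "submodule N K M"
  shows "module K (quot_mod M N)"
proof -
  interpret M: module K M by fact
  interpret N: abelian_subgroup N M by (rule submodule_abelian_subgroup[OF assms(1,2)])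
  note pr = quot_proj_lin[OF assms]
  let ?Q = "quot_mod M N"
  have zero: "\<zero>\<^bsub>?Q\<^esub> = N +>\<^bsub>M\<^esub> \<zero>\<^bsub>M\<^esub>"
    using N.a_subset by (simp add: quot_mod_def)
  note s = lin_add[OF pr, symmetric] lin_smult[OF pr, symmetric] lin_closed[OF pr] zero
  have ag: "abelian_group ?Q"
  proof (rule abelian_groupI)
    fix X assume "X \<in> carrier ?Q"
    then obtain x where x: "x \<in> carrier M" "X = N +>\<^bsub>M\<^esub> x" by (rule quot_carrierE)
    show "\<exists>Y\<in>carrier ?Q. Y \<oplus>\<^bsub>?Q\<^esub> X = \<zero>\<^bsub>?Q\<^esub>"
      using x by (intro bexI[of _ "N +>\<^bsub>M\<^esub> (\<ominus>\<^bsub>M\<^esub> x)"]) (simp_all add: s M.M.l_neg)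
  qed (auto elim!: quot_carrierE simp: s M.M.a_ac)
  show ?thesis
  proof (rule moduleI[OF M.R.is_cring ag])
    fix c d X Y assume c: "c \<in> carrier K" and d: "d \<in> carrier K"
      and "X \<in> carrier ?Q" "Y \<in> carrier ?Q"
    then obtain x y where x: "x \<in> carrier M" "X = N +>\<^bsub>M\<^esub> x" and y: "y \<in> carrier M" "Y = N +>\<^bsub>M\<^esub> y"
      by (elim quot_carrierE)
    show "c \<odot>\<^bsub>?Q\<^esub> X \<in> carrier ?Q" using x c by (simp add: s)
    show "(c \<oplus>\<^bsub>K\<^esub> d) \<odot>\<^bsub>?Q\<^esub> X = c \<odot>\<^bsub>?Q\<^esub> X \<oplus>\<^bsub>?Q\<^esub> d \<odot>\<^bsub>?Q\<^esub> X"
      using x c d by (simp add: s M.smult_l_distr)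
    show "c \<odot>\<^bsub>?Q\<^esub> (X \<oplus>\<^bsub>?Q\<^esub> Y) = c \<odot>\<^bsub>?Q\<^esub> X \<oplus>\<^bsub>?Q\<^esub> c \<odot>\<^bsub>?Q\<^esub> Y"
      using x y c by (simp add: s M.smult_r_distr)
    show "(c \<otimes>\<^bsub>K\<^esub> d) \<odot>\<^bsub>?Q\<^esub> X = c \<odot>\<^bsub>?Q\<^esub> (d \<odot>\<^bsub>?Q\<^esub> X)"
      using x c d by (simp add: s M.smult_assoc1)
  next
    fix X assume "X \<in> carrier ?Q"
    then obtain x where "x \<in> carrier M" "X = N +>\<^bsub>M\<^esub> x" by (elim quot_carrierE)
    then show "\<one>\<^bsub>K\<^esub> \<odot>\<^bsub>?Q\<^esub> X = X" by (simp add: s)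
  qed
qed

text \<open>
  All operations of a quotient are set operations on cosets, and taking direct images under a linear
  bijection respects these, so \<open>X \<mapsto> f ` X\<close> is the induced map of the quotients.
\<close>

lemma quot_mod_isomorphic:
  assumes "module K M" "module K M'" and f: "f \<in> lin_maps K M M'"
    and bij: "bij_betw f (carrier M) (carrier M')"
    and "N \<subseteq> carrier M" "Z \<subseteq> carrier M"
  shows "mod_isomorphic K (quot_mod (M\<lparr>carrier := Z\<rparr>) N) (quot_mod (M'\<lparr>carrier := f ` Z\<rparr>) (f ` N))"
proof -
  interpret M: module K M by fact
  interpret M': module K M' by fact
  let ?Q = "quot_mod (M\<lparr>carrier := Z\<rparr>) N" and ?Q' = "quot_mod (M'\<lparr>carrier := f ` Z\<rparr>) (f ` N)"
  have coset: "f ` (N +>\<^bsub>M\<^esub> z) = f ` N +>\<^bsub>M'\<^esub> f z" if "z \<in> carrier M" for z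
  proof -
    have "f (n \<oplus>\<^bsub>M\<^esub> z) = f n \<oplus>\<^bsub>M'\<^esub> f z" if "n \<in> N" for n
      using assms(5) that \<open>z \<in> carrier M\<close> by (intro lin_add[OF f]) auto
    then show ?thesis by (auto simp: a_r_coset_def' image_iff; blast)
  qed
  have car: "carrier ?Q = (\<lambda>z. N +>\<^bsub>M\<^esub> z) ` Z"
    "carrier ?Q' = (\<lambda>z. f ` N +>\<^bsub>M'\<^esub> z) ` f ` Z"
    by (auto simp: quot_mod_def A_RCOSETS_def' a_r_coset_def')
  have sub: "X \<subseteq> carrier M" if "X \<in> carrier ?Q" for X
    using that assms(5,6) by (auto simp: car a_r_coset_def')
  have sm: "c \<odot>\<^bsub>?Q\<^esub> X = (\<Union>x\<in>X. N +>\<^bsub>M\<^esub> (c \<odot>\<^bsub>M\<^esub> x))"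
    "c \<odot>\<^bsub>?Q'\<^esub> Y = (\<Union>y\<in>Y. f ` N +>\<^bsub>M'\<^esub> (c \<odot>\<^bsub>M'\<^esub> y))" for c X Y
    by (auto simp: quot_mod_def a_r_coset_def')
  have ad: "X \<oplus>\<^bsub>?Q\<^esub> Y = (\<Union>x\<in>X. \<Union>y\<in>Y. {x \<oplus>\<^bsub>M\<^esub> y})"
    "X' \<oplus>\<^bsub>?Q'\<^esub> Y' = (\<Union>x\<in>X'. \<Union>y\<in>Y'. {x \<oplus>\<^bsub>M'\<^esub> y})" for X Y X' Y'
    by (auto simp: quot_mod_def set_add_def')
  have "(\<lambda>X. f ` X) \<in> lin_maps K ?Q ?Q'"
  proof (rule lin_mapsI)
    fix X assume "X \<in> carrier ?Q"
    then show "f ` X \<in> carrier ?Q'"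
      using coset assms(6) by (auto simp: car)
  next
    fix X Y assume "X \<in> carrier ?Q" "Y \<in> carrier ?Q"
    then have "f (x \<oplus>\<^bsub>M\<^esub> y) = f x \<oplus>\<^bsub>M'\<^esub> f y" if "x \<in> X" "y \<in> Y" for x y
      using that sub by (intro lin_add[OF f]) auto
    then show "f ` (X \<oplus>\<^bsub>?Q\<^esub> Y) = f ` X \<oplus>\<^bsub>?Q'\<^esub> f ` Y"
      unfolding ad image_UN by auto
  next
    fix c X assume c: "c \<in> carrier K" and X: "X \<in> carrier ?Q"
    have "f ` (N +>\<^bsub>M\<^esub> (c \<odot>\<^bsub>M\<^esub> x)) = f ` N +>\<^bsub>M'\<^esub> (c \<odot>\<^bsub>M'\<^esub> f x)" if "x \<in> X" for x
      using c sub[OF X] that by (subst coset) (auto simp: lin_smult[OF f])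
    then show "f ` (c \<odot>\<^bsub>?Q\<^esub> X) = c \<odot>\<^bsub>?Q'\<^esub> f ` X"
      unfolding sm image_UN by auto
  qed
  moreover have "bij_betw (\<lambda>X. f ` X) (carrier ?Q) (carrier ?Q')"
    unfolding bij_betw_def
  proof
    have "inj_on f (carrier M)" using bij by (simp add: bij_betw_def)
    then show "inj_on ((`) f) (carrier ?Q)"
      using sub by (meson inj_onI inj_on_image_eq_iff)
    show "(`) f ` carrier ?Q = carrier ?Q'"
      unfolding car image_image using coset assms(6) by (intro image_cong refl) auto
  qed
  ultimately show ?thesis by (auto simp: mod_isomorphic_def)
qed


text \<open>
  The form in which complexes are compared: \<open>f\<close> and \<open>g\<close> are the components of a chain map in two
  consecutive degrees, and \<open>N\<close> is the image of the incoming differential.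
\<close>

lemma subquot_isomorphic:
  assumes M: "module K M" "module K M'" and f: "f \<in> lin_maps K M M'"
    and bij: "bij_betw f (carrier M) (carrier M')"
    and R: "module K R" "module K R'" and g: "g \<in> lin_maps K R R'" and inj: "inj_on g (carrier R)"
    and d: "\<And>x. x \<in> carrier M \<Longrightarrow> d x \<in> carrier R"
    and comm: "\<And>x. x \<in> carrier M \<Longrightarrow> d' (f x) = g (d x)"
    and N: "N \<subseteq> carrier M" and N': "N' = f ` N"
  shows "mod_isomorphic K
    (quot_mod (M\<lparr>carrier := {x \<in> carrier M. d x = \<zero>\<^bsub>R\<^esub>}\<rparr>) N)
    (quot_mod (M'\<lparr>carrier := {y \<in> carrier M'. d' y = \<zero>\<^bsub>R'\<^esub>}\<rparr>) N')"
proof -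
  interpret R: module K R by fact
  have zero: "g r = \<zero>\<^bsub>R'\<^esub> \<longleftrightarrow> r = \<zero>\<^bsub>R\<^esub>" if "r \<in> carrier R" for r
    using lin_zero[OF R g] inj_onD[OF inj, of r "\<zero>\<^bsub>R\<^esub>"] that by auto
  have surj: "f ` carrier M = carrier M'" using bij by (simp add: bij_betw_def)
  have "f ` {x \<in> carrier M. d x = \<zero>\<^bsub>R\<^esub>} = {y \<in> f ` carrier M. d' y = \<zero>\<^bsub>R'\<^esub>}"
    using comm zero[OF d] by fastforce
  then have "{y \<in> carrier M'. d' y = \<zero>\<^bsub>R'\<^esub>} = f ` {x \<in> carrier M. d x = \<zero>\<^bsub>R\<^esub>}"
    unfolding surj by (rule sym)
  then show ?thesis
    using quot_mod_isomorphic[OF M f bij N, of "{x \<in> carrier M. d x = \<zero>\<^bsub>R\<^esub>}"] N' by auto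
qed


section \<open>Modules presented by generators and relations\<close>

text \<open>
  The sum that defines \<^const>\<open>pres_lift\<close>, as a function of the representative.
\<close>

definition free_ext ::
  "('k, 'r) ring_scheme \<Rightarrow> ('k, 'p, 't) module_scheme \<Rightarrow> ('s \<Rightarrow> 'p) \<Rightarrow> ('s \<Rightarrow> 'k) \<Rightarrow> 'p"
where
  "free_ext K P \<phi> x = (\<Oplus>\<^bsub>P\<^esub>s\<in>{s. x s \<noteq> \<zero>\<^bsub>K\<^esub>}. x s \<odot>\<^bsub>P\<^esub> \<phi> s)"

lemma free_carrierD:
  assumes "x \<in> carrier (free_mod K S)"
  shows "x s \<in> carrier K" "finite {s. x s \<noteq> \<zero>\<^bsub>K\<^esub>}" "{s. x s \<noteq> \<zero>\<^bsub>K\<^esub>} \<subseteq> S"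
  using assms by (auto simp: free_mod_def)

lemma free_sel [simp]:
  "\<zero>\<^bsub>free_mod K S\<^esub> = (\<lambda>s. \<zero>\<^bsub>K\<^esub>)"
  "x \<oplus>\<^bsub>free_mod K S\<^esub> y = (\<lambda>s. x s \<oplus>\<^bsub>K\<^esub> y s)"
  "c \<odot>\<^bsub>free_mod K S\<^esub> x = (\<lambda>s. c \<otimes>\<^bsub>K\<^esub> x s)"
  by (auto simp: free_mod_def)

lemma free_module:
  assumes "cring K"
  shows "module K (free_mod K S)"
proof -
  interpret K: cring K by fact
  let ?F = "free_mod K S"
  have clos: "(\<lambda>s. x s \<oplus>\<^bsub>K\<^esub> y s) \<in> carrier ?F" if "x \<in> carrier ?F" "y \<in> carrier ?F" for x y
  proof -
    have "{s. x s \<oplus>\<^bsub>K\<^esub> y s \<noteq> \<zero>\<^bsub>K\<^esub>} \<subseteq> {s. x s \<noteq> \<zero>\<^bsub>K\<^esub>} \<union> {s. y s \<noteq> \<zero>\<^bsub>K\<^esub>}" by auto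
    moreover have "finite ({s. x s \<noteq> \<zero>\<^bsub>K\<^esub>} \<union> {s. y s \<noteq> \<zero>\<^bsub>K\<^esub>})"
      using that by (simp add: free_mod_def)
    ultimately show ?thesis using that
      by (auto simp: free_mod_def intro: finite_subset)
  qed
  have clos2: "(\<lambda>s. c \<otimes>\<^bsub>K\<^esub> x s) \<in> carrier ?F" if "x \<in> carrier ?F" "c \<in> carrier K" for c x
  proof -
    have "{s. c \<otimes>\<^bsub>K\<^esub> x s \<noteq> \<zero>\<^bsub>K\<^esub>} \<subseteq> {s. x s \<noteq> \<zero>\<^bsub>K\<^esub>}" using that by auto
    then show ?thesis using that
      by (auto simp: free_mod_def intro: finite_subset)
  qed
  have neg: "(\<lambda>s. \<ominus>\<^bsub>K\<^esub> x s) \<in> carrier ?F" if "x \<in> carrier ?F" for x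
  proof -
    have "{s. \<ominus>\<^bsub>K\<^esub> x s \<noteq> \<zero>\<^bsub>K\<^esub>} \<subseteq> {s. x s \<noteq> \<zero>\<^bsub>K\<^esub>}" by auto
    then show ?thesis using that
      by (auto simp: free_mod_def intro: finite_subset)
  qed
  have "abelian_group ?F"
  proof (rule abelian_groupI)
    fix x assume "x \<in> carrier ?F"
    then show "\<exists>y\<in>carrier ?F. y \<oplus>\<^bsub>?F\<^esub> x = \<zero>\<^bsub>?F\<^esub>"
      by (intro bexI[OF _ neg]) (auto simp: free_carrierD K.l_neg)
  next
    show "\<zero>\<^bsub>?F\<^esub> \<in> carrier ?F" by (auto simp: free_mod_def)
  qed (auto simp: clos free_carrierD K.a_ac)
  then show ?thesis
    by (intro moduleI)
      (auto simp: assms clos clos2 free_carrierD K.l_distr K.r_distr K.m_assoc)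
qed

lemma free_gen_carrier:
  assumes "cring K" "s \<in> S"
  shows "free_gen K s \<in> carrier (free_mod K S)"
proof -
  interpret K: cring K by fact
  have "{t. free_gen K s t \<noteq> \<zero>\<^bsub>K\<^esub>} \<subseteq> {s}" by (auto simp: free_gen_def)
  then show ?thesis using assms(2)
    by (auto simp: free_mod_def free_gen_def intro: finite_subset split: if_splits)
qed

lemma free_induct:
  assumes "cring K" and x: "x \<in> carrier (free_mod K S)"
    and zero: "Q \<zero>\<^bsub>free_mod K S\<^esub>"
    and step: "\<And>c s y. c \<in> carrier K \<Longrightarrow> s \<in> S \<Longrightarrow> y \<in> carrier (free_mod K S) \<Longrightarrow> Q y \<Longrightarrow>
      Q ((c \<odot>\<^bsub>free_mod K S\<^esub> free_gen K s) \<oplus>\<^bsub>free_mod K S\<^esub> y)"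
  shows "Q x"
proof -
  interpret K: cring K by fact
  have "\<forall>x. x \<in> carrier (free_mod K S) \<longrightarrow> {s. x s \<noteq> \<zero>\<^bsub>K\<^esub>} = T \<longrightarrow> Q x" if "finite T" for T
    using that
  proof (induction T)
    case empty
    have "x = (\<lambda>s. \<zero>\<^bsub>K\<^esub>)" if "{s. x s \<noteq> \<zero>\<^bsub>K\<^esub>} = {}" for x :: "'b \<Rightarrow> 'a"
      using that by auto
    then show ?case using zero by auto
  next
    case (insert s T)
    show ?case
    proof (intro allI impI)
      fix x assume x: "x \<in> carrier (free_mod K S)" and sup: "{s. x s \<noteq> \<zero>\<^bsub>K\<^esub>} = insert s T"
      let ?y = "x(s := \<zero>\<^bsub>K\<^esub>)"
      have supy: "{t. ?y t \<noteq> \<zero>\<^bsub>K\<^esub>} = T" using sup insert(2) by auto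
      have y: "?y \<in> carrier (free_mod K S)"
        unfolding free_mod_def using x insert(1) sup supy
        by (auto simp: free_mod_def)
      have s: "s \<in> S" using x sup by (auto simp: free_mod_def)
      have "x = (x s \<odot>\<^bsub>free_mod K S\<^esub> free_gen K s) \<oplus>\<^bsub>free_mod K S\<^esub> ?y"
        using free_carrierD(1)[OF x] by (auto simp: free_gen_def fun_eq_iff)
      then show "Q x"
        using step[OF free_carrierD(1)[OF x] s y] insert(3) y supy by metis
    qed
  qed
  then show ?thesis using x free_carrierD(2)[OF x] by blast
qed

lemma free_ext_superset:
  assumes "module K P" "x \<in> carrier (free_mod K S)" "\<And>s. s \<in> S \<Longrightarrow> \<phi> s \<in> carrier P"
    and "finite T" "{s. x s \<noteq> \<zero>\<^bsub>K\<^esub>} \<subseteq> T" "T \<subseteq> S"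
  shows "free_ext K P \<phi> x = (\<Oplus>\<^bsub>P\<^esub>s\<in>T. x s \<odot>\<^bsub>P\<^esub> \<phi> s)"
proof -
  interpret P: module K P by fact
  show ?thesis
    unfolding free_ext_def using assms free_carrierD(1)[OF assms(2)]
    by (intro P.M.add.finprod_mono_neutral_cong_left) auto
qed

lemma free_ext_gen:
  assumes "module K P" "s \<in> S" "\<And>s. s \<in> S \<Longrightarrow> \<phi> s \<in> carrier P"
  shows "free_ext K P \<phi> (free_gen K s) = \<phi> s"
proof -
  interpret P: module K P by fact
  have "free_ext K P \<phi> (free_gen K s) = (\<Oplus>\<^bsub>P\<^esub>t\<in>{s}. free_gen K s t \<odot>\<^bsub>P\<^esub> \<phi> t)"
    using assms by (intro free_ext_superset[where S = S] free_gen_carrier P.R.is_cring)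
      (auto simp: free_gen_def)
  then show ?thesis using assms by (simp add: free_gen_def)
qed

lemma free_ext_lin:
  assumes "module K P" and phi: "\<And>s. s \<in> S \<Longrightarrow> \<phi> s \<in> carrier P"
  shows "free_ext K P \<phi> \<in> lin_maps K (free_mod K S) P"
proof -
  interpret P: module K P by fact
  interpret F: module K "free_mod K S" by (rule free_module) (rule P.R.is_cring)
  show ?thesis
  proof (rule lin_mapsI)
    fix x assume x: "x \<in> carrier (free_mod K S)"
    show "free_ext K P \<phi> x \<in> carrier P"
      unfolding free_ext_def using free_carrierD[OF x] phi by (intro P.M.finsum_closed) auto
  next
    fix x y assume x: "x \<in> carrier (free_mod K S)" and y: "y \<in> carrier (free_mod K S)"
    let ?T = "{s. x s \<noteq> \<zero>\<^bsub>K\<^esub>} \<union> {s. y s \<noteq> \<zero>\<^bsub>K\<^esub>}"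
    note [simp] = free_carrierD(1)[OF x] free_carrierD(1)[OF y]
    have T: "finite ?T" "?T \<subseteq> S" using free_carrierD[OF x] free_carrierD[OF y] by auto
    have phiT: "\<And>s. s \<in> ?T \<Longrightarrow> \<phi> s \<in> carrier P" using T phi by blast
    have "free_ext K P \<phi> (x \<oplus>\<^bsub>free_mod K S\<^esub> y)
        = (\<Oplus>\<^bsub>P\<^esub>s\<in>?T. (x \<oplus>\<^bsub>free_mod K S\<^esub> y) s \<odot>\<^bsub>P\<^esub> \<phi> s)"
      using T x y phi by (intro free_ext_superset[where S = S] assms(1) F.M.a_closed) auto
    also have "\<dots> = (\<Oplus>\<^bsub>P\<^esub>s\<in>?T. x s \<odot>\<^bsub>P\<^esub> \<phi> s \<oplus>\<^bsub>P\<^esub> y s \<odot>\<^bsub>P\<^esub> \<phi> s)"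
      using phiT by (intro P.M.finsum_cong') (auto simp: P.smult_l_distr)
    also have "\<dots> = (\<Oplus>\<^bsub>P\<^esub>s\<in>?T. x s \<odot>\<^bsub>P\<^esub> \<phi> s) \<oplus>\<^bsub>P\<^esub> (\<Oplus>\<^bsub>P\<^esub>s\<in>?T. y s \<odot>\<^bsub>P\<^esub> \<phi> s)"
      using phiT by (intro P.M.finsum_addf) auto
    also have "\<dots> = free_ext K P \<phi> x \<oplus>\<^bsub>P\<^esub> free_ext K P \<phi> y"
      using T phi x y by (subst (1 2) free_ext_superset[where S = S and T = ?T]) (auto simp: assms(1))
    finally show "free_ext K P \<phi> (x \<oplus>\<^bsub>free_mod K S\<^esub> y) = free_ext K P \<phi> x \<oplus>\<^bsub>P\<^esub> free_ext K P \<phi> y" .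
  next
    fix c x assume c: "c \<in> carrier K" and x: "x \<in> carrier (free_mod K S)"
    let ?T = "{s. x s \<noteq> \<zero>\<^bsub>K\<^esub>}"
    note [simp] = free_carrierD(1)[OF x] c
    have T: "finite ?T" "?T \<subseteq> S" using free_carrierD[OF x] by auto
    have phiT: "\<And>s. s \<in> ?T \<Longrightarrow> \<phi> s \<in> carrier P" using T phi by blast
    have "free_ext K P \<phi> (c \<odot>\<^bsub>free_mod K S\<^esub> x)
        = (\<Oplus>\<^bsub>P\<^esub>s\<in>?T. (c \<odot>\<^bsub>free_mod K S\<^esub> x) s \<odot>\<^bsub>P\<^esub> \<phi> s)"
      using T x phi c by (intro free_ext_superset[where S = S] assms(1) F.smult_closed) auto
    also have "\<dots> = (\<Oplus>\<^bsub>P\<^esub>s\<in>?T. c \<odot>\<^bsub>P\<^esub> (x s \<odot>\<^bsub>P\<^esub> \<phi> s))"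
      using phiT by (intro P.M.finsum_cong') (auto simp: P.smult_assoc1)
    also have "\<dots> = c \<odot>\<^bsub>P\<^esub> free_ext K P \<phi> x"
      unfolding free_ext_def using phiT T by (intro P.finsum_smult_ldistr[symmetric]) auto
    finally show "free_ext K P \<phi> (c \<odot>\<^bsub>free_mod K S\<^esub> x) = c \<odot>\<^bsub>P\<^esub> free_ext K P \<phi> x" .
  qed
qed

lemma submod_span_submodule:
  assumes "module K M" "R \<subseteq> carrier M"
  shows "submodule (submod_span K M R) K M" "R \<subseteq> submod_span K M R"
proof -
  interpret M: module K M by fact
  have sub: "submod_span K M R \<subseteq> carrier M"
    using M.carrier_is_submodule assms(2) unfolding submod_span_def by blast
  have mem: "x \<in> submod_span K M R \<longleftrightarrow> (\<forall>N. submodule N K M \<and> R \<subseteq> N \<longrightarrow> x \<in> N)" for x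
    by (auto simp: submod_span_def)
  have zero: "\<zero>\<^bsub>M\<^esub> \<in> N" if "submodule N K M" for N
    using subgroup.one_closed[OF submodule.axioms(1)[OF that]] by simp
  show "submodule (submod_span K M R) K M"
    by (rule M.submoduleI[OF sub]; unfold mem) (simp_all add: zero M.submoduleE)
qed (auto simp: submod_span_def)

lemma lin_kernel_submodule:
  assumes "module K M" "module K P" "f \<in> lin_maps K M P"
  shows "submodule {x \<in> carrier M. f x = \<zero>\<^bsub>P\<^esub>} K M"
proof -
  interpret M: module K M by fact
  interpret P: module K P by fact
  show ?thesis
    by (rule M.submoduleI)
      (auto simp: lin_zero[OF assms] lin_uminus[OF assms] lin_add[OF assms(3)] lin_smult[OF assms(3)])
qed

lemma lin_vanish_span:
  assumes "module K M" "module K P" "f \<in> lin_maps K M P"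
    and "R \<subseteq> carrier M" "\<And>r. r \<in> R \<Longrightarrow> f r = \<zero>\<^bsub>P\<^esub>" "x \<in> submod_span K M R"
  shows "f x = \<zero>\<^bsub>P\<^esub>"
  using lin_kernel_submodule[OF assms(1-3)] assms(4-6) unfolding submod_span_def by blast

lemma free_lin_eqI:
  assumes "module K P" "f \<in> lin_maps K (free_mod K S) P" "g \<in> lin_maps K (free_mod K S) P"
    and "\<And>s. s \<in> S \<Longrightarrow> f (free_gen K s) = g (free_gen K s)" "x \<in> carrier (free_mod K S)"
  shows "f x = g x"
proof -
  have K: "cring K" using assms(1) by (rule module.axioms(1))
  interpret F: module K "free_mod K S" by (rule free_module[OF K])
  show ?thesis
  proof (rule free_induct[OF K assms(5)])
    show "f \<zero>\<^bsub>free_mod K S\<^esub> = g \<zero>\<^bsub>free_mod K S\<^esub>"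
      using lin_zero[OF F.module_axioms assms(1)] assms(2,3) by metis
  next
    fix c s y
    assume "c \<in> carrier K" "s \<in> S" "y \<in> carrier (free_mod K S)" "f y = g y"
    then show "f ((c \<odot>\<^bsub>free_mod K S\<^esub> free_gen K s) \<oplus>\<^bsub>free_mod K S\<^esub> y)
        = g ((c \<odot>\<^bsub>free_mod K S\<^esub> free_gen K s) \<oplus>\<^bsub>free_mod K S\<^esub> y)"
      using assms(4) by (simp add: lin_add[OF assms(2)] lin_add[OF assms(3)] lin_smult[OF assms(2)]
        lin_smult[OF assms(3)] free_gen_carrier[OF K] del: free_sel)
  qed
qed

lemma free_ext_hom:
  assumes "module K P" "module K P'" "f \<in> lin_maps K P P'"
    and "\<And>s. s \<in> S \<Longrightarrow> \<phi> s \<in> carrier P" and x: "x \<in> carrier (free_mod K S)"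
  shows "f (free_ext K P \<phi> x) = free_ext K P' (\<lambda>s. f (\<phi> s)) x"
proof -
  interpret P: module K P by fact
  interpret P': module K P' by fact
  have 1: "\<And>s. x s \<noteq> \<zero>\<^bsub>K\<^esub> \<Longrightarrow> \<phi> s \<in> carrier P" using assms(4) free_carrierD[OF x] by blast
  show ?thesis
    unfolding free_ext_def using 1 free_carrierD[OF x] assms(3)
    by (subst lin_finsum[OF assms(1-3)])
      (auto intro!: P'.M.finsum_cong' simp: lin_smult[OF assms(3)] lin_closed[OF assms(3)])
qed

lemma free_ext_param:
  assumes "module K Q" "module K P"
    and "\<And>s. s \<in> S \<Longrightarrow> (\<lambda>u. \<phi> u s) \<in> lin_maps K Q P" and x: "x \<in> carrier (free_mod K S)"
  shows "(\<lambda>u. free_ext K P (\<phi> u) x) \<in> lin_maps K Q P"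
  unfolding free_ext_def using assms(3) free_carrierD[OF x]
  by (intro lin_finsum_maps[OF assms(1,2)] lin_comp[OF _ lin_smult_map[OF assms(2)]]) auto

text \<open>
  Both sides are linear in \<open>x\<close>, so it is enough to compare them at the free generators.
\<close>

lemma free_ext_swap:
  assumes "module K P" "\<And>s t. s \<in> S \<Longrightarrow> t \<in> T \<Longrightarrow> B s t \<in> carrier P"
    and x: "x \<in> carrier (free_mod K S)" and y: "y \<in> carrier (free_mod K T)"
  shows "free_ext K P (\<lambda>s. free_ext K P (B s) y) x
    = free_ext K P (\<lambda>t. free_ext K P (\<lambda>s. B s t) x) y"
proof -
  have K: "cring K" using assms(1) by (rule module.axioms(1))
  note ext = free_ext_lin[OF assms(1), THEN lin_closed, OF _ y]
  show ?thesis
  proof (rule free_lin_eqI[OF assms(1) _ _ _ x])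
    show "(\<lambda>x. free_ext K P (\<lambda>s. free_ext K P (B s) y) x) \<in> lin_maps K (free_mod K S) P"
      by (intro free_ext_lin assms(1) ext assms(2))
    show "(\<lambda>x. free_ext K P (\<lambda>t. free_ext K P (\<lambda>s. B s t) x) y) \<in> lin_maps K (free_mod K S) P"
      by (intro free_ext_param[where S = T] free_module[OF K] assms(1) y free_ext_lin assms(2))
  next
    fix s assume s: "s \<in> S"
    have "free_ext K P (\<lambda>s. free_ext K P (B s) y) (free_gen K s) = free_ext K P (B s) y"
      by (intro free_ext_gen[where S = S] assms(1,2) s ext)
    moreover have "free_ext K P (\<lambda>t. free_ext K P (\<lambda>s. B s t) (free_gen K s)) y
        = free_ext K P (B s) y"
      unfolding free_ext_def[of K P _ y] using free_carrierD[OF y] assms(1,2) s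
      by (intro abelian_monoid.finsum_cong')
        (auto simp: module_def abelian_group_def free_ext_gen[where S = S] subset_iff
          intro!: module.smult_closed)
    ultimately show "free_ext K P (\<lambda>s. free_ext K P (B s) y) (free_gen K s)
        = free_ext K P (\<lambda>t. free_ext K P (\<lambda>s. B s t) (free_gen K s)) y" by simp
  qed
qed

locale presentation =
  fixes K :: "('k, 'r) ring_scheme" and S :: "'s set" and R :: "('s \<Rightarrow> 'k) set"
  assumes cring: "cring K" and rels: "R \<subseteq> carrier (free_mod K S)"
begin

abbreviation "F \<equiv> free_mod K S"
abbreviation "N \<equiv> submod_span K F R"
abbreviation "G \<equiv> pres_mod K S R"

lemma F_module: "module K F" by (rule free_module[OF cring])

lemma N_submodule: "submodule N K F"
  by (rule submod_span_submodule[OF F_module rels])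

lemma pres_module: "module K G"
  unfolding pres_mod_def by (rule quot_module[OF F_module N_submodule])

lemma proj_lin: "(\<lambda>x. N +>\<^bsub>F\<^esub> x) \<in> lin_maps K F G"
  unfolding pres_mod_def by (rule quot_proj_lin[OF F_module N_submodule])

lemma pres_gen_closed: "s \<in> S \<Longrightarrow> pres_gen K S R s \<in> carrier G"
  unfolding pres_gen_def by (intro lin_closed[OF proj_lin] free_gen_carrier cring)

lemma pres_rep:
  assumes "X \<in> carrier G"
  shows "(SOME x. x \<in> X) \<in> carrier F" "(SOME x. x \<in> X) \<in> X"
proof -
  interpret F: module K F by (rule F_module)
  interpret N: abelian_subgroup N F by (rule submodule_abelian_subgroup[OF F_module N_submodule])
  obtain x where x: "x \<in> carrier F" "X = N +>\<^bsub>F\<^esub> x"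
    using assms unfolding pres_mod_def by (rule quot_carrierE)
  then show X: "(SOME x. x \<in> X) \<in> X" using N.a_rcos_self[OF x(1)] by (metis someI)
  have "X \<subseteq> carrier F" unfolding x(2) by (intro F.M.a_r_coset_subset_G N.a_subset x(1))
  with X show "(SOME x. x \<in> X) \<in> carrier F" by blast
qed

text \<open>
  The chosen representative of a coset does not depend on \<open>\<phi>\<close>. So \<^const>\<open>pres_lift\<close> is, for every
  \<open>\<phi>\<close> with values in the module, a finite linear combination of values of \<open>\<phi>\<close> whose coefficients
  depend on the coset alone; linearity in \<open>\<phi>\<close>, compatibility with linear maps and interchange of two
  such combinations follow from this. Respecting the relations is what linearity in the coset and
  the value at the generators depend on.
\<close>

lemma pres_lift_rep: "pres_lift K P \<phi> X = free_ext K P \<phi> (SOME x. x \<in> X)"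
  by (simp add: pres_lift_def free_ext_def Let_def)

lemma pres_lift_closed:
  assumes "module K P" "\<And>s. s \<in> S \<Longrightarrow> \<phi> s \<in> carrier P" "X \<in> carrier G"
  shows "pres_lift K P \<phi> X \<in> carrier P"
  unfolding pres_lift_rep
  by (rule lin_closed[OF free_ext_lin[OF assms(1,2)] pres_rep(1)[OF assms(3)]])

lemma pres_lift_cong:
  assumes "module K P" "\<And>s. s \<in> S \<Longrightarrow> \<phi> s \<in> carrier P" "\<And>s. s \<in> S \<Longrightarrow> \<psi> s = \<phi> s"
    and "X \<in> carrier G"
  shows "pres_lift K P \<psi> X = pres_lift K P \<phi> X"
proof -
  interpret P: module K P by fact
  note r = free_carrierD[OF pres_rep(1)[OF assms(4)]]
  show ?thesis
    unfolding pres_lift_rep free_ext_def using r assms(2,3)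
    by (intro P.M.finsum_cong') (auto simp: subset_iff)
qed

lemma pres_lift_hom:
  assumes "module K P" "module K P'" "f \<in> lin_maps K P P'"
    and "\<And>s. s \<in> S \<Longrightarrow> \<phi> s \<in> carrier P" "X \<in> carrier G"
  shows "f (pres_lift K P \<phi> X) = pres_lift K P' (\<lambda>s. f (\<phi> s)) X"
  unfolding pres_lift_rep by (rule free_ext_hom[OF assms(1-3) _ pres_rep(1)[OF assms(5)]]) (rule assms(4))

lemma pres_lift_param:
  assumes "module K Q" "module K P"
    and "\<And>s. s \<in> S \<Longrightarrow> (\<lambda>u. \<phi> u s) \<in> lin_maps K Q P" "X \<in> carrier G"
  shows "(\<lambda>u. pres_lift K P (\<phi> u) X) \<in> lin_maps K Q P"
  unfolding pres_lift_rep
  by (rule free_ext_param[OF assms(1,2) _ pres_rep(1)[OF assms(4)]]) (rule assms(3))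

lemma pres_lift_coset:
  assumes "module K P" "\<And>s. s \<in> S \<Longrightarrow> \<phi> s \<in> carrier P"
    and "\<And>r. r \<in> R \<Longrightarrow> free_ext K P \<phi> r = \<zero>\<^bsub>P\<^esub>" "x \<in> carrier F"
  shows "pres_lift K P \<phi> (N +>\<^bsub>F\<^esub> x) = free_ext K P \<phi> x"
proof -
  interpret P: module K P by fact
  interpret F: module K F by (rule F_module)
  interpret N: abelian_subgroup N F by (rule submodule_abelian_subgroup[OF F_module N_submodule])
  note ext = free_ext_lin[OF assms(1), of S \<phi>, OF assms(2)]
  let ?y = "SOME y. y \<in> N +>\<^bsub>F\<^esub> x"
  have "N +>\<^bsub>F\<^esub> x \<in> carrier G" by (rule lin_closed[OF proj_lin assms(4)])
  then have "?y \<in> N +>\<^bsub>F\<^esub> x" by (rule pres_rep)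
  then obtain n where n: "n \<in> N" "?y = n \<oplus>\<^bsub>F\<^esub> x" by (auto simp: a_r_coset_def')
  have n0: "free_ext K P \<phi> n = \<zero>\<^bsub>P\<^esub>"
    using lin_vanish_span[OF F_module assms(1) ext rels assms(3) n(1)] by simp
  have "free_ext K P \<phi> ?y = free_ext K P \<phi> n \<oplus>\<^bsub>P\<^esub> free_ext K P \<phi> x"
    unfolding n(2) using n(1) assms(4) N.a_subset by (intro lin_add[OF ext]) auto
  then show ?thesis
    unfolding pres_lift_rep n0 using lin_closed[OF ext assms(4)] by simp
qed

lemma pres_lift_gen:
  assumes "module K P" "\<And>s. s \<in> S \<Longrightarrow> \<phi> s \<in> carrier P"
    and "\<And>r. r \<in> R \<Longrightarrow> free_ext K P \<phi> r = \<zero>\<^bsub>P\<^esub>" "s \<in> S"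
  shows "pres_lift K P \<phi> (pres_gen K S R s) = \<phi> s"
  unfolding pres_gen_def
  by (subst pres_lift_coset) (auto intro: assms free_gen_carrier cring free_ext_gen[OF _ assms(4)])

lemma pres_lift_lin:
  assumes "module K P" "\<And>s. s \<in> S \<Longrightarrow> \<phi> s \<in> carrier P"
    and "\<And>r. r \<in> R \<Longrightarrow> free_ext K P \<phi> r = \<zero>\<^bsub>P\<^esub>"
  shows "pres_lift K P \<phi> \<in> lin_maps K G P"
proof -
  interpret F: module K F by (rule F_module)
  note ext = free_ext_lin[OF assms(1), of S \<phi>, OF assms(2)]
  note c = pres_lift_coset[OF assms]
  note pr = lin_add[OF proj_lin, symmetric] lin_smult[OF proj_lin, symmetric]
  have E: "\<exists>x\<in>carrier F. X = N +>\<^bsub>F\<^esub> x" if "X \<in> carrier G" for X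
    using that unfolding pres_mod_def by (auto elim: quot_carrierE)
  show ?thesis
  proof (rule lin_mapsI)
    show "pres_lift K P \<phi> X \<in> carrier P" if "X \<in> carrier G" for X
      by (rule pres_lift_closed[OF assms(1,2) that])
  next
    fix X Y assume "X \<in> carrier G" "Y \<in> carrier G"
    then obtain x y where xy: "x \<in> carrier F" "y \<in> carrier F" "X = N +>\<^bsub>F\<^esub> x" "Y = N +>\<^bsub>F\<^esub> y"
      using E by blast
    then show "pres_lift K P \<phi> (X \<oplus>\<^bsub>G\<^esub> Y) = pres_lift K P \<phi> X \<oplus>\<^bsub>P\<^esub> pres_lift K P \<phi> Y"
      by (simp only: pr c F.M.a_closed lin_add[OF ext])
  next
    fix a X assume "a \<in> carrier K" "X \<in> carrier G"
    then obtain x where xy: "x \<in> carrier F" "X = N +>\<^bsub>F\<^esub> x" using E by blast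
    then show "pres_lift K P \<phi> (a \<odot>\<^bsub>G\<^esub> X) = a \<odot>\<^bsub>P\<^esub> pres_lift K P \<phi> X"
      using \<open>a \<in> carrier K\<close> by (simp only: pr c F.smult_closed lin_smult[OF ext])
  qed
qed

lemma pres_lift_swap:
  fixes P :: "('k, 'p, 't) module_scheme"
  assumes "module K P" "presentation K T R'"
    and "\<And>s t. s \<in> S \<Longrightarrow> t \<in> T \<Longrightarrow> B s t \<in> carrier P"
    and "X \<in> carrier G" "Y \<in> carrier (pres_mod K T R')"
  shows "pres_lift K P (\<lambda>s. pres_lift K P (B s) Y) X
    = pres_lift K P (\<lambda>t. pres_lift K P (\<lambda>s. B s t) X) Y"
proof -
  interpret T: presentation K T R' by fact
  show ?thesis
    unfolding pres_lift_rep
    by (intro free_ext_swap[where S = S and T = T] assms pres_rep(1) T.pres_rep(1))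
qed

lemma pres_lin_eqI:
  assumes "module K P" "f \<in> lin_maps K G P" "g \<in> lin_maps K G P"
    and "\<And>s. s \<in> S \<Longrightarrow> f (pres_gen K S R s) = g (pres_gen K S R s)" "X \<in> carrier G"
  shows "f X = g X"
proof -
  obtain x where x: "x \<in> carrier F" "X = N +>\<^bsub>F\<^esub> x"
    using assms(5) unfolding pres_mod_def by (rule quot_carrierE)
  show ?thesis
    unfolding x(2)
    by (rule free_lin_eqI[OF assms(1) lin_comp[OF proj_lin assms(2)] lin_comp[OF proj_lin assms(3)] _ x(1)])
      (use assms(4) in \<open>simp add: pres_gen_def\<close>)
qed

text \<open>
  For tensor products this is the bilinearity of pure tensors, for Hochschild chains the
  multilinearity of the generators.
\<close>

lemma pres_gen_rel:
  assumes "r \<in> R"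
  shows "free_ext K G (pres_gen K S R) r = \<zero>\<^bsub>G\<^esub>"
proof -
  interpret F: module K F by (rule F_module)
  interpret N: abelian_subgroup N F by (rule submodule_abelian_subgroup[OF F_module N_submodule])
  have r: "r \<in> carrier F" "r \<in> N"
    using assms rels submod_span_submodule(2)[OF F_module rels] by auto
  have "free_ext K G (pres_gen K S R) r = N +>\<^bsub>F\<^esub> r"
    by (rule free_lin_eqI[OF pres_module _ proj_lin _ r(1)])
      (simp_all add: free_ext_lin pres_module pres_gen_closed
        free_ext_gen[OF pres_module _ pres_gen_closed], simp add: pres_gen_def)
  also have "\<dots> = \<zero>\<^bsub>G\<^esub>"
    using r by (simp add: N.a_rcos_const pres_mod_def quot_mod_def)
  finally show ?thesis .
qed

end


section \<open>The universal property of the tensor product\<close>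

definition bilin ::
  "('k, 'r) ring_scheme \<Rightarrow> ('k, 'm, 's) module_scheme \<Rightarrow> ('k, 'n, 't) module_scheme \<Rightarrow>
    ('k, 'p, 'u) module_scheme \<Rightarrow> ('m \<Rightarrow> 'n \<Rightarrow> 'p) \<Rightarrow> bool"
where
  "bilin K M N P B \<longleftrightarrow> (\<forall>y\<in>carrier N. (\<lambda>x. B x y) \<in> lin_maps K M P) \<and>
     (\<forall>x\<in>carrier M. (\<lambda>y. B x y) \<in> lin_maps K N P)"

text \<open>
  On \<open>\<Sum> x\<^sub>i \<otimes> y\<^sub>i\<close> the value is \<open>\<Sum> B x\<^sub>i y\<^sub>i\<close>. Calculations in Sweedler notation become
  calculations with this function, applied to a coaction or to a value of the translation map.
\<close>

definition tlift ::
  "('k, 'r) ring_scheme \<Rightarrow> ('k, 'p, 't) module_scheme \<Rightarrow> ('m \<Rightarrow> 'n \<Rightarrow> 'p) \<Rightarrow>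
    ('m \<times> 'n \<Rightarrow> 'k) set \<Rightarrow> 'p"
where
  "tlift K P B = pres_lift K P (\<lambda>(x, y). B x y)"

lemma bilinI:
  "(\<And>y. y \<in> carrier N \<Longrightarrow> (\<lambda>x. B x y) \<in> lin_maps K M P) \<Longrightarrow>
   (\<And>x. x \<in> carrier M \<Longrightarrow> (\<lambda>y. B x y) \<in> lin_maps K N P) \<Longrightarrow> bilin K M N P B"
  by (auto simp: bilin_def)

lemma bilinD:
  assumes "bilin K M N P B"
  shows "y \<in> carrier N \<Longrightarrow> (\<lambda>x. B x y) \<in> lin_maps K M P"
    and "x \<in> carrier M \<Longrightarrow> (\<lambda>y. B x y) \<in> lin_maps K N P"
    and "x \<in> carrier M \<Longrightarrow> y \<in> carrier N \<Longrightarrow> B x y \<in> carrier P"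
  using assms by (auto simp: bilin_def lin_maps_def)

lemma (in module) minus_zero_iff:
  assumes "x \<in> carrier M" "y \<in> carrier M"
  shows "x \<ominus>\<^bsub>M\<^esub> y = \<zero>\<^bsub>M\<^esub> \<longleftrightarrow> x = y"
  using assms M.minus_equality[of x "\<ominus>\<^bsub>M\<^esub> y"] by (auto simp: a_minus_def M.r_neg)

lemma free_ext_minus_gen:
  assumes "module K P" "\<And>s. s \<in> S \<Longrightarrow> \<phi> s \<in> carrier P" "s \<in> S" "z \<in> carrier (free_mod K S)"
  shows "free_ext K P \<phi> (free_gen K s \<ominus>\<^bsub>free_mod K S\<^esub> z) = \<zero>\<^bsub>P\<^esub> \<longleftrightarrow> \<phi> s = free_ext K P \<phi> z"
proof -
  interpret P: module K P by fact
  have K: "cring K" by (rule P.R.is_cring)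
  note F = free_module[OF K, of S]
  note ext = free_ext_lin[OF assms(1), of S \<phi>, OF assms(2)]
  have "free_ext K P \<phi> (free_gen K s \<ominus>\<^bsub>free_mod K S\<^esub> z) = \<phi> s \<ominus>\<^bsub>P\<^esub> free_ext K P \<phi> z"
    using assms by (simp add: lin_minus[OF F assms(1) ext] free_gen_carrier[OF K]
      free_ext_gen[where S = S])
  then show ?thesis
    using assms lin_closed[OF ext] by (simp add: P.minus_zero_iff)
qed

lemma free_ext_gen_add:
  assumes "module K P" "\<And>s. s \<in> S \<Longrightarrow> \<phi> s \<in> carrier P" "s \<in> S" "t \<in> S"
  shows "free_ext K P \<phi> (free_gen K s \<oplus>\<^bsub>free_mod K S\<^esub> free_gen K t) = \<phi> s \<oplus>\<^bsub>P\<^esub> \<phi> t"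
  using assms module.axioms(1)[OF assms(1)]
  by (subst lin_add[OF free_ext_lin[where S = S]]) (auto simp: free_gen_carrier free_ext_gen[where S = S])

lemma free_ext_gen_smult:
  assumes "module K P" "\<And>s. s \<in> S \<Longrightarrow> \<phi> s \<in> carrier P" "s \<in> S" "c \<in> carrier K"
  shows "free_ext K P \<phi> (c \<odot>\<^bsub>free_mod K S\<^esub> free_gen K s) = c \<odot>\<^bsub>P\<^esub> \<phi> s"
  using assms module.axioms(1)[OF assms(1)]
  by (subst lin_smult[OF free_ext_lin[where S = S]]) (auto simp: free_gen_carrier free_ext_gen[where S = S])

lemma free_minus_closed:
  assumes "cring K" "s \<in> S" "z \<in> carrier (free_mod K S)"
  shows "free_gen K s \<ominus>\<^bsub>free_mod K S\<^esub> z \<in> carrier (free_mod K S)"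
proof -
  interpret F: module K "free_mod K S" by (rule free_module) fact
  show ?thesis using assms by (intro F.M.minus_closed free_gen_carrier)
qed

lemma free_add_gen_closed:
  assumes "cring K" "s \<in> S" "t \<in> S"
  shows "free_gen K s \<oplus>\<^bsub>free_mod K S\<^esub> free_gen K t \<in> carrier (free_mod K S)"
proof -
  interpret F: module K "free_mod K S" by (rule free_module) fact
  show ?thesis using assms by (intro F.M.a_closed free_gen_carrier)
qed

lemma free_smult_gen_closed:
  assumes "cring K" "s \<in> S" "c \<in> carrier K"
  shows "c \<odot>\<^bsub>free_mod K S\<^esub> free_gen K s \<in> carrier (free_mod K S)"
proof -
  interpret F: module K "free_mod K S" by (rule free_module) fact
  show ?thesis using assms by (intro F.smult_closed free_gen_carrier)
qed

lemma tensor_presentation: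
  assumes "module K M" "module K N"
  shows "presentation K (carrier M \<times> carrier N) (tensor_rels K M N)"
proof -
  interpret M: module K M by fact
  interpret N: module K N by fact
  show ?thesis
    by (intro presentation.intro M.R.is_cring)
      (auto simp: tensor_rels_def Let_def intro!: free_minus_closed free_add_gen_closed
        free_smult_gen_closed M.R.is_cring simp del: free_sel)
qed

lemma bilin_tensor_rels:
  assumes "module K M" "module K N" "module K P" "bilin K M N P B" "r \<in> tensor_rels K M N"
  shows "free_ext K P (\<lambda>(x, y). B x y) r = \<zero>\<^bsub>P\<^esub>"
proof -
  interpret M: module K M by fact
  interpret N: module K N by fact
  let ?S = "carrier M \<times> carrier N" and ?\<phi> = "\<lambda>(x, y). B x y"
  have S: "\<And>s. s \<in> ?S \<Longrightarrow> ?\<phi> s \<in> carrier P" using bilinD(3)[OF assms(4)] by auto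
  note rel = free_ext_minus_gen[OF assms(3), of ?S ?\<phi>, OF S]
    free_ext_gen_add[OF assms(3), of ?S ?\<phi>, OF S] free_ext_gen_smult[OF assms(3), of ?S ?\<phi>, OF S]
    free_add_gen_closed[OF M.R.is_cring] free_smult_gen_closed[OF M.R.is_cring]
  show ?thesis
    using assms(5) unfolding tensor_rels_def Let_def
    by (elim UnE CollectE exE conjE)
      (simp_all del: free_sel add: rel bilinD(1)[OF assms(4), THEN lin_add]
        bilinD(1)[OF assms(4), THEN lin_smult] bilinD(2)[OF assms(4), THEN lin_add]
        bilinD(2)[OF assms(4), THEN lin_smult])
qed

lemma tensor_rels_bilin:
  assumes "module K M" "module K N" "module K P"
    and B: "\<And>x y. x \<in> carrier M \<Longrightarrow> y \<in> carrier N \<Longrightarrow> B x y \<in> carrier P"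
    and R: "\<And>r. r \<in> tensor_rels K M N \<Longrightarrow> free_ext K P (\<lambda>(x, y). B x y) r = \<zero>\<^bsub>P\<^esub>"
  shows "bilin K M N P B"
proof -
  interpret M: module K M by fact
  interpret N: module K N by fact
  let ?S = "carrier M \<times> carrier N" and ?\<phi> = "\<lambda>(x, y). B x y"
  let ?F = "free_mod K ?S"
  have S: "\<And>s. s \<in> ?S \<Longrightarrow> ?\<phi> s \<in> carrier P" using B by auto
  note rel = free_ext_minus_gen[OF assms(3), of ?S ?\<phi>, OF S]
    free_ext_gen_add[OF assms(3), of ?S ?\<phi>, OF S] free_ext_gen_smult[OF assms(3), of ?S ?\<phi>, OF S]
    free_add_gen_closed[OF M.R.is_cring] free_smult_gen_closed[OF M.R.is_cring]
  show ?thesis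
  proof (intro bilinI lin_mapsI; (rule B)?; assumption?)
    fix x x' y assume a: "x \<in> carrier M" "x' \<in> carrier M" "y \<in> carrier N"
    have "free_gen K (x \<oplus>\<^bsub>M\<^esub> x', y) \<ominus>\<^bsub>?F\<^esub> (free_gen K (x, y) \<oplus>\<^bsub>?F\<^esub> free_gen K (x', y)) \<in> tensor_rels K M N"
      unfolding tensor_rels_def Let_def using a by blast
    from R[OF this] show "B (x \<oplus>\<^bsub>M\<^esub> x') y = B x y \<oplus>\<^bsub>P\<^esub> B x' y"
      using a by (simp del: free_sel add: rel)
  next
    fix x y y' assume a: "x \<in> carrier M" "y \<in> carrier N" "y' \<in> carrier N"
    have "free_gen K (x, y \<oplus>\<^bsub>N\<^esub> y') \<ominus>\<^bsub>?F\<^esub> (free_gen K (x, y) \<oplus>\<^bsub>?F\<^esub> free_gen K (x, y')) \<in> tensor_rels K M N"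
      unfolding tensor_rels_def Let_def using a by blast
    from R[OF this] show "B x (y \<oplus>\<^bsub>N\<^esub> y') = B x y \<oplus>\<^bsub>P\<^esub> B x y'"
      using a by (simp del: free_sel add: rel)
  next
    fix c x y assume a: "c \<in> carrier K" "x \<in> carrier M" "y \<in> carrier N"
    have "free_gen K (c \<odot>\<^bsub>M\<^esub> x, y) \<ominus>\<^bsub>?F\<^esub> c \<odot>\<^bsub>?F\<^esub> free_gen K (x, y) \<in> tensor_rels K M N"
      unfolding tensor_rels_def Let_def using a by blast
    from R[OF this] show "B (c \<odot>\<^bsub>M\<^esub> x) y = c \<odot>\<^bsub>P\<^esub> B x y"
      using a by (simp del: free_sel add: rel)
    have "free_gen K (x, c \<odot>\<^bsub>N\<^esub> y) \<ominus>\<^bsub>?F\<^esub> c \<odot>\<^bsub>?F\<^esub> free_gen K (x, y) \<in> tensor_rels K M N"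
      unfolding tensor_rels_def Let_def using a by blast
    from R[OF this] show "B x (c \<odot>\<^bsub>N\<^esub> y) = c \<odot>\<^bsub>P\<^esub> B x y"
      using a by (simp del: free_sel add: rel)
  qed
qed

text \<open>
  The algebra structure of \<^const>\<open>tensor\<close> only adds a multiplication and a unit to
  \<^const>\<open>tensor_mod\<close>, so linear maps do not see the difference.
\<close>

lemma tensor_sel:
  "carrier (tensor K M N) = carrier (tensor_mod K M N)"
  "add (tensor K M N) = add (tensor_mod K M N)"
  "zero (tensor K M N) = zero (tensor_mod K M N)"
  "smult (tensor K M N) = smult (tensor_mod K M N)"
  by (simp_all add: tensor_def)

lemma tensor_lin_iff:
  "lin_maps K (tensor K M N) P = lin_maps K (tensor_mod K M N) P"
  "lin_maps K P (tensor K M N) = lin_maps K P (tensor_mod K M N)"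
  by (simp_all add: lin_maps_def tensor_sel)

lemma pres_lift_tensor: "pres_lift K (tensor K M N) \<phi> X = pres_lift K (tensor_mod K M N) \<phi> X"
proof -
  have "add_monoid (tensor K M N) = add_monoid (tensor_mod K M N)"
    by (simp add: tensor_sel)
  then show ?thesis by (simp add: pres_lift_def tensor_sel finsum_def)
qed

lemma module_cong:
  assumes "module K M" "carrier N = carrier M" "add N = add M" "zero N = zero M" "smult N = smult M"
  shows "module K N"
proof -
  interpret M: module K M by fact
  show ?thesis
  proof (rule moduleI[OF M.R.is_cring])
    show "abelian_group N"
      by (rule abelian_groupI) (auto simp: assms(2-) M.M.a_ac intro: M.M.l_neg)
  qed (simp_all add: assms(2-) M.smult_l_distr M.smult_r_distr M.smult_assoc1)
qed

context
  fixes K :: "('k, 'r) ring_scheme" and M :: "('k, 'm, 's) module_scheme"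
    and N :: "('k, 'n, 't) module_scheme"
  assumes M: "module K M" and N: "module K N"
begin

interpretation T: presentation K "carrier M \<times> carrier N" "tensor_rels K M N"
  by (rule tensor_presentation[OF M N])

lemma tensor_mod_module: "module K (tensor_mod K M N)"
  unfolding tensor_mod_def by (rule T.pres_module)

lemma tensor_module: "module K (tensor K M N)"
  by (rule module_cong[OF tensor_mod_module]) (simp_all add: tensor_sel)

lemma pure_tensor_closed:
  "x \<in> carrier M \<Longrightarrow> y \<in> carrier N \<Longrightarrow> pure_tensor K M N x y \<in> carrier (tensor K M N)"
  unfolding pure_tensor_def tensor_sel tensor_mod_def by (rule T.pres_gen_closed) simp

lemma pure_tensor_bilin: "bilin K M N (tensor K M N) (pure_tensor K M N)"
  unfolding bilin_def tensor_lin_iff unfolding bilin_def[symmetric]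
  by (rule tensor_rels_bilin[OF M N tensor_mod_module])
    (use T.pres_gen_rel pure_tensor_closed in
      \<open>simp_all add: pure_tensor_def tensor_mod_def tensor_sel case_prod_eta\<close>)

lemma tlift_closed:
  assumes "module K P" "\<And>x y. x \<in> carrier M \<Longrightarrow> y \<in> carrier N \<Longrightarrow> B x y \<in> carrier P"
    and "X \<in> carrier (tensor K M N)"
  shows "tlift K P B X \<in> carrier P"
  unfolding tlift_def using assms by (intro T.pres_lift_closed) (auto simp: tensor_sel tensor_mod_def)

lemma tlift_cong:
  assumes "module K P" "\<And>x y. x \<in> carrier M \<Longrightarrow> y \<in> carrier N \<Longrightarrow> C x y \<in> carrier P"
    and "\<And>x y. x \<in> carrier M \<Longrightarrow> y \<in> carrier N \<Longrightarrow> B x y = C x y"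
    and "X \<in> carrier (tensor K M N)"
  shows "tlift K P B X = tlift K P C X"
  unfolding tlift_def using assms by (intro T.pres_lift_cong) (auto simp: tensor_sel tensor_mod_def)

lemma tlift_hom:
  assumes "module K P" "module K P'" "f \<in> lin_maps K P P'"
    and "\<And>x y. x \<in> carrier M \<Longrightarrow> y \<in> carrier N \<Longrightarrow> B x y \<in> carrier P"
    and "X \<in> carrier (tensor K M N)"
  shows "f (tlift K P B X) = tlift K P' (\<lambda>x y. f (B x y)) X"
  unfolding tlift_def using assms
  by (subst T.pres_lift_hom[OF assms(1-3)]) (auto simp: tensor_sel tensor_mod_def case_prod_beta')

lemma tlift_param:
  assumes "module K Q" "module K P"
    and "\<And>x y. x \<in> carrier M \<Longrightarrow> y \<in> carrier N \<Longrightarrow> (\<lambda>u. B u x y) \<in> lin_maps K Q P"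
    and "X \<in> carrier (tensor K M N)"
  shows "(\<lambda>u. tlift K P (B u) X) \<in> lin_maps K Q P"
  unfolding tlift_def using assms
  by (intro T.pres_lift_param) (auto simp: tensor_sel tensor_mod_def)

lemma tlift_swap:
  assumes "module K P" "module K M'" "module K N'"
    and "\<And>x y x' y'. x \<in> carrier M \<Longrightarrow> y \<in> carrier N \<Longrightarrow> x' \<in> carrier M' \<Longrightarrow> y' \<in> carrier N' \<Longrightarrow>
      B x y x' y' \<in> carrier P"
    and "X \<in> carrier (tensor K M N)" "Y \<in> carrier (tensor K M' N')"
  shows "tlift K P (\<lambda>x y. tlift K P (B x y) Y) X = tlift K P (\<lambda>x' y'. tlift K P (\<lambda>x y. B x y x' y') X) Y"
proof -
  have "pres_lift K P (\<lambda>s. pres_lift K P (\<lambda>t. B (fst s) (snd s) (fst t) (snd t)) Y) X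
      = pres_lift K P (\<lambda>t. pres_lift K P (\<lambda>s. B (fst s) (snd s) (fst t) (snd t)) X) Y"
    using assms(4-6)
    by (intro T.pres_lift_swap[OF assms(1) tensor_presentation[OF assms(2,3)]])
      (auto simp: tensor_sel tensor_mod_def)
  then show ?thesis by (simp add: tlift_def case_prod_beta')
qed

lemma tlift_pure:
  assumes "module K P" "bilin K M N P B" "x \<in> carrier M" "y \<in> carrier N"
  shows "tlift K P B (pure_tensor K M N x y) = B x y"
  unfolding tlift_def pure_tensor_def
  using assms bilinD(3)[OF assms(2)] bilin_tensor_rels[OF M N assms(1,2)]
  by (subst T.pres_lift_gen) auto

lemma tlift_lin:
  assumes "module K P" "bilin K M N P B"
  shows "tlift K P B \<in> lin_maps K (tensor K M N) P"
  unfolding tlift_def tensor_lin_iff tensor_mod_def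
  using assms bilinD(3)[OF assms(2)] bilin_tensor_rels[OF M N assms(1,2)]
  by (intro T.pres_lift_lin) auto

lemma tensor_lin_eqI:
  assumes "module K P" "f \<in> lin_maps K (tensor K M N) P" "g \<in> lin_maps K (tensor K M N) P"
    and "\<And>x y. x \<in> carrier M \<Longrightarrow> y \<in> carrier N \<Longrightarrow>
      f (pure_tensor K M N x y) = g (pure_tensor K M N x y)"
    and "X \<in> carrier (tensor K M N)"
  shows "f X = g X"
proof (rule T.pres_lin_eqI[OF assms(1)])
  show "f \<in> lin_maps K T.G P" "g \<in> lin_maps K T.G P" "X \<in> carrier T.G"
    using assms(2,3,5) by (simp_all only: tensor_lin_iff tensor_sel tensor_mod_def)
next
  fix s assume "s \<in> carrier M \<times> carrier N"
  then show "f (pres_gen K (carrier M \<times> carrier N) (tensor_rels K M N) s)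
      = g (pres_gen K (carrier M \<times> carrier N) (tensor_rels K M N) s)"
    using assms(4) by (auto simp: pure_tensor_def)
qed

end

section \<open>Multilinear maps and the Hochschild complex\<close>

text \<open>
  One distinguished variable in a module \<open>N\<close> and \<open>n\<close> variables in \<open>A\<close>. With \<open>N\<close> the coefficient
  module these are the linear maps out of the Hochschild chains. With \<open>N = A\<close> they also describe
  cochains: a cochain \<open>f\<close> is recovered from \<open>(x, as) \<mapsto> f(as) x\<close> by putting \<open>x = 1\<close>.
\<close>

definition mlin ::
  "('k, 'r) ring_scheme \<Rightarrow> ('k, 'a, 's) module_scheme \<Rightarrow> ('k, 'n, 't) module_scheme \<Rightarrow> nat \<Rightarrow>
    ('k, 'p, 'u) module_scheme \<Rightarrow> ('n \<Rightarrow> 'a list \<Rightarrow> 'p) \<Rightarrow> bool"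
where
  "mlin K A N n P B \<longleftrightarrow>
     (\<forall>as\<in>tuples A n. (\<lambda>x. B x as) \<in> lin_maps K N P) \<and>
     (\<forall>x\<in>carrier N. \<forall>as\<in>tuples A n. \<forall>i<n. (\<lambda>a. B x (as[i := a])) \<in> lin_maps K A P)"

lemma tuples_0 [simp]: "tuples A 0 = {[]}"
  by (auto simp: tuples_def)

lemma tuples_Cons [simp]: "a # as \<in> tuples A (Suc n) \<longleftrightarrow> a \<in> carrier A \<and> as \<in> tuples A n"
  by (auto simp: tuples_def)

lemma tuples_SucE:
  assumes "as \<in> tuples A (Suc n)"
  obtains b bs where "as = b # bs" "b \<in> carrier A" "bs \<in> tuples A n"
  using assms by (cases as) (auto simp: tuples_def)

lemma tuples_update: "as \<in> tuples A n \<Longrightarrow> a \<in> carrier A \<Longrightarrow> as[i := a] \<in> tuples A n"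
  unfolding tuples_def using set_update_subset_insert[of as i a] by auto

lemma mlinD:
  assumes "mlin K A N n P B"
  shows "as \<in> tuples A n \<Longrightarrow> (\<lambda>x. B x as) \<in> lin_maps K N P"
    and "x \<in> carrier N \<Longrightarrow> as \<in> tuples A n \<Longrightarrow> i < n \<Longrightarrow> (\<lambda>a. B x (as[i := a])) \<in> lin_maps K A P"
    and "x \<in> carrier N \<Longrightarrow> as \<in> tuples A n \<Longrightarrow> B x as \<in> carrier P"
  using assms lin_closed[of "\<lambda>x. B x as" K N P x] by (auto simp: mlin_def)

lemma mlin_0 [simp]: "mlin K A N 0 P B \<longleftrightarrow> (\<lambda>x. B x []) \<in> lin_maps K N P"
  by (simp add: mlin_def)

text \<open>
  Splitting off the first variable makes induction on the number of variables possible, in step with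
  recursion on the list of arguments.
\<close>

lemma mlin_Suc:
  "mlin K A N (Suc n) P B \<longleftrightarrow>
     (\<forall>a\<in>carrier A. mlin K A N n P (\<lambda>x as. B x (a # as))) \<and>
     (\<forall>x\<in>carrier N. \<forall>as\<in>tuples A n. (\<lambda>a. B x (a # as)) \<in> lin_maps K A P)" (is "?L \<longleftrightarrow> ?R")
proof
  assume L: ?L
  show ?R
  proof (intro conjI ballI)
    fix a assume a: "a \<in> carrier A"
    show "mlin K A N n P (\<lambda>x as. B x (a # as))"
      unfolding mlin_def using mlinD(1)[OF L, of "a # _"] mlinD(2)[OF L, of _ "a # _" "Suc _"] a
      by simp
  next
    fix x as assume x: "x \<in> carrier N" "as \<in> tuples A n"
    show "(\<lambda>a. B x (a # as)) \<in> lin_maps K A P"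
    proof (rule lin_mapsI)
      fix a b assume ab: "a \<in> carrier A" "b \<in> carrier A"
      show "B x ((a \<oplus>\<^bsub>A\<^esub> b) # as) = B x (a # as) \<oplus>\<^bsub>P\<^esub> B x (b # as)"
        using lin_add[OF mlinD(2)[OF L x(1), of "a # as" 0] ab] x ab by simp
    next
      fix a assume a: "a \<in> carrier A"
      show "B x (a # as) \<in> carrier P" by (rule mlinD(3)[OF L]) (use x a in auto)
      fix c assume c: "c \<in> carrier K"
      show "B x ((c \<odot>\<^bsub>A\<^esub> a) # as) = c \<odot>\<^bsub>P\<^esub> B x (a # as)"
        using lin_smult[OF mlinD(2)[OF L x(1), of "a # as" 0] c a] x a by simp
    qed
  qed
next
  assume R: ?R
  show ?L
    unfolding mlin_def
  proof (intro conjI ballI allI impI)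
    fix as assume "as \<in> tuples A (Suc n)"
    then show "(\<lambda>x. B x as) \<in> lin_maps K N P"
      using R by (auto elim!: tuples_SucE simp: mlin_def)
  next
    fix x as i assume "x \<in> carrier N" "as \<in> tuples A (Suc n)" "i < Suc n"
    then show "(\<lambda>a. B x (as[i := a])) \<in> lin_maps K A P"
      using R by (cases i) (auto elim!: tuples_SucE simp: mlin_def)
  qed
qed

lemma mlin_SucI:
  assumes "\<And>a. a \<in> carrier A \<Longrightarrow> mlin K A N n P (\<lambda>x as. B x (a # as))"
    and "\<And>x as. x \<in> carrier N \<Longrightarrow> as \<in> tuples A n \<Longrightarrow> (\<lambda>a. B x (a # as)) \<in> lin_maps K A P"
  shows "mlin K A N (Suc n) P B"
  using assms by (simp add: mlin_Suc)

lemma mlin_SucD: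
  assumes "mlin K A N (Suc n) P B"
  shows "a \<in> carrier A \<Longrightarrow> mlin K A N n P (\<lambda>x as. B x (a # as))"
    and "x \<in> carrier N \<Longrightarrow> as \<in> tuples A n \<Longrightarrow> (\<lambda>a. B x (a # as)) \<in> lin_maps K A P"
  using assms by (simp_all add: mlin_Suc)

lemma mlin_cong:
  assumes "module K A" "module K N" "mlin K A N n P C"
    and "\<And>x as. x \<in> carrier N \<Longrightarrow> as \<in> tuples A n \<Longrightarrow> B x as = C x as"
  shows "mlin K A N n P B"
  unfolding mlin_def
  by (intro conjI ballI allI impI)
    (auto intro!: lin_cong[OF assms(1) mlinD(2)[OF assms(3)]] lin_cong[OF assms(2) mlinD(1)[OF assms(3)]]
      assms(4) tuples_update)

lemma mlin_comp:
  assumes "mlin K A N n P B" "f \<in> lin_maps K L N"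
  shows "mlin K A L n P (\<lambda>x as. B (f x) as)"
  using assms lin_closed[OF assms(2)] lin_comp[OF assms(2)] unfolding mlin_def by blast

lemma mlin_hom:
  assumes "mlin K A N n P B" "f \<in> lin_maps K P Q"
  shows "mlin K A N n Q (\<lambda>x as. f (B x as))"
  unfolding mlin_def
  by (intro conjI ballI allI impI)
    (rule lin_comp[OF _ assms(2)], erule mlinD(1)[OF assms(1)],
      rule lin_comp[OF _ assms(2)], erule (2) mlinD(2)[OF assms(1)])

lemma mlin_finsum:
  assumes "module K A" "module K N" "module K P" "finite I" "\<And>i. i \<in> I \<Longrightarrow> mlin K A N n P (B i)"
  shows "mlin K A N n P (\<lambda>x as. \<Oplus>\<^bsub>P\<^esub>i\<in>I. B i x as)"
  using assms(5) unfolding mlin_def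
  by (auto intro!: lin_finsum_maps[OF assms(1,3,4)] lin_finsum_maps[OF assms(2,3,4)])

lemma hoch_presentation:
  assumes "module K A" "module K M"
  shows "presentation K (carrier M \<times> tuples A n) (hoch_rels K A M n)"
proof -
  interpret A: module K A by fact
  interpret M: module K M by fact
  show ?thesis
    by (intro presentation.intro A.R.is_cring)
      (auto simp: hoch_rels_def Let_def intro!: free_minus_closed free_add_gen_closed
        free_smult_gen_closed A.R.is_cring tuples_update simp del: free_sel)
qed

lemma mlin_hoch_rels:
  assumes "module K A" "module K M" "module K P" "mlin K A M n P B" "r \<in> hoch_rels K A M n"
  shows "free_ext K P (\<lambda>(x, as). B x as) r = \<zero>\<^bsub>P\<^esub>"
proof -
  interpret A: module K A by fact
  interpret M: module K M by fact
  let ?S = "carrier M \<times> tuples A n" and ?\<phi> = "\<lambda>(x, y). B x y"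
  have S: "\<And>s. s \<in> ?S \<Longrightarrow> ?\<phi> s \<in> carrier P" using mlinD(3)[OF assms(4)] by auto
  note rel = free_ext_minus_gen[OF assms(3), of ?S ?\<phi>, OF S]
    free_ext_gen_add[OF assms(3), of ?S ?\<phi>, OF S] free_ext_gen_smult[OF assms(3), of ?S ?\<phi>, OF S]
    free_add_gen_closed[OF A.R.is_cring] free_smult_gen_closed[OF A.R.is_cring]
  show ?thesis
    using assms(5) unfolding hoch_rels_def Let_def
    by (elim UnE CollectE exE conjE)
      (simp_all del: free_sel add: rel tuples_update mlinD(1)[OF assms(4), THEN lin_add]
        mlinD(1)[OF assms(4), THEN lin_smult] mlinD(2)[OF assms(4), THEN lin_add]
        mlinD(2)[OF assms(4), THEN lin_smult])
qed

lemma hoch_rels_mlin: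
  assumes "module K A" "module K M" "module K P"
    and B: "\<And>x as. x \<in> carrier M \<Longrightarrow> as \<in> tuples A n \<Longrightarrow> B x as \<in> carrier P"
    and R: "\<And>r. r \<in> hoch_rels K A M n \<Longrightarrow> free_ext K P (\<lambda>(x, as). B x as) r = \<zero>\<^bsub>P\<^esub>"
  shows "mlin K A M n P B"
proof -
  interpret A: module K A by fact
  interpret M: module K M by fact
  let ?S = "carrier M \<times> tuples A n" and ?\<phi> = "\<lambda>(x, y). B x y"
  let ?F = "free_mod K ?S"
  have S: "\<And>s. s \<in> ?S \<Longrightarrow> ?\<phi> s \<in> carrier P" using B by auto
  note rel = free_ext_minus_gen[OF assms(3), of ?S ?\<phi>, OF S]
    free_ext_gen_add[OF assms(3), of ?S ?\<phi>, OF S] free_ext_gen_smult[OF assms(3), of ?S ?\<phi>, OF S]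
    free_add_gen_closed[OF A.R.is_cring] free_smult_gen_closed[OF A.R.is_cring] tuples_update
  show ?thesis
    unfolding mlin_def
  proof (intro conjI ballI allI impI; rule lin_mapsI; ((rule B; (assumption | rule tuples_update)+); fail)?)
    fix as x x' assume a: "as \<in> tuples A n" "x \<in> carrier M" "x' \<in> carrier M"
    have "free_gen K (x \<oplus>\<^bsub>M\<^esub> x', as) \<ominus>\<^bsub>?F\<^esub> (free_gen K (x, as) \<oplus>\<^bsub>?F\<^esub> free_gen K (x', as))
        \<in> hoch_rels K A M n"
      unfolding hoch_rels_def Let_def using a by blast
    from R[OF this] show "B (x \<oplus>\<^bsub>M\<^esub> x') as = B x as \<oplus>\<^bsub>P\<^esub> B x' as"
      using a by (simp del: free_sel add: rel)
  next
    fix as c x assume a: "as \<in> tuples A n" "c \<in> carrier K" "x \<in> carrier M"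
    have "free_gen K (c \<odot>\<^bsub>M\<^esub> x, as) \<ominus>\<^bsub>?F\<^esub> c \<odot>\<^bsub>?F\<^esub> free_gen K (x, as) \<in> hoch_rels K A M n"
      unfolding hoch_rels_def Let_def using a by blast
    from R[OF this] show "B (c \<odot>\<^bsub>M\<^esub> x) as = c \<odot>\<^bsub>P\<^esub> B x as"
      using a by (simp del: free_sel add: rel)
  next
    fix x as i a b
    assume a: "x \<in> carrier M" "as \<in> tuples A n" "i < n" "a \<in> carrier A" "b \<in> carrier A"
    have "free_gen K (x, as[i := a \<oplus>\<^bsub>A\<^esub> b]) \<ominus>\<^bsub>?F\<^esub>
        (free_gen K (x, as[i := a]) \<oplus>\<^bsub>?F\<^esub> free_gen K (x, as[i := b])) \<in> hoch_rels K A M n"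
      unfolding hoch_rels_def Let_def using a by blast
    from R[OF this] show "B x (as[i := a \<oplus>\<^bsub>A\<^esub> b]) = B x (as[i := a]) \<oplus>\<^bsub>P\<^esub> B x (as[i := b])"
      using a by (simp del: free_sel add: rel)
  next
    fix x as i c a
    assume a: "x \<in> carrier M" "as \<in> tuples A n" "i < n" "c \<in> carrier K" "a \<in> carrier A"
    have "free_gen K (x, as[i := c \<odot>\<^bsub>A\<^esub> a]) \<ominus>\<^bsub>?F\<^esub> c \<odot>\<^bsub>?F\<^esub> free_gen K (x, as[i := a])
        \<in> hoch_rels K A M n"
      unfolding hoch_rels_def Let_def using a by blast
    from R[OF this] show "B x (as[i := c \<odot>\<^bsub>A\<^esub> a]) = c \<odot>\<^bsub>P\<^esub> B x (as[i := a])"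
      using a by (simp del: free_sel add: rel)
  qed
qed

context
  fixes K :: "('k, 'r) ring_scheme" and A :: "('k, 'a, 's) module_scheme"
    and M :: "('k, 'm, 't) module_scheme" and n :: nat
  assumes A: "module K A" and M: "module K M"
begin

interpretation C: presentation K "carrier M \<times> tuples A n" "hoch_rels K A M n"
  by (rule hoch_presentation[OF A M])

lemma hoch_chains_module: "module K (hoch_chains K A M n)"
  unfolding hoch_chains_def by (rule C.pres_module)

lemma hoch_pure_mlin: "mlin K A M n (hoch_chains K A M n) (\<lambda>x as. hoch_pure K A M n (x, as))"
  by (rule hoch_rels_mlin[OF A M hoch_chains_module])
    (use C.pres_gen_rel C.pres_gen_closed in \<open>simp_all add: hoch_pure_def hoch_chains_def\<close>)

lemma chain_lift_pure:
  assumes "module K P" "mlin K A M n P B" "x \<in> carrier M" "as \<in> tuples A n"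
  shows "pres_lift K P (\<lambda>(x, as). B x as) (hoch_pure K A M n (x, as)) = B x as"
  unfolding hoch_pure_def
  using assms mlinD(3)[OF assms(2)] mlin_hoch_rels[OF A M assms(1,2)]
  by (subst C.pres_lift_gen) auto

lemma chain_lift_lin:
  assumes "module K P" "mlin K A M n P B"
  shows "pres_lift K P (\<lambda>(x, as). B x as) \<in> lin_maps K (hoch_chains K A M n) P"
  unfolding hoch_chains_def
  using assms mlinD(3)[OF assms(2)] mlin_hoch_rels[OF A M assms(1,2)]
  by (intro C.pres_lift_lin) auto

lemma chain_lin_eqI:
  assumes "module K P" "f \<in> lin_maps K (hoch_chains K A M n) P"
    and "g \<in> lin_maps K (hoch_chains K A M n) P"
    and "\<And>x as. x \<in> carrier M \<Longrightarrow> as \<in> tuples A n \<Longrightarrow>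
      f (hoch_pure K A M n (x, as)) = g (hoch_pure K A M n (x, as))"
    and "X \<in> carrier (hoch_chains K A M n)"
  shows "f X = g X"
proof (rule C.pres_lin_eqI[OF assms(1)])
  show "f \<in> lin_maps K C.G P" "g \<in> lin_maps K C.G P" "X \<in> carrier C.G"
    using assms(2,3,5) by (simp_all only: hoch_chains_def)
next
  fix s assume "s \<in> carrier M \<times> tuples A n"
  then show "f (pres_gen K (carrier M \<times> tuples A n) (hoch_rels K A M n) s)
      = g (pres_gen K (carrier M \<times> tuples A n) (hoch_rels K A M n) s)"
    using assms(4) by (auto simp: hoch_pure_def)
qed

end

lemma (in assoc_algebra) mult_lin:
  shows "y \<in> carrier A \<Longrightarrow> (\<lambda>x. x \<otimes>\<^bsub>A\<^esub> y) \<in> lin_maps K A A"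
    and "x \<in> carrier A \<Longrightarrow> (\<lambda>y. x \<otimes>\<^bsub>A\<^esub> y) \<in> lin_maps K A A"
  by (auto intro!: lin_mapsI simp: A.l_distr A.r_distr smult_mult_l smult_mult_r)

lemma mult_adj_simps [simp]:
  "mult_adj A (Suc 0) (a # b # as) = (a \<otimes>\<^bsub>A\<^esub> b) # as"
  "mult_adj A (Suc (Suc i)) (a # as) = a # mult_adj A (Suc i) as"
  by (simp_all add: mult_adj_def)

lemma (in assoc_algebra) mult_adj_tuples:
  assumes "as \<in> tuples A (Suc n)" "0 < i" "i \<le> n"
  shows "mult_adj A i as \<in> tuples A n"
  using assms
proof (induction n arbitrary: as i)
  case (Suc n)
  from Suc.prems(1) obtain a b bs where as: "as = a # b # bs" "a \<in> carrier A" "b \<in> carrier A" "bs \<in> tuples A n"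
    by (auto elim!: tuples_SucE)
  show ?case
  proof (cases "i = Suc 0")
    case False
    then obtain j where "i = Suc (Suc j)" using Suc.prems(2) by (cases i; cases "i - 1") auto
    then show ?thesis using Suc.IH[of "b # bs" "Suc j"] Suc.prems(3) as by simp
  qed (simp add: as)
qed simp

lemma (in assoc_algebra) mlin_mult_adj:
  assumes "module K N" "mlin K A N n P B" "0 < i" "i \<le> n"
  shows "mlin K A N (Suc n) P (\<lambda>x as. B x (mult_adj A i as))"
  using assms(2-)
proof (induction n arbitrary: B i)
  case (Suc n)
  note B = mlin_SucD[OF Suc.prems(1)]
  show ?case
  proof (cases "i = Suc 0")
    case True
    show ?thesis
    proof (intro mlin_SucI)
      fix a b assume "a \<in> carrier A" "b \<in> carrier A"
      then show "mlin K A N n P (\<lambda>x as. B x (mult_adj A i (a # b # as)))"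
        using B(1) by (simp add: True)
    next
      fix a x as assume "a \<in> carrier A" "x \<in> carrier N" "as \<in> tuples A n"
      then show "(\<lambda>b. B x (mult_adj A i (a # b # as))) \<in> lin_maps K A P"
        using lin_comp[OF mult_lin(2) B(2)] by (simp add: True)
    next
      fix x as assume x: "x \<in> carrier N" and "as \<in> tuples A (Suc n)"
      then obtain b bs where "as = b # bs" "b \<in> carrier A" "bs \<in> tuples A n" by (auto elim!: tuples_SucE)
      then show "(\<lambda>a. B x (mult_adj A i (a # as))) \<in> lin_maps K A P"
        using lin_comp[OF mult_lin(1) B(2)] x by (simp add: True)
    qed
  next
    case False
    then obtain j where i: "i = Suc (Suc j)" using Suc.prems(2) by (cases i; cases "i - 1") auto
    then have j: "Suc j \<le> n" using Suc.prems(3) by simp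
    show ?thesis
      unfolding i using Suc.IH[OF B(1) _ j] B(2) mult_adj_tuples[OF _ _ j]
      by (intro mlin_SucI[where n = "Suc n"]) simp_all
  qed
qed simp

lemma mlin_first_face:
  assumes "mlin K A N n P B" "bilin K N A N act"
  shows "mlin K A N (Suc n) P (\<lambda>x as. B (act x (hd as)) (tl as))"
  using lin_comp[OF bilinD(2)[OF assms(2)] mlinD(1)[OF assms(1)]]
  by (intro mlin_SucI) (simp_all add: mlin_comp[OF assms(1) bilinD(1)[OF assms(2)]])

lemma mlin_last_face:
  assumes "module K A" "module K N" "mlin K A N n P B" "bilin K A N N act"
  shows "mlin K A N (Suc n) P (\<lambda>x as. B (act (last as) x) (butlast as))"
  using assms(3)
proof (induction n arbitrary: B)
  case 0
  then show ?case
    using lin_comp[OF bilinD(2)[OF assms(4)]] lin_comp[OF bilinD(1)[OF assms(4)]]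
    by (intro mlin_SucI) auto
next
  case (Suc n)
  note B = mlin_SucD[OF Suc.prems]
  have ne: "as \<noteq> []" if "as \<in> tuples A (Suc n)" for as using that by (auto simp: tuples_def)
  show ?case
  proof (rule mlin_SucI)
    fix a assume "a \<in> carrier A"
    from Suc.IH[OF B(1)[OF this]]
    show "mlin K A N (Suc n) P (\<lambda>x as. B (act (last (a # as)) x) (butlast (a # as)))"
      by (rule mlin_cong[OF assms(1,2)]) (simp add: ne)
  next
    fix x as assume x: "x \<in> carrier N" "as \<in> tuples A (Suc n)"
    have "last as \<in> carrier A" "butlast as \<in> tuples A n"
      using x(2) ne[OF x(2)] last_in_set[of as] by (auto simp: tuples_def dest: in_set_butlastD)
    then show "(\<lambda>a. B (act (last (a # as)) x) (butlast (a # as))) \<in> lin_maps K A P"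
      using B(2) bilinD(3)[OF assms(4)] x ne by simp
  qed
qed

text \<open>
  The Hochschild boundary on generators, with the generator of the target replaced by an arbitrary
  \<open>B\<close>: the comparison of the complexes needs it also for the image of the generator under a chain map.
\<close>

definition hoch_alt ::
  "('k, 'r) ring_scheme \<Rightarrow> ('k, 'a, 's) module_scheme \<Rightarrow> ('k, 'm, 'a, 't) bimodule_scheme \<Rightarrow> nat \<Rightarrow>
    ('k, 'p, 'u) module_scheme \<Rightarrow> ('m \<Rightarrow> 'a list \<Rightarrow> 'p) \<Rightarrow> 'm \<Rightarrow> 'a list \<Rightarrow> 'p"
where
  "hoch_alt K A M n P B x as =
     (\<Oplus>\<^bsub>P\<^esub>i\<in>{0..Suc n}. sgn_pow K i \<odot>\<^bsub>P\<^esub> (case hoch_face A M i (x, as) of (y, bs) \<Rightarrow> B y bs))"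

lemma (in cring) sgn_pow_closed [simp]: "sgn_pow R i \<in> carrier R"
  by (simp add: sgn_pow_def)

context alg_bimodule
begin

lemma modules: "module K A" "module K M"
  using A.A.module_axioms M.module_axioms by simp_all

lemma act_bilin: "bilin K A M M (lact M)" "bilin K M A M (ract M)"
  by (auto intro!: bilinI lin_mapsI simp: lact_closed ract_closed lact_add_l lact_add_r lact_smult_l
    lact_smult_r ract_add_l ract_add_r ract_smult_l ract_smult_r)

text \<open>
  Multilinearity of the faces is what makes the boundary well defined on the presented module.
\<close>

lemma face_mlin:
  assumes "mlin K A M n P B" "i \<le> Suc n"
  shows "mlin K A M (Suc n) P (\<lambda>x as. case hoch_face A M i (x, as) of (y, bs) \<Rightarrow> B y bs)"
proof -
  consider "i = 0" | "0 < i" "i \<le> n" | "i = Suc n" using assms(2) by linarith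
  then show ?thesis
  proof cases
    case 1
    then show ?thesis using mlin_first_face[OF assms(1) act_bilin(2)] by (simp add: hoch_face_def)
  next
    case 2
    then show ?thesis
      by (intro mlin_cong[OF modules A.mlin_mult_adj[OF modules(2) assms(1), of i]])
        (auto simp: hoch_face_def tuples_def)
  next
    case 3
    then show ?thesis
      by (intro mlin_cong[OF modules mlin_last_face[OF modules assms(1) act_bilin(1)]])
        (auto simp: hoch_face_def tuples_def)
  qed
qed

lemma alt_mlin:
  assumes "module K P" "mlin K A M n P B"
  shows "mlin K A M (Suc n) P (hoch_alt K A M n P B)"
proof -
  have summand: "mlin K A M (Suc n) P
      (\<lambda>x as. sgn_pow K i \<odot>\<^bsub>P\<^esub> (case hoch_face A M i (x, as) of (y, bs) \<Rightarrow> B y bs))"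
    if "i \<in> {0..Suc n}" for i
  proof -
    have "mlin K A M (Suc n) P (\<lambda>x as. case hoch_face A M i (x, as) of (y, bs) \<Rightarrow> B y bs)"
      using that by (intro face_mlin[OF assms(2)]) simp
    moreover have "(\<lambda>p. sgn_pow K i \<odot>\<^bsub>P\<^esub> p) \<in> lin_maps K P P"
      by (simp add: lin_smult_map[OF assms(1)])
    ultimately show ?thesis by (rule mlin_hom)
  qed
  show ?thesis
    unfolding hoch_alt_def[abs_def]
    by (rule mlin_finsum[OF modules assms(1)]) (rule finite_atLeastAtMost, rule summand)
qed

lemma bdry_eq:
  "hoch_bdry K A M (Suc n) = pres_lift K (hoch_chains K A M n) (\<lambda>(x, as).
     hoch_alt K A M n (hoch_chains K A M n) (\<lambda>x as. hoch_pure K A M n (x, as)) x as)"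
  (is "_ = pres_lift K ?C ?a")
proof -
  have "(\<lambda>g. \<Oplus>\<^bsub>?C\<^esub>i\<in>{0..Suc n}. sgn_pow K i \<odot>\<^bsub>?C\<^esub> hoch_pure K A M n (hoch_face A M i g)) = ?a"
    by (simp only: fun_eq_iff split_paired_all hoch_alt_def prod.case case_prod_eta) simp
  then show ?thesis unfolding hoch_bdry_def[abs_def] by simp
qed

lemma alt_pure_mlin:
  "mlin K A M (Suc n) (hoch_chains K A M n)
     (hoch_alt K A M n (hoch_chains K A M n) (\<lambda>x as. hoch_pure K A M n (x, as)))"
  by (rule alt_mlin[OF hoch_chains_module[OF modules] hoch_pure_mlin[OF modules]])

lemma bdry_lin:
  "hoch_bdry K A M (Suc n) \<in> lin_maps K (hoch_chains K A M (Suc n)) (hoch_chains K A M n)"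
  unfolding bdry_eq by (rule chain_lift_lin[OF modules hoch_chains_module[OF modules] alt_pure_mlin])

lemma bdry_pure:
  assumes "x \<in> carrier M" "as \<in> tuples A (Suc n)"
  shows "hoch_bdry K A M (Suc n) (hoch_pure K A M (Suc n) (x, as))
    = hoch_alt K A M n (hoch_chains K A M n) (\<lambda>x as. hoch_pure K A M n (x, as)) x as"
  unfolding bdry_eq
  by (rule chain_lift_pure[OF modules hoch_chains_module[OF modules] alt_pure_mlin assms])

end

section \<open>Sweedler calculus for the coaction and the translation map\<close>

lemma bilin_lin_l:
  assumes "bilin K M N P B" "f \<in> lin_maps K Q M" "y \<in> carrier N"
  shows "(\<lambda>x. B (f x) y) \<in> lin_maps K Q P"
  using lin_comp[OF assms(2) bilinD(1)[OF assms(1,3)]] .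

lemma bilin_lin_r:
  assumes "bilin K M N P B" "x \<in> carrier M" "f \<in> lin_maps K Q N"
  shows "(\<lambda>y. B x (f y)) \<in> lin_maps K Q P"
  using lin_comp[OF assms(3) bilinD(2)[OF assms(1,2)]] .

lemma lin_app:
  assumes "g \<in> lin_maps K M P" "f \<in> lin_maps K Q M"
  shows "(\<lambda>x. g (f x)) \<in> lin_maps K Q P"
  using lin_comp[OF assms(2,1)] .

lemma tlift_arg:
  assumes "module K M" "module K N" "module K P" "bilin K M N P B" "f \<in> lin_maps K Q (tensor K M N)"
  shows "(\<lambda>x. tlift K P B (f x)) \<in> lin_maps K Q P"
  using lin_comp[OF assms(5) tlift_lin[OF assms(1-4)]] .

lemma tlift_tlift_pure:
  assumes M: "module K M" "module K N" "module K M'" "module K N'" and P: "module K P"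
    and D: "bilin K M N P D" and X: "X \<in> carrier (tensor K M' N')"
    and fg: "\<And>u v. u \<in> carrier M' \<Longrightarrow> v \<in> carrier N' \<Longrightarrow> f u v \<in> carrier M"
      "\<And>u v. u \<in> carrier M' \<Longrightarrow> v \<in> carrier N' \<Longrightarrow> g u v \<in> carrier N"
  shows "tlift K P D (tlift K (tensor K M N) (\<lambda>u v. pure_tensor K M N (f u v) (g u v)) X)
    = tlift K P (\<lambda>u v. D (f u v) (g u v)) X"
proof -
  have "tlift K P D (tlift K (tensor K M N) (\<lambda>u v. pure_tensor K M N (f u v) (g u v)) X)
      = tlift K P (\<lambda>u v. tlift K P D (pure_tensor K M N (f u v) (g u v))) X"
    by (intro tlift_hom[OF M(3,4) tensor_module[OF M(1,2)] P tlift_lin[OF M(1,2) P D] _ X]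
      pure_tensor_closed[OF M(1,2)] fg)
  also have "\<dots> = tlift K P (\<lambda>u v. D (f u v) (g u v)) X"
    by (intro tlift_cong[OF M(3,4) P _ _ X] tlift_pure[OF M(1,2) P D] bilinD(3)[OF D] fg)
  finally show ?thesis .
qed

lemma tensor_map_tlift:
  "tensor_map K M N f g = tlift K (tensor K M N) (\<lambda>x y. pure_tensor K M N (f x) (g y))"
  by (simp add: tensor_map_def tlift_def)

lemma tensor_map_props:
  assumes M: "module K M" "module K N" "module K M'" "module K N'"
    and f: "f \<in> lin_maps K M M'" and g: "g \<in> lin_maps K N N'"
  shows "tensor_map K M' N' f g \<in> lin_maps K (tensor K M N) (tensor K M' N')"
    and "x \<in> carrier M \<Longrightarrow> y \<in> carrier N \<Longrightarrow>
      tensor_map K M' N' f g (pure_tensor K M N x y) = pure_tensor K M' N' (f x) (g y)"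
proof -
  have b: "bilin K M N (tensor K M' N') (\<lambda>x y. pure_tensor K M' N' (f x) (g y))"
    by (intro bilinI bilin_lin_l[OF pure_tensor_bilin[OF M(3,4)]] bilin_lin_r[OF pure_tensor_bilin[OF M(3,4)]]
      f g lin_closed[OF f] lin_closed[OF g])
  show "tensor_map K M' N' f g \<in> lin_maps K (tensor K M N) (tensor K M' N')"
    unfolding tensor_map_tlift by (rule tlift_lin[OF M(1,2) tensor_module[OF M(3,4)] b])
  show "tensor_map K M' N' f g (pure_tensor K M N x y) = pure_tensor K M' N' (f x) (g y)"
    if "x \<in> carrier M" "y \<in> carrier N"
    unfolding tensor_map_tlift by (rule tlift_pure[OF M(1,2) tensor_module[OF M(3,4)] b that])
qed

lemma tensor_assoc_tlift:
  "tensor_assoc K L M N = tlift K (tensor K L (tensor K M N)) (\<lambda>t z.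
     tlift K (tensor K L (tensor K M N)) (\<lambda>x y. pure_tensor K L (tensor K M N) x (pure_tensor K M N y z)) t)"
  by (simp add: tensor_assoc_def tlift_def)

lemma tensor_mult:
  "X \<otimes>\<^bsub>tensor K M N\<^esub> Y = tlift K (tensor K M N) (\<lambda>x y. tlift K (tensor K M N) (\<lambda>x' y'.
     pure_tensor K M N (x \<otimes>\<^bsub>M\<^esub> x') (y \<otimes>\<^bsub>N\<^esub> y')) Y) X"
  by (simp only: tlift_def pres_lift_tensor) (simp add: tensor_def)

lemma (in assoc_algebra) algebra_module: "module K A"
  by (rule A.module_axioms)

lemma (in assoc_algebra) mult_l_lin: "f \<in> lin_maps K Q A \<Longrightarrow> y \<in> carrier A \<Longrightarrow> (\<lambda>x. f x \<otimes>\<^bsub>A\<^esub> y) \<in> lin_maps K Q A"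
  and mult_r_lin: "y \<in> carrier A \<Longrightarrow> f \<in> lin_maps K Q A \<Longrightarrow> (\<lambda>x. y \<otimes>\<^bsub>A\<^esub> f x) \<in> lin_maps K Q A"
  by (rule lin_app[OF mult_lin(1)], assumption+, rule lin_app[OF mult_lin(2)], assumption+)

context left_galois_object
begin

abbreviation mult_A (infixl "\<cdot>" 70) where "a \<cdot> b \<equiv> a \<otimes>\<^bsub>A\<^esub> b"

lemmas H_mod = H.algebra_module and A_mod = A.algebra_module
lemmas HA_mod = tensor_module[OF H_mod A_mod] and AA_mod = tensor_module[OF A_mod A_mod]
lemmas HA_bilin = pure_tensor_bilin[OF H_mod A_mod] and AA_bilin = pure_tensor_bilin[OF A_mod A_mod]

lemmas lin_intros = lin_id A.mult_l_lin A.mult_r_lin H.mult_l_lin H.mult_r_lin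
  bilin_lin_l[OF HA_bilin] bilin_lin_r[OF HA_bilin] bilin_lin_l[OF AA_bilin] bilin_lin_r[OF AA_bilin]
  A.A.m_closed H.A.m_closed

lemma coact_lin: "coact \<in> lin_maps K A (tensor K H A)"
  using coact_hom by (simp add: alg_hom_def)

lemma coact_closed: "a \<in> carrier A \<Longrightarrow> coact a \<in> carrier (tensor K H A)"
  by (rule lin_closed[OF coact_lin])

lemma coact_tlift_lin:
  assumes "module K P" "bilin K H A P D"
  shows "(\<lambda>a. tlift K P D (coact a)) \<in> lin_maps K A P"
  by (rule tlift_arg[OF H_mod A_mod assms coact_lin])

lemmas coact_tlift_hom = tlift_hom[OF H_mod A_mod _ _ _ _ coact_closed]
lemmas coact_tlift_cong = tlift_cong[OF H_mod A_mod _ _ _ coact_closed]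
lemmas coact_tlift_param = tlift_param[OF H_mod A_mod _ _ _ coact_closed]
lemmas coact_tlift_closed = tlift_closed[OF H_mod A_mod _ _ coact_closed]

text \<open>
  \<open>(a a')\<^sub>- \<otimes> (a a')\<^sub>0 = a\<^sub>- a'\<^sub>- \<otimes> a\<^sub>0 a'\<^sub>0\<close>, the multiplicativity of the coaction in the form in which
  it is applied to a bilinear map.
\<close>

lemma coact_mult:
  assumes P: "module K P" and D: "bilin K H A P D" and a: "a \<in> carrier A" "a' \<in> carrier A"
  shows "tlift K P D (coact (a \<cdot> a'))
    = tlift K P (\<lambda>h c. tlift K P (\<lambda>h' c'. D (h \<otimes>\<^bsub>H\<^esub> h') (c \<cdot> c')) (coact a')) (coact a)"
proof -
  let ?T = "tensor K H A"
  let ?p = "\<lambda>h c h' c'. pure_tensor K H A (h \<otimes>\<^bsub>H\<^esub> h') (c \<cdot> c')"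
  have p: "?p h c h' c' \<in> carrier ?T" if "h \<in> carrier H" "c \<in> carrier A" "h' \<in> carrier H" "c' \<in> carrier A"
    for h c h' c' using that by (intro pure_tensor_closed[OF H_mod A_mod] A.A.m_closed H.A.m_closed)
  have cl: "tlift K ?T (?p h c) (coact a') \<in> carrier ?T" if "h \<in> carrier H" "c \<in> carrier A" for h c
    using that a by (intro coact_tlift_closed HA_mod p)
  note lD = tlift_lin[OF H_mod A_mod P D]
  have "coact (a \<cdot> a') = coact a \<otimes>\<^bsub>?T\<^esub> coact a'"
    using coact_hom a by (auto simp: alg_hom_def ring_hom_def)
  then have "tlift K P D (coact (a \<cdot> a'))
      = tlift K P D (tlift K ?T (\<lambda>h c. tlift K ?T (?p h c) (coact a')) (coact a))"
    by (simp only: tensor_mult)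
  also have "\<dots> = tlift K P (\<lambda>h c. tlift K P D (tlift K ?T (?p h c) (coact a'))) (coact a)"
    by (rule coact_tlift_hom[OF HA_mod P lD cl a(1)])
  also have "\<dots> = tlift K P (\<lambda>h c. tlift K P (\<lambda>h' c'. D (h \<otimes>\<^bsub>H\<^esub> h') (c \<cdot> c')) (coact a')) (coact a)"
  proof (rule coact_tlift_cong[OF P _ _ a(1)])
    fix h c assume hc: "h \<in> carrier H" "c \<in> carrier A"
    show "tlift K P (\<lambda>h' c'. D (h \<otimes>\<^bsub>H\<^esub> h') (c \<cdot> c')) (coact a') \<in> carrier P"
      using hc a by (intro coact_tlift_closed P bilinD(3)[OF D] A.A.m_closed H.A.m_closed)
    show "tlift K P D (tlift K ?T (?p h c) (coact a'))
        = tlift K P (\<lambda>h' c'. D (h \<otimes>\<^bsub>H\<^esub> h') (c \<cdot> c')) (coact a')"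
      using hc a by (intro tlift_tlift_pure[OF H_mod A_mod H_mod A_mod P D coact_closed] A.A.m_closed H.A.m_closed)
  qed
  finally show ?thesis .
qed

lemma coact_one:
  assumes "module K P" "bilin K H A P D"
  shows "tlift K P D (coact \<one>\<^bsub>A\<^esub>) = D \<one>\<^bsub>H\<^esub> \<one>\<^bsub>A\<^esub>"
proof -
  have "coact \<one>\<^bsub>A\<^esub> = pure_tensor K H A \<one>\<^bsub>H\<^esub> \<one>\<^bsub>A\<^esub>"
    using coact_hom by (auto simp: alg_hom_def ring_hom_def tensor_def)
  then show ?thesis
    by (simp add: tlift_pure[OF H_mod A_mod assms])
qed

lemma counit_closed: "h \<in> carrier H \<Longrightarrow> counit h \<in> carrier K"
  using H.counit_hom by (auto simp: ring_hom_def)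

lemma coact_counit_lin:
  assumes P: "module K P" and g: "g \<in> lin_maps K A P" and a: "a \<in> carrier A"
  shows "tlift K P (\<lambda>h c. counit h \<odot>\<^bsub>P\<^esub> g c) (coact a) = g a"
proof -
  interpret P: module K P by fact
  have "g a = g (tlift K A (\<lambda>h c. counit h \<odot>\<^bsub>A\<^esub> c) (coact a))"
    using coact_counit[OF a] by (simp add: tlift_def)
  also have "\<dots> = tlift K P (\<lambda>h c. g (counit h \<odot>\<^bsub>A\<^esub> c)) (coact a)"
    by (rule coact_tlift_hom[OF A_mod P g _ a]) (simp add: counit_closed)
  also have "\<dots> = tlift K P (\<lambda>h c. counit h \<odot>\<^bsub>P\<^esub> g c) (coact a)"
    using g by (intro coact_tlift_cong P a) (simp_all add: counit_closed lin_closed lin_smult)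
  finally show ?thesis by simp
qed

abbreviation "gal \<equiv> galois_map K H A coact"

lemma mult_map_props:
  "mult_map K A \<in> lin_maps K (tensor K A A) A"
  "a \<in> carrier A \<Longrightarrow> b \<in> carrier A \<Longrightarrow> mult_map K A (pure_tensor K A A a b) = a \<cdot> b"
proof -
  have b: "bilin K A A A (\<lambda>a b. a \<cdot> b)" by (intro bilinI lin_intros)
  have eq: "mult_map K A = tlift K A (\<lambda>a b. a \<cdot> b)" by (simp add: mult_map_def tlift_def)
  show "mult_map K A \<in> lin_maps K (tensor K A A) A"
    unfolding eq by (rule tlift_lin[OF A_mod A_mod A_mod b])
  show "mult_map K A (pure_tensor K A A a b) = a \<cdot> b" if "a \<in> carrier A" "b \<in> carrier A" for a b
    unfolding eq by (rule tlift_pure[OF A_mod A_mod A_mod b that])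
qed

lemma gal_lin: "gal \<in> lin_maps K (tensor K A A) (tensor K H A)"
  and gal_pure: "a \<in> carrier A \<Longrightarrow> b \<in> carrier A \<Longrightarrow>
    gal (pure_tensor K A A a b) = tlift K (tensor K H A) (\<lambda>h c. pure_tensor K H A h (c \<cdot> b)) (coact a)"
proof -
  let ?HA = "tensor K H A" and ?AA = "tensor K A A"
  let ?S = "tensor K ?HA A" and ?T = "tensor K H ?AA"
  let ?i = "\<lambda>z h c. pure_tensor K H ?AA h (pure_tensor K A A c z)"
  let ?as = "tensor_assoc K H A A" and ?m = "tensor_map K H A (\<lambda>h. h) (mult_map K A)"
  note S = tensor_module[OF HA_mod A_mod] and T = tensor_module[OF H_mod AA_mod]
  note T_bilin = pure_tensor_bilin[OF H_mod AA_mod]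
  have AAc: "pure_tensor K A A c z \<in> carrier ?AA" if "c \<in> carrier A" "z \<in> carrier A" for c z
    using that by (rule pure_tensor_closed[OF A_mod A_mod])
  have i: "bilin K H A ?T (?i z)" if "z \<in> carrier A" for z
    using that by (intro bilinI lin_intros bilin_lin_l[OF T_bilin] bilin_lin_r[OF T_bilin] AAc)
  have assoc_bilin: "bilin K ?HA A ?T (\<lambda>t z. tlift K ?T (?i z) t)"
    by (intro bilinI tlift_lin[OF H_mod A_mod T] i tlift_param[OF H_mod A_mod A_mod T]
      bilin_lin_r[OF T_bilin] lin_intros)
  note c = tensor_map_props[OF A_mod A_mod HA_mod A_mod coact_lin lin_id]
  have a: "?as \<in> lin_maps K ?S ?T"
    unfolding tensor_assoc_tlift by (rule tlift_lin[OF HA_mod A_mod T assoc_bilin])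
  note m = tensor_map_props[OF H_mod AA_mod H_mod A_mod lin_id mult_map_props(1)]
  show "gal \<in> lin_maps K ?AA ?HA"
    unfolding galois_map_def[abs_def] by (rule lin_comp[OF lin_comp[OF c(1) a] m(1)])
  fix a b assume ab: "a \<in> carrier A" "b \<in> carrier A"
  have "gal (pure_tensor K A A a b) = ?m (?as (pure_tensor K ?HA A (coact a) b))"
    unfolding galois_map_def using c(2) ab by simp
  also have "?as (pure_tensor K ?HA A (coact a) b) = tlift K ?T (?i b) (coact a)"
    unfolding tensor_assoc_tlift
    using tlift_pure[OF HA_mod A_mod T assoc_bilin coact_closed[OF ab(1)] ab(2)] .
  also have "?m \<dots> = tlift K ?HA (\<lambda>h c. ?m (?i b h c)) (coact a)"
    by (rule coact_tlift_hom[OF T HA_mod m(1) bilinD(3)[OF i[OF ab(2)]] ab(1)])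
  also have "\<dots> = tlift K ?HA (\<lambda>h c. pure_tensor K H A h (c \<cdot> b)) (coact a)"
    using ab by (intro coact_tlift_cong HA_mod)
      (simp_all add: m(2) AAc mult_map_props(2) pure_tensor_closed[OF H_mod A_mod])
  finally show "gal (pure_tensor K A A a b)
      = tlift K ?HA (\<lambda>h c. pure_tensor K H A h (c \<cdot> b)) (coact a)" .
qed

text \<open>
  A bilinear map evaluated along the Galois map \<open>a \<otimes> b \<mapsto> a\<^sub>- \<otimes> a\<^sub>0 b\<close>.
\<close>

lemma tlift_gal:
  assumes P: "module K P" and D: "bilin K H A P D" and t: "t \<in> carrier (tensor K A A)"
  shows "tlift K P D (gal t) = tlift K P (\<lambda>a b. tlift K P (\<lambda>h c. D h (c \<cdot> b)) (coact a)) t"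
proof -
  note lD = tlift_lin[OF H_mod A_mod P D]
  have Db: "bilin K H A P (\<lambda>h c. D h (c \<cdot> b))" if "b \<in> carrier A" for b
    using that by (intro bilinI lin_intros bilin_lin_l[OF D] bilin_lin_r[OF D])
  have E: "bilin K A A P (\<lambda>a b. tlift K P (\<lambda>h c. D h (c \<cdot> b)) (coact a))"
    by (intro bilinI coact_tlift_lin P Db coact_tlift_param[OF A_mod P] bilin_lin_r[OF D] lin_intros)
  show ?thesis
  proof (rule tensor_lin_eqI[OF A_mod A_mod P lin_comp[OF gal_lin lD] tlift_lin[OF A_mod A_mod P E] _ t])
    fix a b assume ab: "a \<in> carrier A" "b \<in> carrier A"
    have "tlift K P D (gal (pure_tensor K A A a b))
        = tlift K P (\<lambda>h c. D h (c \<cdot> b)) (coact a)"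
      unfolding gal_pure[OF ab]
      using ab by (intro tlift_tlift_pure[OF H_mod A_mod H_mod A_mod P D coact_closed] A.A.m_closed)
    also have "\<dots> = tlift K P (\<lambda>a b. tlift K P (\<lambda>h c. D h (c \<cdot> b)) (coact a)) (pure_tensor K A A a b)"
      using ab by (simp add: tlift_pure[OF A_mod A_mod P E])
    finally show "tlift K P D (gal (pure_tensor K A A a b))
        = tlift K P (\<lambda>a b. tlift K P (\<lambda>h c. D h (c \<cdot> b)) (coact a)) (pure_tensor K A A a b)" .
  qed
qed

text \<open>
  The translation map \<open>h \<mapsto> h\<^sub>1 \<otimes> h\<^sub>2\<close>. For \<open>A = H\<close> it is the coproduct followed by the antipode on
  the second factor.
\<close>

definition kappa where
  "kappa h = inv_into (carrier (tensor K A A)) gal (pure_tensor K H A h \<one>\<^bsub>A\<^esub>)"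

lemma HA_closed: "h \<in> carrier H \<Longrightarrow> a \<in> carrier A \<Longrightarrow> pure_tensor K H A h a \<in> carrier (tensor K H A)"
  by (rule pure_tensor_closed[OF H_mod A_mod])

lemma AA_closed: "a \<in> carrier A \<Longrightarrow> b \<in> carrier A \<Longrightarrow> pure_tensor K A A a b \<in> carrier (tensor K A A)"
  by (rule pure_tensor_closed[OF A_mod A_mod])

lemma gal_inj:
  "t \<in> carrier (tensor K A A) \<Longrightarrow> t' \<in> carrier (tensor K A A) \<Longrightarrow> gal t = gal t' \<Longrightarrow> t = t'"
  using galois_bij by (auto simp: bij_betw_def inj_on_def)

lemma kappa_closed: "h \<in> carrier H \<Longrightarrow> kappa h \<in> carrier (tensor K A A)"
  and gal_kappa: "h \<in> carrier H \<Longrightarrow> gal (kappa h) = pure_tensor K H A h \<one>\<^bsub>A\<^esub>"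
  using galois_bij HA_closed[of h "\<one>\<^bsub>A\<^esub>"] unfolding kappa_def
  by (auto simp: bij_betw_def inv_into_into f_inv_into_f)

lemma kappa_lin: "kappa \<in> lin_maps K H (tensor K A A)"
proof -
  interpret H: module K H by (rule H_mod)
  interpret AA: module K "tensor K A A" by (rule AA_mod)
  have 1: "(\<lambda>h. pure_tensor K H A h \<one>\<^bsub>A\<^esub>) \<in> lin_maps K H (tensor K H A)"
    by (intro bilin_lin_l[OF HA_bilin] lin_id A.A.one_closed)
  show ?thesis
  proof (rule lin_mapsI)
    fix h k assume "h \<in> carrier H" "k \<in> carrier H"
    then show "kappa (h \<oplus>\<^bsub>H\<^esub> k) = kappa h \<oplus>\<^bsub>tensor K A A\<^esub> kappa k"
      by (intro gal_inj) (simp_all add: kappa_closed gal_kappa lin_add[OF gal_lin] lin_add[OF 1])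
  next
    fix c h assume "c \<in> carrier K" "h \<in> carrier H"
    then show "kappa (c \<odot>\<^bsub>H\<^esub> h) = c \<odot>\<^bsub>tensor K A A\<^esub> kappa h"
      by (intro gal_inj) (simp_all add: kappa_closed gal_kappa lin_smult[OF gal_lin] lin_smult[OF 1])
  qed (rule kappa_closed)
qed

lemmas kappa_tlift_hom = tlift_hom[OF A_mod A_mod _ _ _ _ kappa_closed]
lemmas kappa_tlift_cong = tlift_cong[OF A_mod A_mod _ _ _ kappa_closed]
lemmas kappa_tlift_param = tlift_param[OF A_mod A_mod _ _ _ kappa_closed]
lemmas kappa_tlift_closed = tlift_closed[OF A_mod A_mod _ _ kappa_closed]

lemma kappa_tlift_lin:
  assumes "module K P" "bilin K A A P D"
  shows "(\<lambda>h. tlift K P D (kappa h)) \<in> lin_maps K H P"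
  by (rule tlift_arg[OF A_mod A_mod assms kappa_lin])

text \<open>
  The Galois map sends \<open>\<kappa>(h)\<close> to \<open>h \<otimes> 1\<close>.
\<close>

lemma kappa_coact:
  assumes P: "module K P" and D: "bilin K H A P D" and h: "h \<in> carrier H"
  shows "tlift K P (\<lambda>a b. tlift K P (\<lambda>h' c. D h' (c \<cdot> b)) (coact a)) (kappa h) = D h \<one>\<^bsub>A\<^esub>"
  using tlift_gal[OF P D kappa_closed[OF h]] tlift_pure[OF H_mod A_mod P D h A.A.one_closed]
  by (simp add: gal_kappa[OF h])

text \<open>
  The other composite: \<open>\<kappa>(a\<^sub>-)(1 \<otimes> a\<^sub>0) = a \<otimes> 1\<close>. As the Galois map is injective and right
  \<open>A\<close>-linear, it suffices that it sends the left side to \<open>a\<^sub>- \<otimes> a\<^sub>0\<close>, which is its value at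
  \<open>a \<otimes> 1\<close>.
\<close>

lemma coact_kappa:
  assumes P: "module K P" and D: "bilin K A A P D" and a: "a \<in> carrier A"
  shows "tlift K P (\<lambda>h c. tlift K P (\<lambda>a' b. D a' (b \<cdot> c)) (kappa h)) (coact a) = D a \<one>\<^bsub>A\<^esub>"
proof -
  let ?AA = "tensor K A A" and ?HA = "tensor K H A"
  let ?p = "\<lambda>c a' b. pure_tensor K A A a' (b \<cdot> c)"
  let ?t = "tlift K ?AA (\<lambda>h c. tlift K ?AA (?p c) (kappa h)) (coact a)"
  have p: "?p c a' b \<in> carrier ?AA" if "c \<in> carrier A" "a' \<in> carrier A" "b \<in> carrier A" for c a' b
    using that by (intro AA_closed A.A.m_closed)
  have q: "tlift K ?AA (?p c) (kappa h) \<in> carrier ?AA" if "h \<in> carrier H" "c \<in> carrier A" for h c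
    using that by (intro kappa_tlift_closed AA_mod p)
  have t: "?t \<in> carrier ?AA" by (intro coact_tlift_closed AA_mod q a)
  have inner: "gal (tlift K ?AA (?p c) (kappa h)) = pure_tensor K H A h c"
    if hc: "h \<in> carrier H" "c \<in> carrier A" for h c
  proof -
    have E: "bilin K H A ?HA (\<lambda>h' x. pure_tensor K H A h' (x \<cdot> c))"
      using hc by (intro bilinI lin_intros)
    have "gal (tlift K ?AA (?p c) (kappa h)) = tlift K ?HA (\<lambda>a' b. gal (?p c a' b)) (kappa h)"
      by (rule kappa_tlift_hom[OF AA_mod HA_mod gal_lin p[OF hc(2)] hc(1)])
    also have "\<dots> = tlift K ?HA (\<lambda>a' b. tlift K ?HA
        (\<lambda>h' c'. pure_tensor K H A h' ((c' \<cdot> b) \<cdot> c)) (coact a')) (kappa h)"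
    proof (rule kappa_tlift_cong[OF HA_mod _ _ hc(1)])
      fix a' b assume ab: "a' \<in> carrier A" "b \<in> carrier A"
      show "tlift K ?HA (\<lambda>h' c'. pure_tensor K H A h' ((c' \<cdot> b) \<cdot> c)) (coact a') \<in> carrier ?HA"
        using ab hc by (intro coact_tlift_closed HA_mod HA_closed A.A.m_closed)
      show "gal (?p c a' b)
          = tlift K ?HA (\<lambda>h' c'. pure_tensor K H A h' ((c' \<cdot> b) \<cdot> c)) (coact a')"
        unfolding gal_pure[OF ab(1) A.A.m_closed[OF ab(2) hc(2)]] using ab hc
        by (intro coact_tlift_cong HA_mod) (simp_all add: HA_closed A.A.m_assoc)
    qed
    also have "\<dots> = pure_tensor K H A h (\<one>\<^bsub>A\<^esub> \<cdot> c)"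
      by (rule kappa_coact[OF HA_mod E hc(1)])
    finally show ?thesis using hc by simp
  qed
  have "gal ?t = tlift K ?HA (\<lambda>h c. gal (tlift K ?AA (?p c) (kappa h))) (coact a)"
    by (rule coact_tlift_hom[OF AA_mod HA_mod gal_lin q a])
  also have "\<dots> = tlift K ?HA (\<lambda>h c. pure_tensor K H A h (c \<cdot> \<one>\<^bsub>A\<^esub>)) (coact a)"
    using a by (intro coact_tlift_cong HA_mod) (simp_all add: inner HA_closed)
  also have "\<dots> = gal (pure_tensor K A A a \<one>\<^bsub>A\<^esub>)"
    using a by (simp add: gal_pure)
  finally have teq: "?t = pure_tensor K A A a \<one>\<^bsub>A\<^esub>"
    by (intro gal_inj t AA_closed a A.A.one_closed)
  note lD = tlift_lin[OF A_mod A_mod P D]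
  have "D a \<one>\<^bsub>A\<^esub> = tlift K P D ?t"
    unfolding teq using tlift_pure[OF A_mod A_mod P D a A.A.one_closed] by simp
  also have "\<dots> = tlift K P (\<lambda>h c. tlift K P D (tlift K ?AA (?p c) (kappa h))) (coact a)"
    by (rule coact_tlift_hom[OF AA_mod P lD q a])
  also have "\<dots> = tlift K P (\<lambda>h c. tlift K P (\<lambda>a' b. D a' (b \<cdot> c)) (kappa h)) (coact a)"
  proof (rule coact_tlift_cong[OF P _ _ a])
    fix h c assume hc: "h \<in> carrier H" "c \<in> carrier A"
    show "tlift K P (\<lambda>a' b. D a' (b \<cdot> c)) (kappa h) \<in> carrier P"
      using hc by (intro kappa_tlift_closed P bilinD(3)[OF D] A.A.m_closed)
    show "tlift K P D (tlift K ?AA (?p c) (kappa h)) = tlift K P (\<lambda>a' b. D a' (b \<cdot> c)) (kappa h)"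
      using hc by (intro tlift_tlift_pure[OF A_mod A_mod A_mod A_mod P D kappa_closed] A.A.m_closed)
  qed
  finally show ?thesis by simp
qed

lemma kappa_one:
  assumes P: "module K P" and D: "bilin K A A P D"
  shows "tlift K P D (kappa \<one>\<^bsub>H\<^esub>) = D \<one>\<^bsub>A\<^esub> \<one>\<^bsub>A\<^esub>"
proof -
  have E: "bilin K H A (tensor K H A) (\<lambda>h c. pure_tensor K H A h (c \<cdot> \<one>\<^bsub>A\<^esub>))"
    by (intro bilinI lin_intros A.A.one_closed)
  have "gal (pure_tensor K A A \<one>\<^bsub>A\<^esub> \<one>\<^bsub>A\<^esub>) = pure_tensor K H A \<one>\<^bsub>H\<^esub> \<one>\<^bsub>A\<^esub>"
    using coact_one[OF HA_mod E] by (simp add: gal_pure)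
  then have "kappa \<one>\<^bsub>H\<^esub> = pure_tensor K A A \<one>\<^bsub>A\<^esub> \<one>\<^bsub>A\<^esub>"
    by (intro gal_inj) (simp_all add: kappa_closed gal_kappa AA_closed)
  then show ?thesis by (simp add: tlift_pure[OF A_mod A_mod P D])
qed

text \<open>
  Both \<open>\<kappa>(h k)\<close> and \<open>h\<^sub>1 k\<^sub>1 \<otimes> k\<^sub>2 h\<^sub>2\<close> are sent to \<open>h k \<otimes> 1\<close> by the Galois map. For the second
  one, the coaction of \<open>h\<^sub>1 k\<^sub>1\<close> is a product of two coactions; collapsing the inner one with
  \<open>\<kappa>(k)\<close> brings \<open>h\<^sub>2\<close> next to the coaction of \<open>h\<^sub>1\<close>, so that the outer one collapses too. This is
  why the second factors appear in reversed order.
\<close>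

lemma kappa_mult:
  assumes P: "module K P" and D: "bilin K A A P D" and hk: "h \<in> carrier H" "k \<in> carrier H"
  shows "tlift K P D (kappa (h \<otimes>\<^bsub>H\<^esub> k))
    = tlift K P (\<lambda>a b. tlift K P (\<lambda>a' b'. D (a \<cdot> a') (b' \<cdot> b)) (kappa k)) (kappa h)"
proof -
  let ?AA = "tensor K A A" and ?HA = "tensor K H A"
  let ?p = "\<lambda>a b a' b'. pure_tensor K A A (a \<cdot> a') (b' \<cdot> b)"
  let ?t = "tlift K ?AA (\<lambda>a b. tlift K ?AA (?p a b) (kappa k)) (kappa h)"
  let ?e = "\<lambda>b b' h1 c1 h2 c2. pure_tensor K H A (h1 \<otimes>\<^bsub>H\<^esub> h2) (c1 \<cdot> ((c2 \<cdot> b') \<cdot> b))"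
  have p: "?p a b a' b' \<in> carrier ?AA"
    if "a \<in> carrier A" "b \<in> carrier A" "a' \<in> carrier A" "b' \<in> carrier A" for a b a' b'
    using that by (intro AA_closed A.A.m_closed)
  have q: "tlift K ?AA (?p a b) (kappa k) \<in> carrier ?AA" if "a \<in> carrier A" "b \<in> carrier A" for a b
    using that hk by (intro kappa_tlift_closed AA_mod p)
  have e: "?e b b' h1 c1 h2 c2 \<in> carrier ?HA" if "b \<in> carrier A" "b' \<in> carrier A"
      "h1 \<in> carrier H" "c1 \<in> carrier A" "h2 \<in> carrier H" "c2 \<in> carrier A" for b b' h1 c1 h2 c2
    using that by (intro HA_closed A.A.m_closed H.A.m_closed)
  have e1: "tlift K ?HA (\<lambda>h2 c2. ?e b b' h1 c1 h2 c2) (coact a') \<in> carrier ?HA"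
    if "b \<in> carrier A" "b' \<in> carrier A" "h1 \<in> carrier H" "c1 \<in> carrier A" "a' \<in> carrier A" for b b' h1 c1 a'
    using that by (intro coact_tlift_closed HA_mod e)
  have t: "?t \<in> carrier ?AA" by (intro kappa_tlift_closed AA_mod q hk)
  have g: "gal (?p a b a' b') = tlift K ?HA (\<lambda>h1 c1. tlift K ?HA (\<lambda>h2 c2. ?e b b' h1 c1 h2 c2) (coact a')) (coact a)"
    if ab: "a \<in> carrier A" "b \<in> carrier A" "a' \<in> carrier A" "b' \<in> carrier A" for a b a' b'
  proof -
    have E: "bilin K H A ?HA (\<lambda>h c. pure_tensor K H A h (c \<cdot> (b' \<cdot> b)))"
      using ab by (intro bilinI lin_intros)
    have "gal (?p a b a' b') = tlift K ?HA (\<lambda>h1 c1. tlift K ?HA (\<lambda>h2 c2.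
        pure_tensor K H A (h1 \<otimes>\<^bsub>H\<^esub> h2) ((c1 \<cdot> c2) \<cdot> (b' \<cdot> b))) (coact a')) (coact a)"
      using ab by (subst gal_pure) (simp_all add: coact_mult[OF HA_mod E])
    also have "\<dots> = tlift K ?HA (\<lambda>h1 c1. tlift K ?HA (\<lambda>h2 c2. ?e b b' h1 c1 h2 c2) (coact a')) (coact a)"
      using ab by (intro coact_tlift_cong HA_mod e1 e) (simp_all add: A.A.m_assoc)
    finally show ?thesis .
  qed
  have inner: "gal (tlift K ?AA (?p a b) (kappa k))
      = tlift K ?HA (\<lambda>h1 c1. pure_tensor K H A (h1 \<otimes>\<^bsub>H\<^esub> k) (c1 \<cdot> b)) (coact a)"
    if ab: "a \<in> carrier A" "b \<in> carrier A" for a b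
  proof -
    have "gal (tlift K ?AA (?p a b) (kappa k)) = tlift K ?HA (\<lambda>a' b'. gal (?p a b a' b')) (kappa k)"
      by (rule kappa_tlift_hom[OF AA_mod HA_mod gal_lin p[OF ab] hk(2)])
    also have "\<dots> = tlift K ?HA (\<lambda>a' b'. tlift K ?HA (\<lambda>h1 c1.
        tlift K ?HA (\<lambda>h2 c2. ?e b b' h1 c1 h2 c2) (coact a')) (coact a)) (kappa k)"
      using ab hk by (intro kappa_tlift_cong HA_mod g coact_tlift_closed e)
    also have "\<dots> = tlift K ?HA (\<lambda>h1 c1. tlift K ?HA (\<lambda>a' b'.
        tlift K ?HA (\<lambda>h2 c2. ?e b b' h1 c1 h2 c2) (coact a')) (kappa k)) (coact a)"
      using ab hk by (intro tlift_swap[OF A_mod A_mod HA_mod H_mod A_mod] e1 kappa_closed coact_closed)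
    also have "\<dots> = tlift K ?HA (\<lambda>h1 c1. pure_tensor K H A (h1 \<otimes>\<^bsub>H\<^esub> k) (c1 \<cdot> b)) (coact a)"
    proof (rule coact_tlift_cong[OF HA_mod _ _ ab(1)])
      fix h1 c1 assume c: "h1 \<in> carrier H" "c1 \<in> carrier A"
      show "pure_tensor K H A (h1 \<otimes>\<^bsub>H\<^esub> k) (c1 \<cdot> b) \<in> carrier ?HA"
        using c ab hk by (intro HA_closed A.A.m_closed H.A.m_closed)
      have E: "bilin K H A ?HA (\<lambda>h2 x. pure_tensor K H A (h1 \<otimes>\<^bsub>H\<^esub> h2) (c1 \<cdot> (x \<cdot> b)))"
        using c ab by (intro bilinI lin_intros)
      have "tlift K ?HA (\<lambda>a' b'. tlift K ?HA (\<lambda>h2 c2. ?e b b' h1 c1 h2 c2) (coact a')) (kappa k)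
          = pure_tensor K H A (h1 \<otimes>\<^bsub>H\<^esub> k) (c1 \<cdot> (\<one>\<^bsub>A\<^esub> \<cdot> b))"
        by (rule kappa_coact[OF HA_mod E hk(2)])
      then show "tlift K ?HA (\<lambda>a' b'. tlift K ?HA (\<lambda>h2 c2. ?e b b' h1 c1 h2 c2) (coact a')) (kappa k)
          = pure_tensor K H A (h1 \<otimes>\<^bsub>H\<^esub> k) (c1 \<cdot> b)" using ab by simp
    qed
    finally show ?thesis .
  qed
  have E: "bilin K H A ?HA (\<lambda>h1 x. pure_tensor K H A (h1 \<otimes>\<^bsub>H\<^esub> k) x)"
    using hk by (intro bilinI lin_intros)
  have "gal ?t = tlift K ?HA (\<lambda>a b. gal (tlift K ?AA (?p a b) (kappa k))) (kappa h)"
    by (rule kappa_tlift_hom[OF AA_mod HA_mod gal_lin q hk(1)])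
  also have "\<dots> = tlift K ?HA (\<lambda>a b. tlift K ?HA
      (\<lambda>h1 c1. pure_tensor K H A (h1 \<otimes>\<^bsub>H\<^esub> k) (c1 \<cdot> b)) (coact a)) (kappa h)"
    using hk by (intro kappa_tlift_cong HA_mod inner coact_tlift_closed HA_closed A.A.m_closed H.A.m_closed)
  also have "\<dots> = gal (kappa (h \<otimes>\<^bsub>H\<^esub> k))"
    using kappa_coact[OF HA_mod E hk(1)] hk by (simp add: gal_kappa)
  finally have "gal ?t = gal (kappa (h \<otimes>\<^bsub>H\<^esub> k))" .
  from gal_inj[OF kappa_closed[OF H.A.m_closed[OF hk]] t this[symmetric]]
  have teq: "kappa (h \<otimes>\<^bsub>H\<^esub> k) = ?t" .
  note lD = tlift_lin[OF A_mod A_mod P D]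
  have "tlift K P D ?t = tlift K P (\<lambda>a b. tlift K P D (tlift K ?AA (?p a b) (kappa k))) (kappa h)"
    by (rule kappa_tlift_hom[OF AA_mod P lD q hk(1)])
  also have "\<dots> = tlift K P (\<lambda>a b. tlift K P (\<lambda>a' b'. D (a \<cdot> a') (b' \<cdot> b)) (kappa k)) (kappa h)"
  proof (rule kappa_tlift_cong[OF P _ _ hk(1)])
    fix a b assume ab: "a \<in> carrier A" "b \<in> carrier A"
    show "tlift K P (\<lambda>a' b'. D (a \<cdot> a') (b' \<cdot> b)) (kappa k) \<in> carrier P"
      using ab hk by (intro kappa_tlift_closed P bilinD(3)[OF D] A.A.m_closed)
    show "tlift K P D (tlift K ?AA (?p a b) (kappa k))
        = tlift K P (\<lambda>a' b'. D (a \<cdot> a') (b' \<cdot> b)) (kappa k)"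
      using ab hk by (intro tlift_tlift_pure[OF A_mod A_mod A_mod A_mod P D kappa_closed] A.A.m_closed)
  qed
  finally show ?thesis unfolding teq .
qed

end

section \<open>Transfer of multilinear maps\<close>

lemma mlin_tlift:
  assumes "module K M" "module K M'" "module K A" "module K N" "module K P"
    and X: "X \<in> carrier (tensor K M M')"
    and "\<And>u v. u \<in> carrier M \<Longrightarrow> v \<in> carrier M' \<Longrightarrow> mlin K A N n P (B u v)"
  shows "mlin K A N n P (\<lambda>x as. tlift K P (\<lambda>u v. B u v x as) X)"
  unfolding mlin_def
proof (intro conjI ballI allI impI)
  fix as assume as: "as \<in> tuples A n"
  show "(\<lambda>x. tlift K P (\<lambda>u v. B u v x as) X) \<in> lin_maps K N P"
    by (rule tlift_param[OF assms(1,2,4,5) _ X]) (rule mlinD(1)[OF assms(7) as])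
next
  fix x as i assume x: "x \<in> carrier N" "as \<in> tuples A n" "i < n"
  show "(\<lambda>a. tlift K P (\<lambda>u v. B u v x (as[i := a])) X) \<in> lin_maps K A P"
    by (rule tlift_param[OF assms(1,2,3,5) _ X]) (rule mlinD(2)[OF assms(7) x])
qed

text \<open>
  A linear map \<open>X\<close> from \<open>G\<close> to \<open>Q \<otimes> V\<close> and an action of \<open>V\<close> on \<open>N\<close> turn multilinear maps on
  \<open>N \<otimes> Q \<otimes> \<dots> \<otimes> Q\<close> into multilinear maps on \<open>N \<otimes> G \<otimes> \<dots> \<otimes> G\<close>: each variable in \<open>G\<close> is expanded by
  \<open>X\<close>, and the components in \<open>V\<close> act on the variable in \<open>N\<close>. There are two possible orders for these
  actions. With \<open>l\<close> the action and \<open>r\<close> trivial, the component that belongs to the first list entry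
  acts last; with the roles exchanged it acts first. The coaction needs the first order and its
  inverse, the translation map, the second one.
\<close>

locale tensor_transfer =
  fixes K :: "('k, 'r) ring_scheme" and G :: "('k, 'g, 'u) module_scheme"
    and Q :: "('k, 'q, 's) module_scheme" and V :: "('k, 'v, 't) module_scheme"
    and N :: "('k, 'n, 'w) module_scheme"
    and X :: "'g \<Rightarrow> ('q \<times> 'v \<Rightarrow> 'k) set" and l r :: "'v \<Rightarrow> 'n \<Rightarrow> 'n"
  assumes G: "module K G" and Q: "module K Q" and V: "module K V" and N: "module K N"
    and X_lin: "X \<in> lin_maps K G (tensor K Q V)"
    and l_lin: "v \<in> carrier V \<Longrightarrow> (\<lambda>x. l v x) \<in> lin_maps K N N"
    and r_lin: "v \<in> carrier V \<Longrightarrow> (\<lambda>x. r v x) \<in> lin_maps K N N"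
    \<comment> \<open>At least one of \<open>l\<close>, \<open>r\<close> has to be trivial: otherwise a component in \<open>V\<close> would occur twice.\<close>
    and one_sided: "(\<forall>x\<in>carrier N. (\<lambda>v. l v x) \<in> lin_maps K V N) \<and> r = (\<lambda>v x. x) \<or>
      (\<forall>x\<in>carrier N. (\<lambda>v. r v x) \<in> lin_maps K V N) \<and> l = (\<lambda>v x. x)"
begin

primrec transfer where
  "transfer P [] B x = B x []"
| "transfer P (g # gs) B x =
     tlift K P (\<lambda>q v. transfer P gs (\<lambda>y qs. B (l v y) (q # qs)) (r v x)) (X g)"

lemma X_closed: "g \<in> carrier G \<Longrightarrow> X g \<in> carrier (tensor K Q V)"
  by (rule lin_closed[OF X_lin])

lemma lr_closed:
  "v \<in> carrier V \<Longrightarrow> x \<in> carrier N \<Longrightarrow> l v x \<in> carrier N"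
  "v \<in> carrier V \<Longrightarrow> x \<in> carrier N \<Longrightarrow> r v x \<in> carrier N"
  by (rule lin_closed[OF l_lin], assumption+, rule lin_closed[OF r_lin], assumption+)

lemmas X_hom = tlift_hom[OF Q V _ _ _ _ X_closed]
lemmas X_cong = tlift_cong[OF Q V _ _ _ X_closed]
lemmas X_param = tlift_param[OF Q V _ _ _ X_closed]
lemmas X_tlift_closed = tlift_closed[OF Q V _ _ X_closed]

lemma transfer_closed:
  assumes P: "module K P" and "gs \<in> tuples G n" "x \<in> carrier N"
    and "\<And>y qs. y \<in> carrier N \<Longrightarrow> qs \<in> tuples Q n \<Longrightarrow> B y qs \<in> carrier P"
  shows "transfer P gs B x \<in> carrier P"
  using assms(2-)
proof (induction n arbitrary: gs B x)
  case (Suc n)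
  from Suc.prems(1) obtain g gs' where gs: "gs = g # gs'" "g \<in> carrier G" "gs' \<in> tuples G n"
    by (rule tuples_SucE)
  show ?case
    unfolding gs(1) transfer.simps using gs(2,3) Suc.prems
    by (intro X_tlift_closed P Suc.IH) (simp_all add: lr_closed)
qed simp

lemma transfer_cong:
  assumes P: "module K P" and "gs \<in> tuples G n" "x \<in> carrier N"
    and "\<And>y qs. y \<in> carrier N \<Longrightarrow> qs \<in> tuples Q n \<Longrightarrow> C y qs \<in> carrier P"
    and "\<And>y qs. y \<in> carrier N \<Longrightarrow> qs \<in> tuples Q n \<Longrightarrow> B y qs = C y qs"
  shows "transfer P gs B x = transfer P gs C x"
  using assms(2-)
proof (induction n arbitrary: gs B C x)
  case (Suc n)
  from Suc.prems(1) obtain g gs' where gs: "gs = g # gs'" "g \<in> carrier G" "gs' \<in> tuples G n"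
    by (rule tuples_SucE)
  show ?case
    unfolding gs(1) transfer.simps using gs(2,3) Suc.prems
    by (intro X_cong P Suc.IH transfer_closed[where n = n]) (simp_all add: lr_closed)
qed simp

lemma transfer_hom:
  assumes P: "module K P" "module K P'" "f \<in> lin_maps K P P'" and "gs \<in> tuples G n" "x \<in> carrier N"
    and "\<And>y qs. y \<in> carrier N \<Longrightarrow> qs \<in> tuples Q n \<Longrightarrow> B y qs \<in> carrier P"
  shows "f (transfer P gs B x) = transfer P' gs (\<lambda>y qs. f (B y qs)) x"
  using assms(4-)
proof (induction n arbitrary: gs B x)
  case (Suc n)
  from Suc.prems(1) obtain g gs' where gs: "gs = g # gs'" "g \<in> carrier G" "gs' \<in> tuples G n"
    by (rule tuples_SucE)
  have B: "B (l v y) (q # qs) \<in> carrier P"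
    if "v \<in> carrier V" "q \<in> carrier Q" "y \<in> carrier N" "qs \<in> tuples Q n" for v q y qs
    using that by (intro Suc.prems(3)) (simp_all add: lr_closed)
  have "f (transfer P gs B x)
      = tlift K P' (\<lambda>q v. f (transfer P gs' (\<lambda>y qs. B (l v y) (q # qs)) (r v x))) (X g)"
    unfolding gs(1) transfer.simps using gs(2,3) Suc.prems(2)
    by (intro X_hom[OF P(1-3)] transfer_closed[OF P(1)] B lr_closed)
  also have "\<dots> = transfer P' gs (\<lambda>y qs. f (B y qs)) x"
    unfolding gs(1) transfer.simps using gs(2,3) Suc.prems(2)
    by (intro X_cong P(2) Suc.IH transfer_closed[OF P(2)] B lin_closed[OF P(3)] lr_closed)
  finally show ?case .
qed simp

lemma transfer_param:
  assumes P: "module K U" "module K P" and "gs \<in> tuples G n" "x \<in> carrier N"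
    and "\<And>y qs. y \<in> carrier N \<Longrightarrow> qs \<in> tuples Q n \<Longrightarrow> (\<lambda>u. B u y qs) \<in> lin_maps K U P"
  shows "(\<lambda>u. transfer P gs (B u) x) \<in> lin_maps K U P"
  using assms(3-)
proof (induction n arbitrary: gs B x)
  case (Suc n)
  from Suc.prems(1) obtain g gs' where gs: "gs = g # gs'" "g \<in> carrier G" "gs' \<in> tuples G n"
    by (rule tuples_SucE)
  have B: "(\<lambda>u. B u (l v y) (q # qs)) \<in> lin_maps K U P"
    if "v \<in> carrier V" "q \<in> carrier Q" "y \<in> carrier N" "qs \<in> tuples Q n" for v q y qs
    using that by (intro Suc.prems(3)) (simp_all add: lr_closed)
  show ?case
    unfolding gs(1) transfer.simps using gs(2,3) Suc.prems(2)
    by (intro X_param P Suc.IH B lr_closed)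
qed simp

lemma transfer_lin:
  assumes P: "module K P" and "gs \<in> tuples G n"
    and "\<And>qs. qs \<in> tuples Q n \<Longrightarrow> (\<lambda>y. B y qs) \<in> lin_maps K N P"
  shows "(\<lambda>x. transfer P gs B x) \<in> lin_maps K N P"
  using assms(2-)
proof (induction n arbitrary: gs B)
  case 0
  have "transfer P [] B = (\<lambda>x. B x [])" by (rule ext) simp
  with 0 show ?case by simp
next
  case (Suc n)
  from Suc.prems(1) obtain g gs' where gs: "gs = g # gs'" "g \<in> carrier G" "gs' \<in> tuples G n"
    by (rule tuples_SucE)
  have "(\<lambda>x. transfer P gs' (\<lambda>y qs. B (l v y) (q # qs)) x) \<in> lin_maps K N P"
    if "q \<in> carrier Q" "v \<in> carrier V" for q v
    using that by (intro Suc.IH gs(3) lin_app[OF Suc.prems(2)] l_lin) simp_all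
  from lin_app[OF this r_lin] show ?case
    unfolding gs(1) transfer.simps using gs(2) by (intro X_param N P)
qed

text \<open>
  Expansion of further tensors commutes with the transfer, by interchange of finite sums.
\<close>

lemma transfer_swap:
  assumes P: "module K P" and M: "module K M" "module K M'" and Y: "Y \<in> carrier (tensor K M M')"
    and "gs \<in> tuples G n" "x \<in> carrier N"
    and "\<And>u w y qs. u \<in> carrier M \<Longrightarrow> w \<in> carrier M' \<Longrightarrow> y \<in> carrier N \<Longrightarrow> qs \<in> tuples Q n \<Longrightarrow>
      B u w y qs \<in> carrier P"
  shows "transfer P gs (\<lambda>y qs. tlift K P (\<lambda>u w. B u w y qs) Y) x
    = tlift K P (\<lambda>u w. transfer P gs (B u w) x) Y"
  using assms(5-)
proof (induction n arbitrary: gs B x)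
  case (Suc n)
  from Suc.prems(1) obtain g gs' where gs: "gs = g # gs'" "g \<in> carrier G" "gs' \<in> tuples G n"
    by (rule tuples_SucE)
  have B: "B u w (l v y) (q # qs) \<in> carrier P" if "u \<in> carrier M" "w \<in> carrier M'"
    "v \<in> carrier V" "q \<in> carrier Q" "y \<in> carrier N" "qs \<in> tuples Q n" for u w v q y qs
    using that by (intro Suc.prems(3)) (simp_all add: lr_closed)
  let ?T = "\<lambda>q v u w. transfer P gs' (\<lambda>y qs. B u w (l v y) (q # qs)) (r v x)"
  have cl: "?T q v u w \<in> carrier P"
    if "q \<in> carrier Q" "v \<in> carrier V" "u \<in> carrier M" "w \<in> carrier M'" for q v u w
    using that Suc.prems(2) by (intro transfer_closed[OF P gs(3)] B lr_closed)
  have "transfer P gs (\<lambda>y qs. tlift K P (\<lambda>u w. B u w y qs) Y) x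
      = tlift K P (\<lambda>q v. tlift K P (?T q v) Y) (X g)"
    unfolding gs(1) transfer.simps using gs(2,3) Suc.prems(2)
    by (intro X_cong P Suc.IH tlift_closed[OF M P] cl Y B lr_closed)
  also have "\<dots> = tlift K P (\<lambda>u w. tlift K P (\<lambda>q v. ?T q v u w) (X g)) Y"
    by (intro tlift_swap[OF Q V P M] X_closed gs(2) Y cl)
  finally show ?case unfolding gs(1) transfer.simps .
qed simp

text \<open>
  Endomorphisms of \<open>N\<close> that commute with the action can be moved through the transfer. The relevant
  ones are right multiplications.
\<close>

lemma transfer_base:
  assumes P: "module K P" and R: "\<And>y. y \<in> carrier N \<Longrightarrow> R y \<in> carrier N"
    "\<And>v y. v \<in> carrier V \<Longrightarrow> y \<in> carrier N \<Longrightarrow> R (l v y) = l v (R y)"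
    "\<And>v y. v \<in> carrier V \<Longrightarrow> y \<in> carrier N \<Longrightarrow> R (r v y) = r v (R y)"
    and "gs \<in> tuples G n" "x \<in> carrier N"
    and "\<And>y qs. y \<in> carrier N \<Longrightarrow> qs \<in> tuples Q n \<Longrightarrow> B y qs \<in> carrier P"
  shows "transfer P gs (\<lambda>y qs. B (R y) qs) x = transfer P gs B (R x)"
  using assms(5-)
proof (induction n arbitrary: gs B x)
  case (Suc n)
  from Suc.prems(1) obtain g gs' where gs: "gs = g # gs'" "g \<in> carrier G" "gs' \<in> tuples G n"
    by (rule tuples_SucE)
  note x = Suc.prems(2)
  have B: "B (l v y) (q # qs) \<in> carrier P"
    if "v \<in> carrier V" "q \<in> carrier Q" "y \<in> carrier N" "qs \<in> tuples Q n" for v q y qs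
    using that by (intro Suc.prems(3)) (simp_all add: lr_closed)
  show ?case
    unfolding gs(1) transfer.simps
  proof (rule X_cong[OF P _ _ gs(2)])
    fix q v assume qv: "q \<in> carrier Q" "v \<in> carrier V"
    let ?B = "\<lambda>y qs. B (l v y) (q # qs)"
    show "transfer P gs' ?B (r v (R x)) \<in> carrier P"
      using qv x by (intro transfer_closed[OF P gs(3)] R(1) B lr_closed)
    have "transfer P gs' (\<lambda>y qs. B (l v (R y)) (q # qs)) (r v x) = transfer P gs' ?B (R (r v x))"
      using qv x by (intro Suc.IH[of gs' _ ?B] gs(3) B lr_closed)
    moreover have "transfer P gs' (\<lambda>y qs. B (R (l v y)) (q # qs)) (r v x)
        = transfer P gs' (\<lambda>y qs. B (l v (R y)) (q # qs)) (r v x)"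
      using qv x by (intro transfer_cong[OF P gs(3)]) (simp_all add: R lr_closed B)
    ultimately show "transfer P gs' (\<lambda>y qs. B (R (l v y)) (q # qs)) (r v x)
        = transfer P gs' ?B (r v (R x))" using qv x by (simp add: R(3))
  qed
qed simp

lemma transfer_mlin:
  assumes P: "module K P" and "mlin K Q N n P B"
  shows "mlin K G N n P (\<lambda>x gs. transfer P gs B x)"
  using assms(2)
proof (induction n arbitrary: B)
  case (Suc n)
  note B = mlin_SucD[OF Suc.prems]
  have Bm: "mlin K Q N n P (\<lambda>y qs. B (l v y) (q # qs))" if "q \<in> carrier Q" "v \<in> carrier V" for q v
    using mlin_comp[OF B(1)[OF that(1)] l_lin[OF that(2)]] .
  show ?case
  proof (rule mlin_SucI)
    fix g assume g: "g \<in> carrier G"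
    show "mlin K G N n P (\<lambda>x gs. transfer P (g # gs) B x)"
      unfolding transfer.simps
      by (intro mlin_tlift[OF Q V G N P X_closed[OF g]] mlin_comp[OF Suc.IH[OF Bm]] r_lin)
  next
    fix x gs assume x: "x \<in> carrier N" and gs: "gs \<in> tuples G n"
    show "(\<lambda>g. transfer P (g # gs) B x) \<in> lin_maps K G P"
      unfolding transfer.simps
    proof (intro tlift_arg[OF Q V P _ X_lin] bilinI)
      fix v assume v: "v \<in> carrier V"
      show "(\<lambda>q. transfer P gs (\<lambda>y qs. B (l v y) (q # qs)) (r v x)) \<in> lin_maps K Q P"
        using v x by (intro transfer_param[OF Q P gs] B(2) lr_closed)
    next
      fix q assume q: "q \<in> carrier Q"
      note Bq = mlinD(1)[OF B(1)[OF q]]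
      from one_sided show "(\<lambda>v. transfer P gs (\<lambda>y qs. B (l v y) (q # qs)) (r v x)) \<in> lin_maps K V P"
      proof (elim disjE conjE)
        assume l: "\<forall>x\<in>carrier N. (\<lambda>v. l v x) \<in> lin_maps K V N" and r: "r = (\<lambda>v x. x)"
        have rx: "r v x = x" for v by (simp add: r)
        show ?thesis
          unfolding rx using l by (intro transfer_param[OF V P gs x] lin_app[OF Bq]) auto
      next
        assume r: "\<forall>x\<in>carrier N. (\<lambda>v. r v x) \<in> lin_maps K V N" and l: "l = (\<lambda>v x. x)"
        have "(\<lambda>x. transfer P gs (\<lambda>y qs. B y (q # qs)) x) \<in> lin_maps K N P"
          by (rule transfer_lin[OF P gs Bq])
        moreover have "l v y = y" for v y by (simp add: l)
        ultimately show ?thesis using lin_app[of _ K N P "\<lambda>v. r v x" V] r x by simp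
      qed
    qed
  qed
qed simp

text \<open>
  Both sides are linear in the family \<open>s\<close> of coefficients, seen as an element of the free module on
  \<open>I\<close>, so it is enough to take unit vectors.
\<close>

lemma transfer_sum:
  assumes P: "module K P" and I: "finite I" "\<And>i. i \<in> I \<Longrightarrow> s i \<in> carrier K"
    and gs: "gs \<in> tuples G n" and x: "x \<in> carrier N"
    and B: "\<And>i y qs. i \<in> I \<Longrightarrow> y \<in> carrier N \<Longrightarrow> qs \<in> tuples Q n \<Longrightarrow> B i y qs \<in> carrier P"
  shows "transfer P gs (\<lambda>y qs. \<Oplus>\<^bsub>P\<^esub>i\<in>I. s i \<odot>\<^bsub>P\<^esub> B i y qs) x
    = (\<Oplus>\<^bsub>P\<^esub>i\<in>I. s i \<odot>\<^bsub>P\<^esub> transfer P gs (B i) x)"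
proof -
  interpret P: module K P by (rule P)
  let ?u = "\<lambda>i. if i \<in> I then s i else \<zero>\<^bsub>K\<^esub>"
  have u: "?u \<in> carrier (free_mod K I)" using I by (auto simp: free_mod_def)
  have ext: "free_ext K P \<phi> ?u = (\<Oplus>\<^bsub>P\<^esub>i\<in>I. s i \<odot>\<^bsub>P\<^esub> \<phi> i)" if "\<And>i. i \<in> I \<Longrightarrow> \<phi> i \<in> carrier P" for \<phi>
  proof -
    have "free_ext K P \<phi> ?u = (\<Oplus>\<^bsub>P\<^esub>i\<in>I. ?u i \<odot>\<^bsub>P\<^esub> \<phi> i)"
      by (rule free_ext_superset[OF P u that I(1)]) auto
    also have "\<dots> = (\<Oplus>\<^bsub>P\<^esub>i\<in>I. s i \<odot>\<^bsub>P\<^esub> \<phi> i)"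
      using I that by (intro P.M.finsum_cong') auto
    finally show ?thesis .
  qed
  note F = free_module[OF module.axioms(1)[OF P], of I]
  have Bi: "transfer P gs (B i) x \<in> carrier P" if "i \<in> I" for i
    by (rule transfer_closed[OF P gs x B[OF that]])
  have "transfer P gs (\<lambda>y qs. free_ext K P (\<lambda>i. B i y qs) ?u) x = free_ext K P (\<lambda>i. transfer P gs (B i) x) ?u"
  proof (rule free_lin_eqI[OF P _ _ _ u])
    show "(\<lambda>u. transfer P gs (\<lambda>y qs. free_ext K P (\<lambda>i. B i y qs) u) x) \<in> lin_maps K (free_mod K I) P"
      by (intro transfer_param[OF F P gs x] free_ext_lin P B)
    show "(\<lambda>u. free_ext K P (\<lambda>i. transfer P gs (B i) x) u) \<in> lin_maps K (free_mod K I) P"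
      by (intro free_ext_lin P Bi)
  next
    fix i assume i: "i \<in> I"
    have "transfer P gs (\<lambda>y qs. free_ext K P (\<lambda>i. B i y qs) (free_gen K i)) x = transfer P gs (B i) x"
      by (intro transfer_cong[OF P gs x] B[OF i] free_ext_gen[OF P i] B)
    then show "transfer P gs (\<lambda>y qs. free_ext K P (\<lambda>i. B i y qs) (free_gen K i)) x
        = free_ext K P (\<lambda>i. transfer P gs (B i) x) (free_gen K i)"
      using free_ext_gen[OF P i Bi] by simp
  qed
  moreover have "transfer P gs (\<lambda>y qs. free_ext K P (\<lambda>i. B i y qs) ?u) x
      = transfer P gs (\<lambda>y qs. \<Oplus>\<^bsub>P\<^esub>i\<in>I. s i \<odot>\<^bsub>P\<^esub> B i y qs) x"
    using B I by (intro transfer_cong[OF P gs x] ext P.M.finsum_closed) auto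
  ultimately show ?thesis by (simp only: ext[OF Bi])
qed

end

locale galois_module = left_galois_object +
  fixes N :: "('a, 'n, 'u) module_scheme" and act :: "'e \<Rightarrow> 'n \<Rightarrow> 'n"
  assumes N_mod: "module K N" and act_bilin: "bilin K A N N act"
    and act_one: "x \<in> carrier N \<Longrightarrow> act \<one>\<^bsub>A\<^esub> x = x"
    and act_mult: "a \<in> carrier A \<Longrightarrow> b \<in> carrier A \<Longrightarrow> x \<in> carrier N \<Longrightarrow>
      act (a \<cdot> b) x = act a (act b x)"
begin

lemma act_closed: "a \<in> carrier A \<Longrightarrow> x \<in> carrier N \<Longrightarrow> act a x \<in> carrier N"
  by (rule bilinD(3)[OF act_bilin])

lemma act_lin: "a \<in> carrier A \<Longrightarrow> (\<lambda>x. act a x) \<in> lin_maps K N N"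
  by (rule bilinD(2)[OF act_bilin])

text \<open>
  \<open>cot\<close> substitutes \<open>(x; a, b, \<dots>) \<mapsto> (a\<^sub>0 b\<^sub>0 \<dots> x; a\<^sub>-, b\<^sub>-, \<dots>)\<close> into a multilinear map, \<open>kat\<close>
  substitutes \<open>(x; h, k, \<dots>) \<mapsto> (\<dots> k\<^sub>2 h\<^sub>2 x; h\<^sub>1, k\<^sub>1, \<dots>)\<close>.
\<close>

sublocale cot: tensor_transfer K A H A N coact act "\<lambda>c x. x"
  using bilinD(1)[OF act_bilin]
  by (intro tensor_transfer.intro A_mod H_mod N_mod coact_lin act_lin lin_id) blast+

sublocale kat: tensor_transfer K H A A N kappa "\<lambda>b x. x" act
  using bilinD(1)[OF act_bilin]
  by (intro tensor_transfer.intro A_mod H_mod N_mod kappa_lin act_lin lin_id) blast+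

abbreviation "cot \<equiv> cot.transfer"
abbreviation "kat \<equiv> kat.transfer"

text \<open>
  The first step of \<open>kat\<close> and the outermost action of \<open>cot\<close> concern the same variable. Interchange
  brings the coaction of \<open>h\<^sub>1\<close> next to \<open>\<kappa>(h)\<close>, where the two collapse; the remaining variables are
  covered by induction.
\<close>

lemma kat_cot:
  assumes P: "module K P" and "mlin K H N n P B" "hs \<in> tuples H n" "x \<in> carrier N"
  shows "kat P hs (\<lambda>y as. cot P as B y) x = B x hs"
  using assms(2-)
proof (induction n arbitrary: hs B x)
  case (Suc n)
  from Suc.prems(2) obtain h ks where hs: "hs = h # ks" "h \<in> carrier H" "ks \<in> tuples H n"
    by (rule tuples_SucE)
  note B = mlin_SucD[OF Suc.prems(1)] and x = Suc.prems(3)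
  have Bm: "mlin K H N n P (\<lambda>y hs. B (act c y) (h # hs))" if "h \<in> carrier H" "c \<in> carrier A" for h c
    using mlin_comp[OF B(1)[OF that(1)] act_lin[OF that(2)]] .
  have E: "bilin K H A P (\<lambda>h' e. B (act e x) (h' # ks))"
  proof (rule bilinI)
    fix e assume "e \<in> carrier A"
    then show "(\<lambda>h'. B (act e x) (h' # ks)) \<in> lin_maps K H P" using B(2) act_closed x hs(3) by simp
  next
    fix h' assume h': "h' \<in> carrier H"
    show "(\<lambda>e. B (act e x) (h' # ks)) \<in> lin_maps K A P"
      by (rule lin_app[OF mlinD(1)[OF B(1)[OF h'] hs(3)] bilinD(1)[OF act_bilin x]])
  qed
  have cl: "cot P as (\<lambda>z hs. B (act c z) (h' # hs)) y \<in> carrier P"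
    if "h' \<in> carrier H" "c \<in> carrier A" "y \<in> carrier N" "as \<in> tuples A n" for h' c y as
    by (rule mlinD(3)[OF cot.transfer_mlin[OF P Bm[OF that(1,2)]] that(3,4)])
  have "kat P hs (\<lambda>y as. cot P as B y) x
      = tlift K P (\<lambda>a b. tlift K P (\<lambda>h' c. B (act (c \<cdot> b) x) (h' # ks)) (coact a)) (kappa h)"
    unfolding hs(1) kat.transfer.simps
  proof (rule kappa_tlift_cong[OF P _ _ hs(2)])
    fix a b assume ab: "a \<in> carrier A" "b \<in> carrier A"
    show "tlift K P (\<lambda>h' c. B (act (c \<cdot> b) x) (h' # ks)) (coact a) \<in> carrier P"
      using ab by (intro coact_tlift_closed P bilinD(3)[OF E] A.A.m_closed)
    have "kat P ks (\<lambda>y as. cot P (a # as) B y) (act b x)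
        = tlift K P (\<lambda>h' c. kat P ks (\<lambda>y as. cot P as (\<lambda>z hs. B (act c z) (h' # hs)) y) (act b x)) (coact a)"
      unfolding cot.transfer.simps using ab x hs(3)
      by (intro kat.transfer_swap[OF P H_mod A_mod] coact_closed act_closed cl)
    also have "\<dots> = tlift K P (\<lambda>h' c. B (act (c \<cdot> b) x) (h' # ks)) (coact a)"
    proof (rule coact_tlift_cong[OF P _ _ ab(1)])
      fix h' c assume hc: "h' \<in> carrier H" "c \<in> carrier A"
      show "B (act (c \<cdot> b) x) (h' # ks) \<in> carrier P"
        using hc ab by (intro bilinD(3)[OF E] A.A.m_closed)
      show "kat P ks (\<lambda>y as. cot P as (\<lambda>z hs. B (act c z) (h' # hs)) y) (act b x)
          = B (act (c \<cdot> b) x) (h' # ks)"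
        using Suc.IH[OF Bm[OF hc] hs(3), of "act b x"] act_mult act_closed ab hc x by simp
    qed
    finally show "kat P ks (\<lambda>y as. cot P (a # as) B y) (act b x)
        = tlift K P (\<lambda>h' c. B (act (c \<cdot> b) x) (h' # ks)) (coact a)" .
  qed
  also have "\<dots> = B (act \<one>\<^bsub>A\<^esub> x) (h # ks)"
    by (rule kappa_coact[OF P E hs(2)])
  finally show ?case using x by (simp add: act_one hs(1))
qed simp

text \<open>
  As before, with \<open>\<kappa>(a\<^sub>-)\<close> collapsing against \<open>a\<^sub>0\<close>. The element that acts on the variable in \<open>N\<close>
  in between is treated as a second argument of a bilinear map on \<open>A \<otimes> A\<close>.
\<close>

lemma cot_kat:
  assumes P: "module K P" and "mlin K A N n P B" "as \<in> tuples A n" "x \<in> carrier N"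
  shows "cot P as (\<lambda>y hs. kat P hs B y) x = B x as"
  using assms(2-)
proof (induction n arbitrary: as B)
  case (Suc n)
  from Suc.prems(2) obtain a bs where as: "as = a # bs" "a \<in> carrier A" "bs \<in> tuples A n"
    by (rule tuples_SucE)
  note B = mlin_SucD[OF Suc.prems(1)] and x = Suc.prems(3)
  let ?D = "\<lambda>a' y hs. kat P hs (\<lambda>z as. B z (a' # as)) y"
  have D: "?D a' y hs \<in> carrier P" if "a' \<in> carrier A" "y \<in> carrier N" "hs \<in> tuples H n" for a' y hs
    by (rule mlinD(3)[OF kat.transfer_mlin[OF P B(1)[OF that(1)]] that(2,3)])
  have E: "bilin K A A P (\<lambda>a' e. cot P bs (\<lambda>y hs. ?D a' (act e y) hs) x)"
  proof (rule bilinI)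
    fix e assume "e \<in> carrier A"
    then show "(\<lambda>a'. cot P bs (\<lambda>y hs. ?D a' (act e y) hs) x) \<in> lin_maps K A P"
      by (intro cot.transfer_param[OF A_mod P as(3) x] kat.transfer_param[OF A_mod P] act_closed B(2))
  next
    fix a' assume a': "a' \<in> carrier A"
    have "(\<lambda>y. ?D a' y hs) \<in> lin_maps K N P" if "hs \<in> tuples H n" for hs
      by (rule mlinD(1)[OF kat.transfer_mlin[OF P B(1)[OF a']] that])
    from lin_app[OF this bilinD(1)[OF act_bilin]]
    show "(\<lambda>e. cot P bs (\<lambda>y hs. ?D a' (act e y) hs) x) \<in> lin_maps K A P"
      by (intro cot.transfer_param[OF A_mod P as(3) x])
  qed
  have "cot P as (\<lambda>y hs. kat P hs B y) x
      = tlift K P (\<lambda>h c. tlift K P (\<lambda>a' b. cot P bs (\<lambda>y hs. ?D a' (act (b \<cdot> c) y) hs) x) (kappa h)) (coact a)"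
    unfolding as(1) cot.transfer.simps kat.transfer.simps
  proof (rule coact_tlift_cong[OF P _ _ as(2)])
    fix h c assume hc: "h \<in> carrier H" "c \<in> carrier A"
    show "tlift K P (\<lambda>a' b. cot P bs (\<lambda>y hs. ?D a' (act (b \<cdot> c) y) hs) x) (kappa h) \<in> carrier P"
      using hc by (intro kappa_tlift_closed P bilinD(3)[OF E] A.A.m_closed)
    have "cot P bs (\<lambda>y hs. tlift K P (\<lambda>a' b. ?D a' (act b (act c y)) hs) (kappa h)) x
        = cot P bs (\<lambda>y hs. tlift K P (\<lambda>a' b. ?D a' (act (b \<cdot> c) y) hs) (kappa h)) x"
      using hc by (intro cot.transfer_cong[OF P as(3) x] kappa_tlift_closed P kappa_tlift_cong D act_closed A.A.m_closed)
        (simp_all add: act_mult)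
    also have "\<dots> = tlift K P (\<lambda>a' b. cot P bs (\<lambda>y hs. ?D a' (act (b \<cdot> c) y) hs) x) (kappa h)"
      using hc by (intro cot.transfer_swap[OF P A_mod A_mod _ as(3) x] kappa_closed D act_closed A.A.m_closed)
    finally show "cot P bs (\<lambda>y hs. tlift K P (\<lambda>a' b. ?D a' (act b (act c y)) hs) (kappa h)) x
        = tlift K P (\<lambda>a' b. cot P bs (\<lambda>y hs. ?D a' (act (b \<cdot> c) y) hs) x) (kappa h)" .
  qed
  also have "\<dots> = cot P bs (\<lambda>y hs. ?D a (act \<one>\<^bsub>A\<^esub> y) hs) x"
    by (rule coact_kappa[OF P E as(2)])
  also have "\<dots> = cot P bs (\<lambda>y hs. ?D a y hs) x"
    using as(2) by (intro cot.transfer_cong[OF P as(3) x] D) (simp_all add: act_one)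
  also have "\<dots> = B x (a # bs)"
    by (rule Suc.IH[OF B(1)[OF as(2)] as(3) x])
  finally show ?case by (simp add: as(1))
qed simp

text \<open>
  The inner faces: this is the multiplicativity of the coaction, applied in position \<open>i\<close>.
\<close>

lemma cot_mult_adj:
  assumes P: "module K P" and "mlin K H N n P B" "as \<in> tuples A (Suc n)" "x \<in> carrier N" "0 < i" "i \<le> n"
  shows "cot P as (\<lambda>y hs. B y (mult_adj H i hs)) x = cot P (mult_adj A i as) B x"
  using assms(2-)
proof (induction n arbitrary: as B i)
  case (Suc n)
  note B = mlin_SucD[OF Suc.prems(1)] and x = Suc.prems(3)
  have Bm: "mlin K H N n P (\<lambda>y hs. B (act c y) (h # hs))" if "h \<in> carrier H" "c \<in> carrier A" for h c
    using mlin_comp[OF B(1)[OF that(1)] act_lin[OF that(2)]] .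
  from Suc.prems(2) obtain a as' where as: "as = a # as'" "a \<in> carrier A" "as' \<in> tuples A (Suc n)"
    by (rule tuples_SucE)
  show ?case
  proof (cases "i = Suc 0")
    case True
    from as(3) obtain b bs where bs: "as' = b # bs" "b \<in> carrier A" "bs \<in> tuples A n"
      by (rule tuples_SucE)
    have E: "bilin K H A P (\<lambda>h c. cot P bs (\<lambda>y hs. B (act c y) (h # hs)) x)"
    proof (rule bilinI)
      fix c assume c: "c \<in> carrier A"
      then show "(\<lambda>h. cot P bs (\<lambda>y hs. B (act c y) (h # hs)) x) \<in> lin_maps K H P"
        by (intro cot.transfer_param[OF H_mod P bs(3) x] B(2) act_closed)
    next
      fix h assume h: "h \<in> carrier H"
      then show "(\<lambda>c. cot P bs (\<lambda>y hs. B (act c y) (h # hs)) x) \<in> lin_maps K A P"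
        by (intro cot.transfer_param[OF A_mod P bs(3) x] lin_app[OF mlinD(1)[OF B(1)]] bilinD(1)[OF act_bilin])
    qed
    have "cot P as (\<lambda>y hs. B y (mult_adj H i hs)) x = tlift K P (\<lambda>h c. tlift K P (\<lambda>h' c'.
        cot P bs (\<lambda>y hs. B (act (c \<cdot> c') y) ((h \<otimes>\<^bsub>H\<^esub> h') # hs)) x) (coact b)) (coact a)"
      unfolding as(1) bs(1) cot.transfer.simps True mult_adj_simps
      using as(2) bs(2,3) x
      by (intro coact_tlift_cong P coact_tlift_closed bilinD(3)[OF E] cot.transfer_cong[OF P bs(3) x]
          mlinD(3)[OF Bm] A.A.m_closed H.A.m_closed)
        (simp_all add: act_mult)
    also have "\<dots> = tlift K P (\<lambda>h c. cot P bs (\<lambda>y hs. B (act c y) (h # hs)) x) (coact (a \<cdot> b))"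
      by (rule coact_mult[OF P E as(2) bs(2), symmetric])
    finally show ?thesis by (simp add: as(1) bs(1) True)
  next
    case False
    then obtain j where i: "i = Suc (Suc j)" using Suc.prems(4) by (cases i; cases "i - 1") auto
    then have j: "Suc j \<le> n" using Suc.prems(5) by simp
    have m: "mult_adj A (Suc j) as' \<in> tuples A n" by (rule A.mult_adj_tuples[OF as(3) _ j]) simp
    show ?thesis
      unfolding as(1) i mult_adj_simps cot.transfer.simps using as(2,3) j x
      by (intro coact_tlift_cong P cot.transfer_closed[OF P m x] mlinD(3)[OF Bm] Suc.IH[OF Bm]) simp_all
  qed
qed simp

text \<open>
  The face at the end of the list: the counit axiom \<open>\<epsilon>(a\<^sub>-) a\<^sub>0 = a\<close> for the last entry, whose
  component in \<open>A\<close> acts first.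
\<close>

lemma cot_counit_last:
  assumes P: "module K P" and "mlin K H N n P B" "as \<in> tuples A (Suc n)" "x \<in> carrier N"
  shows "cot P as (\<lambda>y hs. counit (last hs) \<odot>\<^bsub>P\<^esub> B y (butlast hs)) x = cot P (butlast as) B (act (last as) x)"
  using assms(2-)
proof (induction n arbitrary: as B)
  case 0
  then obtain a where as: "as = [a]" "a \<in> carrier A" by (auto elim!: tuples_SucE)
  have "(\<lambda>c. B (act c x) []) \<in> lin_maps K A P"
    using 0 by (intro lin_app[OF _ bilinD(1)[OF act_bilin]]) simp_all
  then show ?case using coact_counit_lin[OF P _ as(2)] by (simp add: as)
next
  case (Suc n)
  note B = mlin_SucD[OF Suc.prems(1)] and x = Suc.prems(3)
  interpret P: module K P by (rule P)
  have Bm: "mlin K H N n P (\<lambda>y hs. B (act c y) (h # hs))" if "h \<in> carrier H" "c \<in> carrier A" for h c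
    using mlin_comp[OF B(1)[OF that(1)] act_lin[OF that(2)]] .
  from Suc.prems(2) obtain a as' where as: "as = a # as'" "a \<in> carrier A" "as' \<in> tuples A (Suc n)"
    by (rule tuples_SucE)
  have ne: "as' \<noteq> []" "last as' \<in> carrier A" "butlast as' \<in> tuples A n"
    using as(3) by (cases as' rule: rev_cases; auto simp: tuples_def)+
  have hs: "hs \<noteq> []" "last hs \<in> carrier H" "butlast hs \<in> tuples H n" if "hs \<in> tuples H (Suc n)" for hs
    using that by (cases hs rule: rev_cases; auto simp: tuples_def)+
  have eqs: "butlast as = a # butlast as'" "last as = last as'" using ne(1) by (simp_all add: as(1))
  show ?case
    unfolding eqs unfolding as(1) cot.transfer.simps
  proof (rule coact_tlift_cong[OF P _ _ as(2)])
    fix h c assume hc: "h \<in> carrier H" "c \<in> carrier A"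
    show "cot P (butlast as') (\<lambda>y hs. B (act c y) (h # hs)) (act (last as') x) \<in> carrier P"
      by (rule cot.transfer_closed[OF P ne(3) act_closed[OF ne(2) x] mlinD(3)[OF Bm[OF hc]]])
    have "cot P as' (\<lambda>y hs. counit (last (h # hs)) \<odot>\<^bsub>P\<^esub> B (act c y) (butlast (h # hs))) x
        = cot P as' (\<lambda>y hs. counit (last hs) \<odot>\<^bsub>P\<^esub> B (act c y) (h # butlast hs)) x"
      by (intro cot.transfer_cong[OF P as(3) x]) (simp_all add: hs counit_closed mlinD(3)[OF Bm[OF hc]])
    also have "\<dots> = cot P (butlast as') (\<lambda>y hs. B (act c y) (h # hs)) (act (last as') x)"
      by (rule Suc.IH[OF Bm[OF hc] as(3) x])
    finally show "cot P as' (\<lambda>y hs. counit (last (h # hs)) \<odot>\<^bsub>P\<^esub> B (act c y) (butlast (h # hs))) x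
        = cot P (butlast as') (\<lambda>y hs. B (act c y) (h # hs)) (act (last as') x)" .
  qed
qed

text \<open>
  The face at the head of the list: a term that depends on the first component \<open>a\<^sub>-\<close> in an arbitrary
  way is collected next to \<open>a\<^sub>0\<close>, the outermost element that acts.
\<close>

lemma cot_hd:
  assumes P: "module K P" and "as \<in> tuples A n" "x \<in> carrier N" "a \<in> carrier A"
    and F: "\<And>h y hs. h \<in> carrier H \<Longrightarrow> y \<in> carrier N \<Longrightarrow> hs \<in> tuples H n \<Longrightarrow> F h y hs \<in> carrier P"
  shows "cot P (a # as) (\<lambda>y hs. F (hd hs) y (tl hs)) x
    = cot P as (\<lambda>y hs. tlift K P (\<lambda>h c. F h (act c y) hs) (coact a)) x"
  using assms(2-4) by (simp add: cot.transfer_swap[OF P H_mod A_mod coact_closed, where n = n] F act_closed)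

end

section \<open>The twisted bimodules\<close>

lemma (in alg_bimodule) face_closed:
  assumes "x \<in> carrier M" "as \<in> tuples A (Suc n)" "i \<le> Suc n"
  shows "hoch_face A M i (x, as) \<in> carrier M \<times> tuples A n"
proof -
  have len: "length as = Suc n" using assms(2) by (simp add: tuples_def)
  consider "i = 0" | "0 < i" "i \<le> n" | "i = Suc n" using assms(3) by linarith
  then show ?thesis
  proof cases
    case 1
    then show ?thesis using assms(1,2) by (auto simp: hoch_face_def ract_closed elim!: tuples_SucE)
  next
    case 2
    then show ?thesis using assms(1) A.mult_adj_tuples[OF assms(2) 2] by (simp add: hoch_face_def len)
  next
    case 3
    have "last as \<in> carrier A" "butlast as \<in> tuples A n"
      using assms(2) by (cases as rule: rev_cases; auto simp: tuples_def)+
    then show ?thesis using assms(1) 3 len by (simp add: hoch_face_def lact_closed)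
  qed
qed

context left_galois_object
begin

text \<open>
  The right action \<open>m \<triangleleft> h = h\<^sub>2 m h\<^sub>1\<close> and the left action \<open>h \<triangleright> m = h\<^sub>1 m h\<^sub>2\<close>. For \<open>A = H\<close> the latter
  is the adjoint action.
\<close>

definition ad_right where
  "ad_right M m h = tlift K M (\<lambda>a b. lact M b (ract M m a)) (kappa h)"

definition ad_left where
  "ad_left M h m = tlift K M (\<lambda>a b. lact M a (ract M m b)) (kappa h)"

text \<open>
  The objects \<open>M'\<close> and \<open>M''\<close>. The nontrivial action is on the right for homology and on the left for
  cohomology.
\<close>

definition right_twist where
  "right_twist M = \<lparr>carrier = carrier M, mult = mult M, one = one M, zero = zero M, add = add M,
     smult = smult M, lact = (\<lambda>h m. counit h \<odot>\<^bsub>M\<^esub> m), ract = ad_right M\<rparr>"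

definition left_twist where
  "left_twist M = \<lparr>carrier = carrier M, mult = mult M, one = one M, zero = zero M, add = add M,
     smult = smult M, lact = ad_left M, ract = (\<lambda>m h. counit h \<odot>\<^bsub>M\<^esub> m)\<rparr>"

lemma twist_sel [simp]:
  "carrier (right_twist M) = carrier M" "add (right_twist M) = add M"
  "zero (right_twist M) = zero M" "smult (right_twist M) = smult M"
  "lact (right_twist M) = (\<lambda>h m. counit h \<odot>\<^bsub>M\<^esub> m)" "ract (right_twist M) = ad_right M"
  "carrier (left_twist M) = carrier M" "add (left_twist M) = add M"
  "zero (left_twist M) = zero M" "smult (left_twist M) = smult M"
  "lact (left_twist M) = ad_left M" "ract (left_twist M) = (\<lambda>m h. counit h \<odot>\<^bsub>M\<^esub> m)"
  by (simp_all add: right_twist_def left_twist_def)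

lemma counit_rules:
  "h \<in> carrier H \<Longrightarrow> k \<in> carrier H \<Longrightarrow> counit (h \<oplus>\<^bsub>H\<^esub> k) = counit h \<oplus>\<^bsub>K\<^esub> counit k"
  "h \<in> carrier H \<Longrightarrow> k \<in> carrier H \<Longrightarrow> counit (h \<otimes>\<^bsub>H\<^esub> k) = counit h \<otimes>\<^bsub>K\<^esub> counit k"
  "counit \<one>\<^bsub>H\<^esub> = \<one>\<^bsub>K\<^esub>"
  using H.counit_hom by (auto simp: ring_hom_def)

end

locale galois_bimodule =
  left_galois_object K H comult counit antipode A coact + B: alg_bimodule K A M
  for K :: "('k, 'r) ring_scheme" and H :: "('k, 'h, 's) module_scheme"
    and comult counit antipode and A :: "('k, 'a, 't) module_scheme" and coact
    and M :: "('k, 'm, 'a, 'u) bimodule_scheme"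
begin

lemmas M_mod = B.modules(2)
lemmas lact_bilin = B.act_bilin(1) and ract_bilin = B.act_bilin(2)

lemma ad_right_bilin: "m \<in> carrier M \<Longrightarrow> bilin K A A M (\<lambda>a b. lact M b (ract M m a))"
  by (intro bilinI bilin_lin_l[OF lact_bilin] bilin_lin_r[OF lact_bilin] bilin_lin_r[OF ract_bilin]
    bilinD(3)[OF ract_bilin] lin_id)

lemma ad_left_bilin: "m \<in> carrier M \<Longrightarrow> bilin K A A M (\<lambda>a b. lact M a (ract M m b))"
  by (intro bilinI bilin_lin_l[OF lact_bilin] bilin_lin_r[OF lact_bilin] bilin_lin_r[OF ract_bilin]
    bilinD(3)[OF ract_bilin] lin_id)

lemma ad_bilin: "bilin K M H M (ad_right M)" "bilin K H M M (ad_left M)"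
  unfolding ad_right_def[abs_def] ad_left_def[abs_def]
  by (intro bilinI kappa_tlift_lin M_mod ad_right_bilin kappa_tlift_param
      bilin_lin_r[OF lact_bilin] bilin_lin_l[OF ract_bilin] lin_id; assumption)
    (intro bilinI kappa_tlift_lin M_mod ad_left_bilin kappa_tlift_param
      bilin_lin_r[OF lact_bilin] bilin_lin_l[OF ract_bilin] lin_id; assumption)

lemma ad_one:
  assumes "m \<in> carrier M"
  shows "ad_right M m \<one>\<^bsub>H\<^esub> = m" "ad_left M \<one>\<^bsub>H\<^esub> m = m"
  using assms by (simp_all add: ad_right_def ad_left_def kappa_one[OF M_mod] ad_right_bilin
    ad_left_bilin B.lact_one B.ract_one)

text \<open>
  \<open>k\<^sub>2 (h\<^sub>2 m h\<^sub>1) k\<^sub>1 = (k\<^sub>2 h\<^sub>2) m (h\<^sub>1 k\<^sub>1)\<close>, and these are the two factors of \<open>\<kappa>(h k)\<close>.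
\<close>

lemma ad_right_mult:
  assumes m: "m \<in> carrier M" and hk: "h \<in> carrier H" "k \<in> carrier H"
  shows "ad_right M m (h \<otimes>\<^bsub>H\<^esub> k) = ad_right M (ad_right M m h) k"
proof -
  let ?E = "\<lambda>a b a' b'. lact M (b' \<cdot> b) (ract M m (a \<cdot> a'))"
  have E: "?E a b a' b' \<in> carrier M" if "a \<in> carrier A" "b \<in> carrier A" "a' \<in> carrier A" "b' \<in> carrier A"
    for a b a' b' using that m by (intro B.lact_closed B.ract_closed A.A.m_closed)
  have "ad_right M (ad_right M m h) k = tlift K M (\<lambda>a' b'. tlift K M (\<lambda>a b. ?E a b a' b') (kappa h)) (kappa k)"
    unfolding ad_right_def[of M "ad_right M m h"]
  proof (rule kappa_tlift_cong[OF M_mod _ _ hk(2)])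
    fix a' b' assume ab: "a' \<in> carrier A" "b' \<in> carrier A"
    show "tlift K M (\<lambda>a b. ?E a b a' b') (kappa h) \<in> carrier M"
      using ab hk by (intro kappa_tlift_closed M_mod E)
    have l: "(\<lambda>x. lact M b' (ract M x a')) \<in> lin_maps K M M"
      using ab by (intro bilin_lin_r[OF lact_bilin] bilin_lin_l[OF ract_bilin] lin_id)
    have "lact M b' (ract M (ad_right M m h) a')
        = tlift K M (\<lambda>a b. lact M b' (ract M (lact M b (ract M m a)) a')) (kappa h)"
      unfolding ad_right_def using m hk
      by (intro kappa_tlift_hom[OF M_mod M_mod l] B.lact_closed B.ract_closed)
    also have "\<dots> = tlift K M (\<lambda>a b. ?E a b a' b') (kappa h)"
      using m hk ab by (intro kappa_tlift_cong M_mod E)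
        (simp_all add: B.act_commute B.lact_mult B.ract_mult B.ract_closed)
    finally show "lact M b' (ract M (ad_right M m h) a') = tlift K M (\<lambda>a b. ?E a b a' b') (kappa h)" .
  qed
  also have "\<dots> = tlift K M (\<lambda>a b. tlift K M (\<lambda>a' b'. ?E a b a' b') (kappa k)) (kappa h)"
    using hk by (intro tlift_swap[OF A_mod A_mod M_mod A_mod A_mod] E kappa_closed)
  also have "\<dots> = ad_right M m (h \<otimes>\<^bsub>H\<^esub> k)"
    unfolding ad_right_def by (rule kappa_mult[OF M_mod ad_right_bilin[OF m] hk, symmetric])
  finally show ?thesis by (rule sym)
qed

lemma ad_left_mult:
  assumes m: "m \<in> carrier M" and hk: "h \<in> carrier H" "k \<in> carrier H"
  shows "ad_left M (h \<otimes>\<^bsub>H\<^esub> k) m = ad_left M h (ad_left M k m)"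
proof -
  let ?E = "\<lambda>a b a' b'. lact M (a \<cdot> a') (ract M m (b' \<cdot> b))"
  have E: "?E a b a' b' \<in> carrier M" if "a \<in> carrier A" "b \<in> carrier A" "a' \<in> carrier A" "b' \<in> carrier A"
    for a b a' b' using that m by (intro B.lact_closed B.ract_closed A.A.m_closed)
  have "ad_left M h (ad_left M k m) = tlift K M (\<lambda>a b. tlift K M (\<lambda>a' b'. ?E a b a' b') (kappa k)) (kappa h)"
    unfolding ad_left_def[of M h "ad_left M k m"]
  proof (rule kappa_tlift_cong[OF M_mod _ _ hk(1)])
    fix a b assume ab: "a \<in> carrier A" "b \<in> carrier A"
    show "tlift K M (\<lambda>a' b'. ?E a b a' b') (kappa k) \<in> carrier M"
      using ab hk by (intro kappa_tlift_closed M_mod E)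
    have l: "(\<lambda>x. lact M a (ract M x b)) \<in> lin_maps K M M"
      using ab by (intro bilin_lin_r[OF lact_bilin] bilin_lin_l[OF ract_bilin] lin_id)
    have "lact M a (ract M (ad_left M k m) b)
        = tlift K M (\<lambda>a' b'. lact M a (ract M (lact M a' (ract M m b')) b)) (kappa k)"
      unfolding ad_left_def using m hk
      by (intro kappa_tlift_hom[OF M_mod M_mod l] B.lact_closed B.ract_closed)
    also have "\<dots> = tlift K M (\<lambda>a' b'. ?E a b a' b') (kappa k)"
      using m hk ab by (intro kappa_tlift_cong M_mod E)
        (simp_all add: B.act_commute B.lact_mult B.ract_mult B.ract_closed)
    finally show "lact M a (ract M (ad_left M k m) b) = tlift K M (\<lambda>a' b'. ?E a b a' b') (kappa k)" .
  qed
  also have "\<dots> = ad_left M (h \<otimes>\<^bsub>H\<^esub> k) m"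
    unfolding ad_left_def by (rule kappa_mult[OF M_mod ad_left_bilin[OF m] hk, symmetric])
  finally show ?thesis by (rule sym)
qed

text \<open>
  \<open>(a\<^sub>0 m) \<triangleleft> a\<^sub>- = m a\<close>: by \<open>coact_kappa\<close>, the product of \<open>\<kappa>(a\<^sub>-)\<close> and \<open>1 \<otimes> a\<^sub>0\<close> is \<open>a \<otimes> 1\<close>.
\<close>

lemma coact_ad_right:
  assumes m: "m \<in> carrier M" and a: "a \<in> carrier A"
  shows "tlift K M (\<lambda>h c. ad_right M (lact M c m) h) (coact a) = ract M m a"
proof -
  have E: "bilin K A A M (\<lambda>a' e. lact M e (ract M m a'))" by (rule ad_right_bilin[OF m])
  have "tlift K M (\<lambda>h c. ad_right M (lact M c m) h) (coact a)
      = tlift K M (\<lambda>h c. tlift K M (\<lambda>a' b. lact M (b \<cdot> c) (ract M m a')) (kappa h)) (coact a)"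
    unfolding ad_right_def using a m
    by (intro coact_tlift_cong kappa_tlift_cong kappa_tlift_closed M_mod bilinD(3)[OF E] A.A.m_closed)
      (simp_all add: B.act_commute B.lact_mult B.ract_closed)
  also have "\<dots> = lact M \<one>\<^bsub>A\<^esub> (ract M m a)"
    by (rule coact_kappa[OF M_mod E a])
  finally show ?thesis using m a by (simp add: B.lact_one B.ract_closed)
qed

text \<open>
  \<open>(a\<^sub>- \<triangleright> m) a\<^sub>0 = a m\<close>, for the same reason.
\<close>

lemma coact_ad_left:
  assumes m: "m \<in> carrier M" and a: "a \<in> carrier A"
  shows "tlift K M (\<lambda>h c. ract M (ad_left M h m) c) (coact a) = lact M a m"
proof -
  have E: "bilin K A A M (\<lambda>a' e. lact M a' (ract M m e))" by (rule ad_left_bilin[OF m])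
  have "tlift K M (\<lambda>h c. ract M (ad_left M h m) c) (coact a)
      = tlift K M (\<lambda>h c. tlift K M (\<lambda>a' b. lact M a' (ract M m (b \<cdot> c))) (kappa h)) (coact a)"
  proof (rule coact_tlift_cong[OF M_mod _ _ a])
    fix h c assume hc: "h \<in> carrier H" "c \<in> carrier A"
    show "tlift K M (\<lambda>a' b. lact M a' (ract M m (b \<cdot> c))) (kappa h) \<in> carrier M"
      using hc by (intro kappa_tlift_closed M_mod bilinD(3)[OF E] A.A.m_closed)
    have "ract M (ad_left M h m) c = tlift K M (\<lambda>a' b. ract M (lact M a' (ract M m b)) c) (kappa h)"
      unfolding ad_left_def using hc bilinD(3)[OF E]
      by (intro kappa_tlift_hom[OF M_mod M_mod bilinD(1)[OF ract_bilin]])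
    also have "\<dots> = tlift K M (\<lambda>a' b. lact M a' (ract M m (b \<cdot> c))) (kappa h)"
      using hc m by (intro kappa_tlift_cong M_mod bilinD(3)[OF E] A.A.m_closed)
        (simp_all add: B.act_commute B.ract_mult B.ract_closed)
    finally show "ract M (ad_left M h m) c = tlift K M (\<lambda>a' b. lact M a' (ract M m (b \<cdot> c))) (kappa h)" .
  qed
  also have "\<dots> = lact M a (ract M m \<one>\<^bsub>A\<^esub>)"
    by (rule coact_kappa[OF M_mod E a])
  finally show ?thesis using m by (simp add: B.ract_one)
qed

lemma twist_mod: "module K (right_twist M)" "module K (left_twist M)"
  by (rule module_cong[OF M_mod]; simp)+

lemma twist_lin:
  "lin_maps K (right_twist M) P = lin_maps K M P" "lin_maps K (left_twist M) P = lin_maps K M P"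
  by (simp_all add: lin_maps_def)

lemma smult_left_comm:
  assumes "c \<in> carrier K" "d \<in> carrier K" "m \<in> carrier M"
  shows "c \<odot>\<^bsub>M\<^esub> (d \<odot>\<^bsub>M\<^esub> m) = d \<odot>\<^bsub>M\<^esub> (c \<odot>\<^bsub>M\<^esub> m)"
  using lin_smult[OF lin_smult_map[OF M_mod assms(1)] assms(2,3)] .

lemma right_twist_bimodule: "alg_bimodule K H (right_twist M)"
proof -
  note b = ad_bilin(1)
  show ?thesis
    by (intro alg_bimodule.intro H.assoc_algebra_axioms twist_mod alg_bimodule_axioms.intro)
      (simp_all add: counit_closed counit_rules H.counit_smult B.M.smult_l_distr B.M.smult_r_distr B.M.smult_assoc1
        bilinD(3)[OF b] lin_add[OF bilinD(1)[OF b]] lin_add[OF bilinD(2)[OF b]]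
        lin_smult[OF bilinD(1)[OF b]] lin_smult[OF bilinD(2)[OF b]] ad_one ad_right_mult
        smult_left_comm)
qed

lemma left_twist_bimodule: "alg_bimodule K H (left_twist M)"
proof -
  note b = ad_bilin(2)
  show ?thesis
    by (intro alg_bimodule.intro H.assoc_algebra_axioms twist_mod alg_bimodule_axioms.intro)
      (simp_all add: counit_closed counit_rules H.counit_smult B.M.smult_l_distr B.M.smult_r_distr B.M.smult_assoc1
        bilinD(3)[OF b] lin_add[OF bilinD(1)[OF b]] lin_add[OF bilinD(2)[OF b]]
        lin_smult[OF bilinD(1)[OF b]] lin_smult[OF bilinD(2)[OF b]] ad_one ad_left_mult
        smult_left_comm)
qed

end

context left_galois_object
begin

text \<open>
  The new actions are sums of compositions of old ones, with coefficients that do not depend on the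
  bimodule, so bimodule maps respect them.
\<close>

lemma bimod_hom_twist:
  assumes M: "alg_bimodule K A M" and N: "alg_bimodule K A N" and f: "f \<in> bimod_hom K A M N"
  shows "f \<in> bimod_hom K H (right_twist M) (right_twist N)"
    and "f \<in> bimod_hom K H (left_twist M) (left_twist N)"
proof -
  interpret M: galois_bimodule K H comult counit antipode A coact M
    by (intro galois_bimodule.intro left_galois_object_axioms M)
  interpret N: galois_bimodule K H comult counit antipode A coact N
    by (intro galois_bimodule.intro left_galois_object_axioms N)
  have l: "f \<in> lin_maps K M N" and e: "f \<in> extensional (carrier M)"
    and c: "\<And>a m. a \<in> carrier A \<Longrightarrow> m \<in> carrier M \<Longrightarrow> f (lact M a m) = lact N a (f m)"
      "\<And>a m. a \<in> carrier A \<Longrightarrow> m \<in> carrier M \<Longrightarrow> f (ract M m a) = ract N (f m) a"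
    using f by (auto simp: bimod_hom_def)
  have R: "f (ad_right M m h) = ad_right N (f m) h" if m: "m \<in> carrier M" and h: "h \<in> carrier H" for m h
  proof -
    have "f (ad_right M m h) = tlift K N (\<lambda>a b. f (lact M b (ract M m a))) (kappa h)"
      unfolding ad_right_def using m h
      by (intro kappa_tlift_hom[OF M.M_mod N.M_mod l] M.B.lact_closed M.B.ract_closed)
    also have "\<dots> = ad_right N (f m) h"
      unfolding ad_right_def using m h
      by (intro kappa_tlift_cong N.M_mod) (simp_all add: c M.B.ract_closed N.B.lact_closed N.B.ract_closed lin_closed[OF l])
    finally show ?thesis .
  qed
  have L: "f (ad_left M h m) = ad_left N h (f m)" if m: "m \<in> carrier M" and h: "h \<in> carrier H" for m h
  proof -
    have "f (ad_left M h m) = tlift K N (\<lambda>a b. f (lact M a (ract M m b))) (kappa h)"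
      unfolding ad_left_def using m h
      by (intro kappa_tlift_hom[OF M.M_mod N.M_mod l] M.B.lact_closed M.B.ract_closed)
    also have "\<dots> = ad_left N h (f m)"
      unfolding ad_left_def using m h
      by (intro kappa_tlift_cong N.M_mod) (simp_all add: c M.B.ract_closed N.B.lact_closed N.B.ract_closed lin_closed[OF l])
    finally show ?thesis .
  qed
  have l': "f \<in> lin_maps K (right_twist M) (right_twist N)" "f \<in> lin_maps K (left_twist M) (left_twist N)"
    using l by (simp_all add: lin_maps_def)
  show "f \<in> bimod_hom K H (right_twist M) (right_twist N)"
    and "f \<in> bimod_hom K H (left_twist M) (left_twist N)"
    unfolding bimod_hom_def using l' e R L lin_smult[OF l] by (simp_all add: counit_closed)
qed

lemma right_twist_functor: "bimod_functor K A H right_twist (\<lambda>M N f. f)"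
  unfolding bimod_functor_def
proof (intro conjI allI impI ballI)
  fix M :: "('a, 'm, 'e) bimodule" assume "alg_bimodule K A M"
  then show "alg_bimodule K H (right_twist M)"
    by (rule galois_bimodule.right_twist_bimodule[OF galois_bimodule.intro[OF left_galois_object_axioms]])
qed (simp_all add: bimod_hom_twist(1))

lemma left_twist_functor: "bimod_functor K A H left_twist (\<lambda>M N f. f)"
  unfolding bimod_functor_def
proof (intro conjI allI impI ballI)
  fix M :: "('a, 'm, 'e) bimodule" assume "alg_bimodule K A M"
  then show "alg_bimodule K H (left_twist M)"
    by (rule galois_bimodule.left_twist_bimodule[OF galois_bimodule.intro[OF left_galois_object_axioms]])
qed (simp_all add: bimod_hom_twist(2))

end


section \<open>Homology\<close>

context galois_bimodule
begin

sublocale C: galois_module K H comult counit antipode A coact M "lact M"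
  by unfold_locales (simp_all add: M_mod lact_bilin B.lact_one B.lact_mult)

sublocale RT: alg_bimodule K H "right_twist M"
  by (rule right_twist_bimodule)

lemma right_twist_mlin: "mlin K H (right_twist M) n P F \<longleftrightarrow> mlin K H M n P F"
  by (simp add: mlin_def twist_lin)

text \<open>
  Each face of the Hochschild complex of \<open>H\<close> corresponds to the face of the same index for \<open>A\<close>. The
  face of index \<open>0\<close> rests on \<open>(a\<^sub>0 m) \<triangleleft> a\<^sub>- = m a\<close>, and on the fact that right multiplication by
  \<open>a\<close> commutes with the left actions of the other components.
\<close>

lemma cot_face:
  assumes P: "module K P" and F: "mlin K H M n P F" and as: "as \<in> tuples A (Suc n)"
    and x: "x \<in> carrier M" and i: "i \<le> Suc n"
  shows "C.cot P as (\<lambda>y hs. case hoch_face H (right_twist M) i (y, hs) of (z, ks) \<Rightarrow> F z ks) x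
    = (case hoch_face A M i (x, as) of (z, bs) \<Rightarrow> C.cot P bs F z)"
proof -
  have F': "mlin K H M (Suc n) P (\<lambda>y hs. case hoch_face H (right_twist M) i (y, hs) of (z, ks) \<Rightarrow> F z ks)"
    using RT.face_mlin[of n P F i] F i unfolding right_twist_mlin by simp
  have lenH: "length hs = Suc n" if "hs \<in> tuples H (Suc n)" for hs
    using that by (simp add: tuples_def)
  have lenA: "length as = Suc n" using as by (simp add: tuples_def)
  consider "i = 0" | "0 < i" "i \<le> n" | "i = Suc n" using i by linarith
  then show ?thesis
  proof cases
    case 1
    from as obtain a bs where as': "as = a # bs" "a \<in> carrier A" "bs \<in> tuples A n" by (rule tuples_SucE)
    have "C.cot P as (\<lambda>y hs. F (ad_right M y (hd hs)) (tl hs)) x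
        = C.cot P bs (\<lambda>y hs. tlift K P (\<lambda>h c. F (ad_right M (lact M c y) h) hs) (coact a)) x"
      unfolding as'(1)
      by (rule C.cot_hd[OF P as'(3) x as'(2)]) (intro mlinD(3)[OF F] bilinD(3)[OF ad_bilin(1)])
    also have "\<dots> = C.cot P bs (\<lambda>y hs. F (ract M y a) hs) x"
    proof (rule C.cot.transfer_cong[OF P as'(3) x])
      fix y hs assume y: "y \<in> carrier M" and hs: "hs \<in> tuples H n"
      show "F (ract M y a) hs \<in> carrier P" using y hs as'(2) by (intro mlinD(3)[OF F] B.ract_closed)
      have "F (tlift K M (\<lambda>h c. ad_right M (lact M c y) h) (coact a)) hs
          = tlift K P (\<lambda>h c. F (ad_right M (lact M c y) h) hs) (coact a)"
        using y by (intro coact_tlift_hom[OF M_mod P mlinD(1)[OF F hs] _ as'(2)]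
          bilinD(3)[OF ad_bilin(1)] B.lact_closed)
      then show "tlift K P (\<lambda>h c. F (ad_right M (lact M c y) h) hs) (coact a) = F (ract M y a) hs"
        using coact_ad_right[OF y as'(2)] by simp
    qed
    also have "\<dots> = C.cot P bs F (ract M x a)"
      by (rule C.cot.transfer_base[OF P _ _ _ as'(3) x mlinD(3)[OF F]])
        (simp_all add: B.ract_closed as'(2) B.act_commute)
    finally show ?thesis using 1 by (simp add: hoch_face_def as'(1))
  next
    case 2
    have "C.cot P as (\<lambda>y hs. F y (mult_adj H i hs)) x = C.cot P (mult_adj A i as) F x"
      by (rule C.cot_mult_adj[OF P F as x 2])
    moreover have "C.cot P as (\<lambda>y hs. F y (mult_adj H i hs)) x
        = C.cot P as (\<lambda>y hs. case hoch_face H (right_twist M) i (y, hs) of (z, ks) \<Rightarrow> F z ks) x"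
      using 2 by (intro C.cot.transfer_cong[OF P as x mlinD(3)[OF F']]) (simp_all add: hoch_face_def lenH)
    ultimately show ?thesis using 2 by (simp add: hoch_face_def lenA)
  next
    case 3
    have hs: "last hs \<in> carrier H" "butlast hs \<in> tuples H n" if "hs \<in> tuples H (Suc n)" for hs
      using that by (cases hs rule: rev_cases; auto simp: tuples_def)+
    have "C.cot P as (\<lambda>y hs. counit (last hs) \<odot>\<^bsub>P\<^esub> F y (butlast hs)) x
        = C.cot P (butlast as) F (lact M (last as) x)"
      by (rule C.cot_counit_last[OF P F as x])
    moreover have "C.cot P as (\<lambda>y hs. counit (last hs) \<odot>\<^bsub>P\<^esub> F y (butlast hs)) x
        = C.cot P as (\<lambda>y hs. case hoch_face H (right_twist M) i (y, hs) of (z, ks) \<Rightarrow> F z ks) x"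
      using 3 by (intro C.cot.transfer_cong[OF P as x mlinD(3)[OF F']])
        (simp_all add: hoch_face_def lenH lin_smult[OF mlinD(1)[OF F]] hs counit_closed)
    ultimately show ?thesis using 3 by (simp add: hoch_face_def lenA)
  qed
qed

lemma cot_alt:
  assumes P: "module K P" and F: "mlin K H M n P F" and as: "as \<in> tuples A (Suc n)" and x: "x \<in> carrier M"
  shows "C.cot P as (hoch_alt K H (right_twist M) n P F) x
    = hoch_alt K A M n P (\<lambda>x as. C.cot P as F x) x as"
proof -
  interpret P: module K P by (rule P)
  have F': "mlin K H M (Suc n) P (\<lambda>y hs. case hoch_face H (right_twist M) i (y, hs) of (z, ks) \<Rightarrow> F z ks)"
    if "i \<in> {0..Suc n}" for i
    using RT.face_mlin[of n P F i] F that unfolding right_twist_mlin by simp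
  have G': "mlin K A M (Suc n) P (\<lambda>x as. case hoch_face A M i (x, as) of (z, bs) \<Rightarrow> C.cot P bs F z)"
    if "i \<in> {0..Suc n}" for i
    using that by (intro B.face_mlin[OF C.cot.transfer_mlin[OF P F]]) simp
  have "C.cot P as (hoch_alt K H (right_twist M) n P F) x = (\<Oplus>\<^bsub>P\<^esub>i\<in>{0..Suc n}. sgn_pow K i \<odot>\<^bsub>P\<^esub>
      C.cot P as (\<lambda>y hs. case hoch_face H (right_twist M) i (y, hs) of (z, ks) \<Rightarrow> F z ks) x)"
    unfolding hoch_alt_def[abs_def]
    by (rule C.cot.transfer_sum[OF P _ _ as x mlinD(3)[OF F']]) simp_all
  also have "\<dots> = hoch_alt K A M n P (\<lambda>x as. C.cot P as F x) x as"
    unfolding hoch_alt_def using mlinD(3)[OF G' x as]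
    by (intro P.M.finsum_cong') (simp_all add: cot_face[OF P F as x])
  finally show ?thesis .
qed

abbreviation "DA n \<equiv> hoch_chains K A M n"
abbreviation "DH n \<equiv> hoch_chains K H (right_twist M) n"
abbreviation "pA n x as \<equiv> hoch_pure K A M n (x, as)"
abbreviation "pH n x hs \<equiv> hoch_pure K H (right_twist M) n (x, hs)"

text \<open>
  The universal chain map: the transfer of the generator of the chains of \<open>H\<close>.
\<close>

definition chain_iso where
  "chain_iso n = pres_lift K (DH n) (\<lambda>(x, as).
     C.cot (DH n) as (pH n) x)"

definition chain_inv where
  "chain_inv n = pres_lift K (DA n) (\<lambda>(x, hs).
     C.kat (DA n) hs (pA n) x)"

lemmas CA_mod = hoch_chains_module[OF A_mod M_mod]
lemmas CH_mod = hoch_chains_module[OF H_mod twist_mod(1)]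

lemma pureH_mlin: "mlin K H M n (DH n) (pH n)"
  using hoch_pure_mlin[OF H_mod twist_mod(1)] unfolding right_twist_mlin .

lemmas pureA_mlin = hoch_pure_mlin[OF A_mod M_mod]

lemma chain_iso_lin: "chain_iso n \<in> lin_maps K (DA n) (DH n)"
  and chain_iso_pure: "x \<in> carrier M \<Longrightarrow> as \<in> tuples A n \<Longrightarrow> chain_iso n (pA n x as)
    = C.cot (DH n) as (pH n) x"
  unfolding chain_iso_def
  by (rule chain_lift_lin[OF A_mod M_mod CH_mod C.cot.transfer_mlin[OF CH_mod pureH_mlin]],
    rule chain_lift_pure[OF A_mod M_mod CH_mod C.cot.transfer_mlin[OF CH_mod pureH_mlin]])

lemma chain_inv_lin: "chain_inv n \<in> lin_maps K (DH n) (DA n)"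
  and chain_inv_pure: "x \<in> carrier M \<Longrightarrow> hs \<in> tuples H n \<Longrightarrow> chain_inv n (pH n x hs)
    = C.kat (DA n) hs (pA n) x"
proof -
  have m: "mlin K H (right_twist M) n (DA n)
      (\<lambda>x hs. C.kat (DA n) hs (pA n) x)"
    unfolding right_twist_mlin by (rule C.kat.transfer_mlin[OF CA_mod pureA_mlin])
  show "chain_inv n \<in> lin_maps K (DH n) (DA n)"
    unfolding chain_inv_def by (rule chain_lift_lin[OF H_mod twist_mod(1) CA_mod m])
  show "chain_inv n (pH n x hs)
      = C.kat (DA n) hs (pA n) x"
    if "x \<in> carrier M" "hs \<in> tuples H n"
    unfolding chain_inv_def using chain_lift_pure[OF H_mod twist_mod(1) CA_mod m] that by simp
qed

lemma chain_inv_iso: "X \<in> carrier (DA n) \<Longrightarrow> chain_inv n (chain_iso n X) = X"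
proof (rule chain_lin_eqI[OF A_mod M_mod CA_mod lin_comp[OF chain_iso_lin chain_inv_lin] lin_id])
  fix x as assume x: "x \<in> carrier M" and as: "as \<in> tuples A n"
  have "chain_inv n (chain_iso n (pA n x as))
      = C.cot (DA n) as (\<lambda>y hs. chain_inv n (pH n y hs)) x"
    unfolding chain_iso_pure[OF x as]
    by (rule C.cot.transfer_hom[OF CH_mod CA_mod chain_inv_lin as x mlinD(3)[OF pureH_mlin]])
  also have "\<dots> = C.cot (DA n) as
      (\<lambda>y hs. C.kat (DA n) hs (pA n) y) x"
    by (intro C.cot.transfer_cong[OF CA_mod as x] chain_inv_pure mlinD(3)[OF C.kat.transfer_mlin[OF CA_mod pureA_mlin]])
  also have "\<dots> = pA n x as"
    by (rule C.cot_kat[OF CA_mod pureA_mlin as x])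
  finally show "chain_inv n (chain_iso n (pA n x as)) = pA n x as" .
qed

lemma chain_iso_inv: "X \<in> carrier (DH n) \<Longrightarrow> chain_iso n (chain_inv n X) = X"
proof (rule chain_lin_eqI[OF H_mod twist_mod(1) CH_mod lin_comp[OF chain_inv_lin chain_iso_lin] lin_id])
  let ?C = "DH n"
  fix x hs assume "x \<in> carrier (right_twist M)" and hs: "hs \<in> tuples H n"
  then have x: "x \<in> carrier M" by simp
  have "chain_iso n (chain_inv n (pH n x hs))
      = C.kat ?C hs (\<lambda>y as. chain_iso n (pA n y as)) x"
    unfolding chain_inv_pure[OF x hs]
    by (rule C.kat.transfer_hom[OF CA_mod CH_mod chain_iso_lin hs x mlinD(3)[OF pureA_mlin]])
  also have "\<dots> = C.kat ?C hs (\<lambda>y as. C.cot ?C as (pH n) y) x"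
    by (intro C.kat.transfer_cong[OF CH_mod hs x] chain_iso_pure mlinD(3)[OF C.cot.transfer_mlin[OF CH_mod pureH_mlin]])
  also have "\<dots> = pH n x hs"
    by (rule C.kat_cot[OF CH_mod pureH_mlin hs x])
  finally show "chain_iso n (chain_inv n (pH n x hs))
      = pH n x hs" .
qed

lemma chain_iso_bij: "bij_betw (chain_iso n) (carrier (DA n)) (carrier (DH n))"
  by (rule bij_betwI[where g = "chain_inv n"])
    (auto intro: lin_closed[OF chain_iso_lin] lin_closed[OF chain_inv_lin] simp: chain_inv_iso chain_iso_inv)

lemma chain_iso_bdry_Suc:
  assumes "X \<in> carrier (DA (Suc n))"
  shows "hoch_bdry K H (right_twist M) (Suc n) (chain_iso (Suc n) X) = chain_iso n (hoch_bdry K A M (Suc n) X)"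
proof (rule chain_lin_eqI[OF A_mod M_mod CH_mod lin_comp[OF chain_iso_lin RT.bdry_lin]
    lin_comp[OF B.bdry_lin chain_iso_lin] _ assms])
  let ?C = "DH n" and ?D = "DA n"
  let ?p = "pH n"
  interpret C': module K ?C by (rule CH_mod)
  interpret D': module K ?D by (rule CA_mod)
  fix x as assume x: "x \<in> carrier M" and as: "as \<in> tuples A (Suc n)"
  have alt: "mlin K H M (Suc n) ?C (hoch_alt K H (right_twist M) n ?C ?p)"
    using RT.alt_pure_mlin unfolding right_twist_mlin .
  have "hoch_bdry K H (right_twist M) (Suc n) (chain_iso (Suc n) (pA (Suc n) x as))
      = C.cot ?C as (\<lambda>y hs. hoch_bdry K H (right_twist M) (Suc n) (pH (Suc n) y hs)) x"
    unfolding chain_iso_pure[OF x as]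
    by (rule C.cot.transfer_hom[OF CH_mod CH_mod RT.bdry_lin as x mlinD(3)[OF pureH_mlin]])
  also have "\<dots> = C.cot ?C as (hoch_alt K H (right_twist M) n ?C ?p) x"
    by (intro C.cot.transfer_cong[OF CH_mod as x] mlinD(3)[OF alt]) (simp_all add: RT.bdry_pure)
  also have "\<dots> = hoch_alt K A M n ?C (\<lambda>x as. C.cot ?C as ?p x) x as"
    by (rule cot_alt[OF CH_mod pureH_mlin as x])
  also have "\<dots> = (\<Oplus>\<^bsub>?C\<^esub>i\<in>{0..Suc n}. chain_iso n (sgn_pow K i \<odot>\<^bsub>?D\<^esub>
      (case hoch_face A M i (x, as) of (y, bs) \<Rightarrow> pA n y bs)))"
    unfolding hoch_alt_def
  proof (rule C'.M.finsum_cong'[OF refl])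
    have step: "sgn_pow K i \<odot>\<^bsub>?C\<^esub> (case hoch_face A M i (x, as) of (y, bs) \<Rightarrow> C.cot ?C bs ?p y)
        = chain_iso n (sgn_pow K i \<odot>\<^bsub>?D\<^esub> (case hoch_face A M i (x, as) of (y, bs) \<Rightarrow> pA n y bs))
      \<and> sgn_pow K i \<odot>\<^bsub>?C\<^esub> (case hoch_face A M i (x, as) of (y, bs) \<Rightarrow> C.cot ?C bs ?p y) \<in> carrier ?C"
      if i: "i \<in> {0..Suc n}" for i
    proof -
      from B.face_closed[OF x as, of i] i obtain y bs
        where f: "hoch_face A M i (x, as) = (y, bs)" "y \<in> carrier M" "bs \<in> tuples A n" by fastforce
      have "chain_iso n (sgn_pow K i \<odot>\<^bsub>?D\<^esub> pA n y bs) = sgn_pow K i \<odot>\<^bsub>?C\<^esub> C.cot ?C bs ?p y"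
        using lin_smult[OF chain_iso_lin _ mlinD(3)[OF pureA_mlin f(2,3)]] chain_iso_pure[OF f(2,3)] by simp
      moreover have "C.cot ?C bs ?p y \<in> carrier ?C"
        by (rule mlinD(3)[OF C.cot.transfer_mlin[OF CH_mod pureH_mlin] f(2,3)])
      ultimately show ?thesis by (simp add: f)
    qed
    show "sgn_pow K i \<odot>\<^bsub>?C\<^esub> (case hoch_face A M i (x, as) of (y, bs) \<Rightarrow> C.cot ?C bs ?p y)
        = chain_iso n (sgn_pow K i \<odot>\<^bsub>?D\<^esub> (case hoch_face A M i (x, as) of (y, bs) \<Rightarrow> pA n y bs))"
      if "i \<in> {0..Suc n}" for i using step[OF that] by blast
    show "(\<lambda>i. chain_iso n (sgn_pow K i \<odot>\<^bsub>?D\<^esub> (case hoch_face A M i (x, as) of (y, bs) \<Rightarrow> pA n y bs)))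
        \<in> {0..Suc n} \<rightarrow> carrier ?C"
      using step by (intro funcsetI) metis
  qed
  also have "\<dots> = chain_iso n (hoch_alt K A M n ?D (pA n) x as)"
    unfolding hoch_alt_def
    using mlinD(3)[OF B.face_mlin[OF pureA_mlin] x as]
    by (intro lin_finsum[OF CA_mod CH_mod chain_iso_lin, symmetric]) auto
  also have "\<dots> = chain_iso n (hoch_bdry K A M (Suc n) (pA (Suc n) x as))"
    using B.bdry_pure[OF x as] by simp
  finally show "hoch_bdry K H (right_twist M) (Suc n) (chain_iso (Suc n) (pA (Suc n) x as))
      = chain_iso n (hoch_bdry K A M (Suc n) (pA (Suc n) x as))" .
qed

lemma chain_iso_bdry:
  assumes "X \<in> carrier (DA n)"
  shows "hoch_bdry K H (right_twist M) n (chain_iso n X) = chain_iso (n - 1) (hoch_bdry K A M n X)"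
proof (cases n)
  case 0
  \<comment> \<open>In degree \<open>0\<close> both boundaries are the constant \<open>0\<close>, in degree \<open>0 - 1 = 0\<close>.\<close>
  then show ?thesis using lin_zero[OF CA_mod CH_mod chain_iso_lin, of 0] by (simp add: hoch_bdry_def)
next
  case (Suc m)
  then show ?thesis using chain_iso_bdry_Suc assms by simp
qed

text \<open>
  \<open>chain_iso\<close> is an isomorphism of complexes.
\<close>

lemma homology_iso:
  "mod_isomorphic K (hoch_homology K A M n) (hoch_homology K H (right_twist M) n)"
  unfolding hoch_homology_def
proof (rule subquot_isomorphic[OF CA_mod CH_mod chain_iso_lin chain_iso_bij CA_mod CH_mod chain_iso_lin])
  let ?C = "DA" and ?D = "DH"
  show "inj_on (chain_iso (n - 1)) (carrier (?C (n - 1)))"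
    using chain_iso_bij by (auto simp: bij_betw_def)
  show "hoch_bdry K A M n X \<in> carrier (?C (n - 1))" if "X \<in> carrier (?C n)" for X
  proof (cases n)
    case 0
    interpret C': module K "?C 0" by (rule CA_mod)
    show ?thesis by (simp add: 0 hoch_bdry_def)
  next
    case (Suc m)
    then show ?thesis using lin_closed[OF B.bdry_lin] that by simp
  qed
  show "hoch_bdry K H (right_twist M) n (chain_iso n X) = chain_iso (n - 1) (hoch_bdry K A M n X)"
    if "X \<in> carrier (?C n)" for X
    by (rule chain_iso_bdry[OF that])
  show "hoch_bdry K A M (Suc n) ` carrier (?C (Suc n)) \<subseteq> carrier (?C n)"
    using lin_closed[OF B.bdry_lin] by blast
  have "carrier (?D (Suc n)) = chain_iso (Suc n) ` carrier (?C (Suc n))"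
    using chain_iso_bij[of "Suc n"] by (simp add: bij_betw_def)
  then show "hoch_bdry K H (right_twist M) (Suc n) ` carrier (?D (Suc n))
      = chain_iso n ` hoch_bdry K A M (Suc n) ` carrier (?C (Suc n))"
    by (simp add: image_image chain_iso_bdry_Suc)
qed

end

section \<open>Cohomology\<close>

lemma cochain_iff:
  "f \<in> carrier (hoch_cochains K A M n) \<longleftrightarrow> f \<in> extensional (tuples A n) \<and>
     (\<forall>as\<in>tuples A n. f as \<in> carrier M) \<and>
     (\<forall>as\<in>tuples A n. \<forall>i<n. (\<lambda>a. f (as[i := a])) \<in> lin_maps K A M)"
  by (auto simp: hoch_cochains_def PiE_iff lin_maps_def tuples_update)

lemma cochainD:
  assumes "f \<in> carrier (hoch_cochains K A M n)"
  shows "f \<in> extensional (tuples A n)" "as \<in> tuples A n \<Longrightarrow> f as \<in> carrier M"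
    and "as \<in> tuples A n \<Longrightarrow> i < n \<Longrightarrow> (\<lambda>a. f (as[i := a])) \<in> lin_maps K A M"
  using assms by (auto simp: cochain_iff)

lemma cochain_sel [simp]:
  "as \<in> tuples A n \<Longrightarrow> \<zero>\<^bsub>hoch_cochains K A M n\<^esub> as = \<zero>\<^bsub>M\<^esub>"
  "as \<in> tuples A n \<Longrightarrow> (f \<oplus>\<^bsub>hoch_cochains K A M n\<^esub> g) as = f as \<oplus>\<^bsub>M\<^esub> g as"
  "as \<in> tuples A n \<Longrightarrow> (c \<odot>\<^bsub>hoch_cochains K A M n\<^esub> f) as = c \<odot>\<^bsub>M\<^esub> f as"
  by (simp_all add: hoch_cochains_def)

lemma cochain_ext:
  "\<zero>\<^bsub>hoch_cochains K A M n\<^esub> \<in> extensional (tuples A n)"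
  "f \<oplus>\<^bsub>hoch_cochains K A M n\<^esub> g \<in> extensional (tuples A n)"
  "c \<odot>\<^bsub>hoch_cochains K A M n\<^esub> f \<in> extensional (tuples A n)"
  by (simp_all add: hoch_cochains_def)

lemma cochains_module:
  assumes A: "module K A" and M: "module K M"
  shows "module K (hoch_cochains K A M n)"
proof -
  interpret M: module K M by fact
  let ?C = "hoch_cochains K A M n"
  have c: "f \<oplus>\<^bsub>?C\<^esub> g \<in> carrier ?C" if "f \<in> carrier ?C" "g \<in> carrier ?C" for f g
    unfolding cochain_iff
  proof (intro conjI ballI allI impI cochain_ext)
    fix as i assume as: "as \<in> tuples A n" and i: "i < n"
    show "(\<lambda>a. (f \<oplus>\<^bsub>?C\<^esub> g) (as[i := a])) \<in> lin_maps K A M"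
      by (rule lin_cong[OF A lin_add_maps[OF M cochainD(3)[OF that(1) as i] cochainD(3)[OF that(2) as i]]])
        (simp add: tuples_update[OF as])
  qed (simp add: cochainD(2)[OF that(1)] cochainD(2)[OF that(2)])
  have s: "k \<odot>\<^bsub>?C\<^esub> f \<in> carrier ?C" if "k \<in> carrier K" "f \<in> carrier ?C" for k f
    unfolding cochain_iff
  proof (intro conjI ballI allI impI cochain_ext)
    fix as i assume as: "as \<in> tuples A n" and i: "i < n"
    show "(\<lambda>a. (k \<odot>\<^bsub>?C\<^esub> f) (as[i := a])) \<in> lin_maps K A M"
      by (rule lin_cong[OF A lin_comp[OF cochainD(3)[OF that(2) as i] lin_smult_map[OF M that(1)]]])
        (simp add: tuples_update[OF as])
  qed (simp add: cochainD(2)[OF that(2)] that(1))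
  have z: "\<zero>\<^bsub>?C\<^esub> \<in> carrier ?C"
    unfolding cochain_iff
  proof (intro conjI ballI allI impI cochain_ext)
    fix as i assume as: "as \<in> tuples A n" and i: "i < n"
    have "(\<lambda>a. \<zero>\<^bsub>M\<^esub>) \<in> lin_maps K A M" by (rule lin_mapsI) simp_all
    then show "(\<lambda>a. \<zero>\<^bsub>?C\<^esub> (as[i := a])) \<in> lin_maps K A M"
      by (rule lin_cong[OF A]) (simp add: tuples_update[OF as])
  qed simp
  note E = extensionalityI[of _ "tuples A n"]
  have ag: "abelian_group ?C"
  proof (rule abelian_groupI)
    fix f assume f: "f \<in> carrier ?C"
    have neg: "(\<ominus>\<^bsub>K\<^esub> \<one>\<^bsub>K\<^esub>) \<odot>\<^bsub>?C\<^esub> f \<in> carrier ?C" by (rule s[OF _ f]) simp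
    have "((\<ominus>\<^bsub>K\<^esub> \<one>\<^bsub>K\<^esub>) \<odot>\<^bsub>?C\<^esub> f) \<oplus>\<^bsub>?C\<^esub> f = \<zero>\<^bsub>?C\<^esub>"
      by (rule E) (simp_all add: cochain_ext cochainD(2)[OF f] M.smult_l_minus M.M.l_neg)
    then show "\<exists>g\<in>carrier ?C. g \<oplus>\<^bsub>?C\<^esub> f = \<zero>\<^bsub>?C\<^esub>" using neg by blast
    show "\<zero>\<^bsub>?C\<^esub> \<oplus>\<^bsub>?C\<^esub> f = f"
      by (rule E) (simp_all add: cochain_ext cochainD(1)[OF f] cochainD(2)[OF f])
  next
    fix f g h assume f: "f \<in> carrier ?C" and g: "g \<in> carrier ?C" and h: "h \<in> carrier ?C"
    show "(f \<oplus>\<^bsub>?C\<^esub> g) \<oplus>\<^bsub>?C\<^esub> h = f \<oplus>\<^bsub>?C\<^esub> (g \<oplus>\<^bsub>?C\<^esub> h)"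
      by (rule E) (simp_all add: cochain_ext cochainD(2)[OF f] cochainD(2)[OF g] cochainD(2)[OF h] M.M.a_assoc)
  next
    fix f g assume f: "f \<in> carrier ?C" and g: "g \<in> carrier ?C"
    show "f \<oplus>\<^bsub>?C\<^esub> g = g \<oplus>\<^bsub>?C\<^esub> f"
      by (rule E) (simp_all add: cochain_ext cochainD(2)[OF f] cochainD(2)[OF g] M.M.a_comm)
  qed (simp_all add: c z)
  show ?thesis
  proof (rule moduleI[OF M.R.is_cring ag s], assumption+)
    fix k l f assume k: "k \<in> carrier K" and l: "l \<in> carrier K" and f: "f \<in> carrier ?C"
    show "(k \<oplus>\<^bsub>K\<^esub> l) \<odot>\<^bsub>?C\<^esub> f = (k \<odot>\<^bsub>?C\<^esub> f) \<oplus>\<^bsub>?C\<^esub> (l \<odot>\<^bsub>?C\<^esub> f)"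
      by (rule E) (simp_all add: cochain_ext cochainD(2)[OF f] k l M.smult_l_distr)
    show "(k \<otimes>\<^bsub>K\<^esub> l) \<odot>\<^bsub>?C\<^esub> f = k \<odot>\<^bsub>?C\<^esub> (l \<odot>\<^bsub>?C\<^esub> f)"
      by (rule E) (simp_all add: cochain_ext cochainD(2)[OF f] k l M.smult_assoc1)
  next
    fix k f g assume k: "k \<in> carrier K" and f: "f \<in> carrier ?C" and g: "g \<in> carrier ?C"
    show "k \<odot>\<^bsub>?C\<^esub> (f \<oplus>\<^bsub>?C\<^esub> g) = (k \<odot>\<^bsub>?C\<^esub> f) \<oplus>\<^bsub>?C\<^esub> (k \<odot>\<^bsub>?C\<^esub> g)"
      by (rule E) (simp_all add: cochain_ext cochainD(2)[OF f] cochainD(2)[OF g] k M.smult_r_distr)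
  next
    fix f assume f: "f \<in> carrier ?C"
    show "\<one>\<^bsub>K\<^esub> \<odot>\<^bsub>?C\<^esub> f = f"
      by (rule E) (simp_all add: cochain_ext cochainD(1)[OF f] cochainD(2)[OF f])
  qed
qed

lemma cochain_eval_lin: "as \<in> tuples A n \<Longrightarrow> (\<lambda>f. f as) \<in> lin_maps K (hoch_cochains K A M n) M"
  by (rule lin_mapsI) (simp_all add: cochainD(2))

lemma cochain_mlin:
  assumes "bilin K M N P act" and f: "f \<in> carrier (hoch_cochains K A M n)"
  shows "mlin K A N n P (\<lambda>x as. act (f as) x)"
  unfolding mlin_def
  by (intro conjI ballI allI impI bilinD(2)[OF assms(1)] cochainD(2)[OF f]
    bilin_lin_l[OF assms(1)] cochainD(3)[OF f])

lemma mlin_cochain: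
  assumes A: "module K A" and B: "mlin K A N n M B" and x: "x \<in> carrier N"
  shows "(\<lambda>as\<in>tuples A n. B x as) \<in> carrier (hoch_cochains K A M n)"
  unfolding cochain_iff
proof (intro conjI ballI allI impI)
  fix as i assume as: "as \<in> tuples A n" and i: "i < n"
  show "(\<lambda>a. (\<lambda>as\<in>tuples A n. B x as) (as[i := a])) \<in> lin_maps K A M"
    by (rule lin_cong[OF A mlinD(2)[OF B x as i]]) (simp add: tuples_update[OF as])
qed (simp_all add: mlinD(3)[OF B x])

definition hoch_coface where
  "hoch_coface A M i f as =
     (if i = 0 then lact M (hd as) (f (tl as))
      else if i = length as then ract M (f (butlast as)) (last as)
      else f (mult_adj A i as))"

context alg_bimodule
begin

lemma coface_closed:
  assumes f: "f \<in> carrier (hoch_cochains K A M n)" and as: "as \<in> tuples A (Suc n)" and i: "i \<le> Suc n"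
  shows "hoch_coface A M i f as \<in> carrier M"
proof -
  have len: "length as = Suc n" using as by (simp add: tuples_def)
  have last: "last as \<in> carrier A" "butlast as \<in> tuples A n"
    using as by (cases as rule: rev_cases; auto simp: tuples_def)+
  consider "i = 0" | "0 < i" "i \<le> n" | "i = Suc n" using i by linarith
  then show ?thesis
  proof cases
    case 1
    then show ?thesis using as by (auto simp: hoch_coface_def elim!: tuples_SucE intro!: lact_closed cochainD(2)[OF f])
  next
    case 2
    then show ?thesis using cochainD(2)[OF f A.mult_adj_tuples[OF as 2]] by (simp add: hoch_coface_def len)
  next
    case 3
    then show ?thesis using last by (simp add: hoch_coface_def len ract_closed cochainD(2)[OF f])
  qed
qed

text \<open>
  The variable \<open>x\<close> in \<open>A\<close> turns the last coface into a multiplication \<open>a x\<close>, so that the statements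
  about faces of multilinear maps cover the cofaces as well.
\<close>

lemma coface_mlin:
  assumes f: "f \<in> carrier (hoch_cochains K A M n)" and i: "i \<le> Suc n"
  shows "mlin K A A (Suc n) M (\<lambda>x as. ract M (hoch_coface A M i f as) x)"
proof -
  note r = act_bilin(2) and l = act_bilin(1)
  let ?B = "\<lambda>x as. ract M (f as) x"
  have B: "mlin K A A n M ?B" by (rule cochain_mlin[OF r f])
  have len: "length as = Suc n" if "as \<in> tuples A (Suc n)" for as using that by (simp add: tuples_def)
  have last: "last as \<in> carrier A" "butlast as \<in> tuples A n" if "as \<in> tuples A (Suc n)" for as
    using that by (cases as rule: rev_cases; auto simp: tuples_def)+
  consider "i = 0" | "0 < i" "i \<le> n" | "i = Suc n" using i by linarith
  then show ?thesis
  proof cases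
    case 1
    show ?thesis
    proof (rule mlin_SucI)
      fix a assume a: "a \<in> carrier A"
      show "mlin K A A n M (\<lambda>x as. ract M (hoch_coface A M i f (a # as)) x)"
        by (rule mlin_cong[OF modules(1) modules(1) mlin_hom[OF B bilinD(2)[OF l a]]])
          (simp add: 1 hoch_coface_def act_commute a cochainD(2)[OF f])
    next
      fix x as assume x: "x \<in> carrier A" and as: "as \<in> tuples A n"
      show "(\<lambda>a. ract M (hoch_coface A M i f (a # as)) x) \<in> lin_maps K A M"
        using x by (simp add: 1 hoch_coface_def)
          (intro bilin_lin_l[OF r] bilinD(1)[OF l] cochainD(2)[OF f as])
    qed
  next
    case 2
    then show ?thesis
      by (intro mlin_cong[OF modules(1) modules(1) A.mlin_mult_adj[OF modules(1) B, of i]])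
        (simp_all add: hoch_coface_def len)
  next
    case 3
    have m: "bilin K A A A (\<lambda>a b. a \<otimes>\<^bsub>A\<^esub> b)"
      by (intro bilinI A.mult_lin)
    show ?thesis
      by (rule mlin_cong[OF modules(1) modules(1) mlin_last_face[OF modules(1) modules(1) B m]])
        (simp add: 3 hoch_coface_def len last ract_mult cochainD(2)[OF f])
  qed
qed

lemma cobdry_sum:
  assumes f: "f \<in> carrier (hoch_cochains K A M n)" and as: "as \<in> tuples A (Suc n)"
  shows "hoch_cobdry K A M n f as = (\<Oplus>\<^bsub>M\<^esub>i\<in>{0..Suc n}. sgn_pow K i \<odot>\<^bsub>M\<^esub> hoch_coface A M i f as)"
proof -
  let ?s = "\<lambda>i. sgn_pow K i \<odot>\<^bsub>M\<^esub> hoch_coface A M i f as"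
  have len: "length as = Suc n" using as by (simp add: tuples_def)
  have cl: "?s i \<in> carrier M" if "i \<le> Suc n" for i
    using coface_closed[OF f as that] by simp
  have "{0..Suc n} = insert 0 (insert (Suc n) {1..n})" by auto
  then have "(\<Oplus>\<^bsub>M\<^esub>i\<in>{0..Suc n}. ?s i) = ?s 0 \<oplus>\<^bsub>M\<^esub> (?s (Suc n) \<oplus>\<^bsub>M\<^esub> (\<Oplus>\<^bsub>M\<^esub>i\<in>{1..n}. ?s i))"
    using cl by (simp add: M.M.finsum_insert Pi_def)
  also have "(\<Oplus>\<^bsub>M\<^esub>i\<in>{1..n}. ?s i) = (\<Oplus>\<^bsub>M\<^esub>i\<in>{1..n}. sgn_pow K i \<odot>\<^bsub>M\<^esub> f (mult_adj A i as))"
    using cochainD(2)[OF f A.mult_adj_tuples[OF as]]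
    by (intro M.M.finsum_cong') (auto simp: hoch_coface_def len)
  finally have "(\<Oplus>\<^bsub>M\<^esub>i\<in>{0..Suc n}. ?s i)
      = ?s 0 \<oplus>\<^bsub>M\<^esub> (?s (Suc n) \<oplus>\<^bsub>M\<^esub> (\<Oplus>\<^bsub>M\<^esub>i\<in>{1..n}. sgn_pow K i \<odot>\<^bsub>M\<^esub> f (mult_adj A i as)))" .
  moreover have "(\<Oplus>\<^bsub>M\<^esub>i\<in>{1..n}. sgn_pow K i \<odot>\<^bsub>M\<^esub> f (mult_adj A i as)) \<in> carrier M"
    using cochainD(2)[OF f A.mult_adj_tuples[OF as]] by (intro M.M.finsum_closed) auto
  moreover have "?s 0 = lact M (hd as) (f (tl as))" "?s (Suc n) = sgn_pow K (Suc n) \<odot>\<^bsub>M\<^esub> ract M (f (butlast as)) (last as)"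
    using coface_closed[OF f as, of 0] by (simp_all add: hoch_coface_def len sgn_pow_def)
  ultimately show ?thesis
    using cl[of 0] cl[of "Suc n"] as by (simp add: hoch_cobdry_def M.M.a_ac)
qed

text \<open>
  The multilinear map that belongs to the coboundary, evaluated at \<open>x = 1\<close>.
\<close>

lemma cobdry_closed:
  assumes f: "f \<in> carrier (hoch_cochains K A M n)"
  shows "hoch_cobdry K A M n f \<in> carrier (hoch_cochains K A M (Suc n))"
proof -
  let ?B = "\<lambda>x as. \<Oplus>\<^bsub>M\<^esub>i\<in>{0..Suc n}. sgn_pow K i \<odot>\<^bsub>M\<^esub> ract M (hoch_coface A M i f as) x"
  have "mlin K A A (Suc n) M (\<lambda>x as. sgn_pow K i \<odot>\<^bsub>M\<^esub> ract M (hoch_coface A M i f as) x)"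
    if "i \<in> {0..Suc n}" for i
  proof -
    have "mlin K A A (Suc n) M (\<lambda>x as. ract M (hoch_coface A M i f as) x)"
      by (rule coface_mlin[OF f]) (use that in simp)
    moreover have "(\<lambda>p. sgn_pow K i \<odot>\<^bsub>M\<^esub> p) \<in> lin_maps K M M"
      by (simp add: lin_smult_map[OF modules(2)])
    ultimately show ?thesis by (rule mlin_hom)
  qed
  then have "mlin K A A (Suc n) M ?B"
    by (rule mlin_finsum[OF modules(1) modules(1) modules(2) finite_atLeastAtMost])
  from mlin_cochain[OF modules(1) this A.A.one_closed]
  have "(\<lambda>as\<in>tuples A (Suc n). ?B \<one>\<^bsub>A\<^esub> as) \<in> carrier (hoch_cochains K A M (Suc n))" .
  moreover have "hoch_cobdry K A M n f = (\<lambda>as\<in>tuples A (Suc n). ?B \<one>\<^bsub>A\<^esub> as)"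
  proof (rule extensionalityI[where A = "tuples A (Suc n)"])
    fix as assume as: "as \<in> tuples A (Suc n)"
    have "(\<Oplus>\<^bsub>M\<^esub>i\<in>{0..Suc n}. sgn_pow K i \<odot>\<^bsub>M\<^esub> hoch_coface A M i f as) = ?B \<one>\<^bsub>A\<^esub> as"
      using coface_closed[OF f as] by (intro M.M.finsum_cong') (auto simp: ract_one)
    then show "hoch_cobdry K A M n f as = (\<lambda>as\<in>tuples A (Suc n). ?B \<one>\<^bsub>A\<^esub> as) as"
      using as by (simp add: cobdry_sum[OF f as])
  qed (simp_all add: hoch_cobdry_def)
  ultimately show ?thesis by simp
qed

end

context galois_bimodule
begin

sublocale R: galois_module K H comult counit antipode A coact A "\<lambda>a b. a \<cdot> b"
  by unfold_locales (auto simp: A_mod A.A.m_assoc intro!: bilinI A.mult_lin)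

sublocale LT: alg_bimodule K H "left_twist M"
  by (rule left_twist_bimodule)

abbreviation "CA n \<equiv> hoch_cochains K A M n"
abbreviation "CH n \<equiv> hoch_cochains K H M n"

lemma left_twist_cochains: "hoch_cochains K H (left_twist M) n = CH n"
  by (simp add: hoch_cochains_def)

lemmas CA'_mod = cochains_module[OF A_mod M_mod] and CH'_mod = cochains_module[OF H_mod M_mod]

text \<open>
  \<open>f \<mapsto> ((a, b, \<dots>) \<mapsto> f(a\<^sub>-, b\<^sub>-, \<dots>) a\<^sub>0 b\<^sub>0 \<dots>)\<close> and its inverse: the transfers for the left module
  \<open>A\<close>, evaluated at \<open>x = 1\<close>.
\<close>

definition to_A where
  "to_A n f = (\<lambda>as\<in>tuples A n. R.cot M as (\<lambda>x hs. ract M (f hs) x) \<one>\<^bsub>A\<^esub>)"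

definition to_H where
  "to_H n g = (\<lambda>hs\<in>tuples H n. R.kat M hs (\<lambda>x as. ract M (g as) x) \<one>\<^bsub>A\<^esub>)"

lemma CH_mlin: "f \<in> carrier (CH n) \<Longrightarrow> mlin K H A n M (\<lambda>x hs. ract M (f hs) x)"
  and CA_mlin: "g \<in> carrier (CA n) \<Longrightarrow> mlin K A A n M (\<lambda>x as. ract M (g as) x)"
  by (rule cochain_mlin[OF ract_bilin], assumption)+

lemma to_A_closed: "f \<in> carrier (CH n) \<Longrightarrow> to_A n f \<in> carrier (CA n)"
  unfolding to_A_def by (rule mlin_cochain[OF A_mod R.cot.transfer_mlin[OF M_mod CH_mlin] A.A.one_closed])

lemma to_H_closed: "g \<in> carrier (CA n) \<Longrightarrow> to_H n g \<in> carrier (CH n)"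
  unfolding to_H_def by (rule mlin_cochain[OF H_mod R.kat.transfer_mlin[OF M_mod CA_mlin] A.A.one_closed])

lemma to_H_lin: "to_H n \<in> lin_maps K (CA n) (CH n)"
proof -
  have l: "(\<lambda>g. R.kat M hs (\<lambda>x as. ract M (g as) x) \<one>\<^bsub>A\<^esub>) \<in> lin_maps K (CA n) M" if "hs \<in> tuples H n" for hs
    by (intro R.kat.transfer_param[OF CA'_mod M_mod that A.A.one_closed] bilin_lin_l[OF ract_bilin] cochain_eval_lin)
  note E = extensionalityI[of _ "tuples H n"]
  show ?thesis
  proof (rule lin_mapsI)
    fix f g assume fg: "f \<in> carrier (CA n)" "g \<in> carrier (CA n)"
    show "to_H n (f \<oplus>\<^bsub>CA n\<^esub> g) = to_H n f \<oplus>\<^bsub>CH n\<^esub> to_H n g"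
      by (rule E) (simp_all add: cochain_ext to_H_def lin_add[OF l fg])
  next
    fix c f assume c: "c \<in> carrier K" and f: "f \<in> carrier (CA n)"
    show "to_H n (c \<odot>\<^bsub>CA n\<^esub> f) = c \<odot>\<^bsub>CH n\<^esub> to_H n f"
      by (rule E) (simp_all add: cochain_ext to_H_def lin_smult[OF l c f])
  qed (rule to_H_closed)
qed

text \<open>
  The transfer commutes with right multiplication, so its value at \<open>1\<close> determines it. This lets the
  inversion formulas for transfers be applied to cochains.
\<close>

lemma to_A_ract:
  assumes f: "f \<in> carrier (CH n)" and as: "as \<in> tuples A n" and x: "x \<in> carrier A"
  shows "ract M (to_A n f as) x = R.cot M as (\<lambda>x hs. ract M (f hs) x) x"
proof -
  note B = mlinD(3)[OF CH_mlin[OF f]]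
  have "ract M (to_A n f as) x = R.cot M as (\<lambda>y hs. ract M (ract M (f hs) y) x) \<one>\<^bsub>A\<^esub>"
    unfolding to_A_def using as
    by (simp add: R.cot.transfer_hom[OF M_mod M_mod bilinD(1)[OF ract_bilin x] as A.A.one_closed B])
  also have "\<dots> = R.cot M as (\<lambda>y hs. ract M (f hs) (y \<cdot> x)) \<one>\<^bsub>A\<^esub>"
    using x by (intro R.cot.transfer_cong[OF M_mod as A.A.one_closed] B A.A.m_closed)
      (simp_all add: B.ract_mult cochainD(2)[OF f])
  also have "\<dots> = R.cot M as (\<lambda>y hs. ract M (f hs) y) (\<one>\<^bsub>A\<^esub> \<cdot> x)"
    using x by (intro R.cot.transfer_base[OF M_mod _ _ _ as A.A.one_closed B]) (simp_all add: A.A.m_assoc)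
  finally show ?thesis using x by simp
qed

lemma to_H_ract:
  assumes g: "g \<in> carrier (CA n)" and hs: "hs \<in> tuples H n" and x: "x \<in> carrier A"
  shows "ract M (to_H n g hs) x = R.kat M hs (\<lambda>x as. ract M (g as) x) x"
proof -
  note B = mlinD(3)[OF CA_mlin[OF g]]
  have "ract M (to_H n g hs) x = R.kat M hs (\<lambda>y as. ract M (ract M (g as) y) x) \<one>\<^bsub>A\<^esub>"
    unfolding to_H_def using hs
    by (simp add: R.kat.transfer_hom[OF M_mod M_mod bilinD(1)[OF ract_bilin x] hs A.A.one_closed B])
  also have "\<dots> = R.kat M hs (\<lambda>y as. ract M (g as) (y \<cdot> x)) \<one>\<^bsub>A\<^esub>"
    using x by (intro R.kat.transfer_cong[OF M_mod hs A.A.one_closed] B A.A.m_closed)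
      (simp_all add: B.ract_mult cochainD(2)[OF g])
  also have "\<dots> = R.kat M hs (\<lambda>y as. ract M (g as) y) (\<one>\<^bsub>A\<^esub> \<cdot> x)"
    using x by (intro R.kat.transfer_base[OF M_mod _ _ _ hs A.A.one_closed B]) (simp_all add: A.A.m_assoc)
  finally show ?thesis using x by simp
qed

lemma to_H_to_A:
  assumes f: "f \<in> carrier (CH n)"
  shows "to_H n (to_A n f) = f"
proof (rule extensionalityI[where A = "tuples H n"])
  fix hs assume hs: "hs \<in> tuples H n"
  have "to_H n (to_A n f) hs = R.kat M hs (\<lambda>x as. R.cot M as (\<lambda>x hs. ract M (f hs) x) x) \<one>\<^bsub>A\<^esub>"
    unfolding to_H_def using hs
    by (simp, intro R.kat.transfer_cong[OF M_mod hs A.A.one_closed] to_A_ract[OF f]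
      mlinD(3)[OF R.cot.transfer_mlin[OF M_mod CH_mlin[OF f]]])
  also have "\<dots> = ract M (f hs) \<one>\<^bsub>A\<^esub>"
    by (rule R.kat_cot[OF M_mod CH_mlin[OF f] hs A.A.one_closed])
  finally show "to_H n (to_A n f) hs = f hs" using cochainD(2)[OF f hs] by (simp add: B.ract_one)
qed (simp_all add: to_H_def cochainD(1)[OF f])

lemma to_A_to_H:
  assumes g: "g \<in> carrier (CA n)"
  shows "to_A n (to_H n g) = g"
proof (rule extensionalityI[where A = "tuples A n"])
  fix as assume as: "as \<in> tuples A n"
  have "to_A n (to_H n g) as = R.cot M as (\<lambda>x hs. R.kat M hs (\<lambda>x as. ract M (g as) x) x) \<one>\<^bsub>A\<^esub>"
    unfolding to_A_def using as
    by (simp, intro R.cot.transfer_cong[OF M_mod as A.A.one_closed] to_H_ract[OF g]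
      mlinD(3)[OF R.kat.transfer_mlin[OF M_mod CA_mlin[OF g]]])
  also have "\<dots> = ract M (g as) \<one>\<^bsub>A\<^esub>"
    by (rule R.cot_kat[OF M_mod CA_mlin[OF g] as A.A.one_closed])
  finally show "to_A n (to_H n g) as = g as" using cochainD(2)[OF g as] by (simp add: B.ract_one)
qed (simp_all add: to_A_def cochainD(1)[OF g])

lemma to_H_bij: "bij_betw (to_H n) (carrier (CA n)) (carrier (CH n))"
  by (rule bij_betwI[where g = "to_A n"]) (auto simp: to_H_closed to_A_closed to_H_to_A to_A_to_H)

text \<open>
  The counterpart of the statement on faces, with \<open>(a\<^sub>- \<triangleright> m) a\<^sub>0 = a m\<close> for the index \<open>0\<close>.
\<close>

lemma cot_coface:
  assumes f: "f \<in> carrier (CH n)" and as: "as \<in> tuples A (Suc n)" and i: "i \<le> Suc n"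
  shows "R.cot M as (\<lambda>x hs. ract M (hoch_coface H (left_twist M) i f hs) x) \<one>\<^bsub>A\<^esub>
    = hoch_coface A M i (to_A n f) as"
proof -
  note B = CH_mlin[OF f]
  have lenH: "length hs = Suc n" if "hs \<in> tuples H (Suc n)" for hs using that by (simp add: tuples_def)
  have lenA: "length as = Suc n" using as by (simp add: tuples_def)
  consider "i = 0" | "0 < i" "i \<le> n" | "i = Suc n" using i by linarith
  then show ?thesis
  proof cases
    case 1
    from as obtain a bs where as': "as = a # bs" "a \<in> carrier A" "bs \<in> tuples A n" by (rule tuples_SucE)
    have "R.cot M as (\<lambda>x hs. ract M (ad_left M (hd hs) (f (tl hs))) x) \<one>\<^bsub>A\<^esub>
        = R.cot M bs (\<lambda>y hs. tlift K M (\<lambda>h c. ract M (ad_left M h (f hs)) (c \<cdot> y)) (coact a)) \<one>\<^bsub>A\<^esub>"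
      unfolding as'(1)
      by (rule R.cot_hd[OF M_mod as'(3) A.A.one_closed as'(2)])
        (intro B.ract_closed bilinD(3)[OF ad_bilin(2)] cochainD(2)[OF f])
    also have "\<dots> = R.cot M bs (\<lambda>y hs. lact M a (ract M (f hs) y)) \<one>\<^bsub>A\<^esub>"
    proof (rule R.cot.transfer_cong[OF M_mod as'(3) A.A.one_closed])
      fix y hs assume y: "y \<in> carrier A" and hs: "hs \<in> tuples H n"
      note fhs = cochainD(2)[OF f hs]
      have c: "ad_left M h (f hs) \<in> carrier M" if "h \<in> carrier H" for h
        by (rule bilinD(3)[OF ad_bilin(2) that fhs])
      show "lact M a (ract M (f hs) y) \<in> carrier M"
        by (intro B.lact_closed B.ract_closed as'(2) y fhs)
      have "tlift K M (\<lambda>h c. ract M (ad_left M h (f hs)) (c \<cdot> y)) (coact a)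
          = tlift K M (\<lambda>h b. ract M (ract M (ad_left M h (f hs)) b) y) (coact a)"
        using y by (intro coact_tlift_cong M_mod as'(2) B.ract_closed c) (simp_all add: B.ract_mult c)
      also have "\<dots> = ract M (tlift K M (\<lambda>h b. ract M (ad_left M h (f hs)) b) (coact a)) y"
        by (rule coact_tlift_hom[OF M_mod M_mod bilinD(1)[OF ract_bilin y] _ as'(2), symmetric])
          (intro B.ract_closed c)
      also have "\<dots> = lact M a (ract M (f hs) y)"
        by (simp add: coact_ad_left[OF fhs as'(2)] B.act_commute[OF as'(2) fhs y])
      finally show "tlift K M (\<lambda>h c. ract M (ad_left M h (f hs)) (c \<cdot> y)) (coact a)
          = lact M a (ract M (f hs) y)" .
    qed
    also have "\<dots> = lact M a (R.cot M bs (\<lambda>y hs. ract M (f hs) y) \<one>\<^bsub>A\<^esub>)"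
      by (rule R.cot.transfer_hom[OF M_mod M_mod bilinD(2)[OF lact_bilin as'(2)] as'(3) A.A.one_closed mlinD(3)[OF B], symmetric])
    finally show ?thesis using 1 as'(3) by (simp add: hoch_coface_def as'(1) to_A_def)
  next
    case 2
    have "R.cot M as (\<lambda>x hs. ract M (hoch_coface H (left_twist M) i f hs) x) \<one>\<^bsub>A\<^esub>
        = R.cot M as (\<lambda>x hs. ract M (f (mult_adj H i hs)) x) \<one>\<^bsub>A\<^esub>"
      using 2 H.mult_adj_tuples[OF _ 2]
      by (intro R.cot.transfer_cong[OF M_mod as A.A.one_closed]) (simp_all add: hoch_coface_def lenH B.ract_closed cochainD(2)[OF f])
    also have "\<dots> = R.cot M (mult_adj A i as) (\<lambda>x hs. ract M (f hs) x) \<one>\<^bsub>A\<^esub>"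
      by (rule R.cot_mult_adj[OF M_mod B as A.A.one_closed 2])
    finally show ?thesis using 2 A.mult_adj_tuples[OF as 2] by (simp add: hoch_coface_def lenA to_A_def)
  next
    case 3
    have hs: "last hs \<in> carrier H" "butlast hs \<in> tuples H n" if "hs \<in> tuples H (Suc n)" for hs
      using that by (cases hs rule: rev_cases; auto simp: tuples_def)+
    have l: "last as \<in> carrier A" "butlast as \<in> tuples A n"
      using as by (cases as rule: rev_cases; auto simp: tuples_def)+
    have "R.cot M as (\<lambda>x hs. ract M (hoch_coface H (left_twist M) i f hs) x) \<one>\<^bsub>A\<^esub>
        = R.cot M as (\<lambda>x hs. counit (last hs) \<odot>\<^bsub>M\<^esub> ract M (f (butlast hs)) x) \<one>\<^bsub>A\<^esub>"
      using 3 hs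
      by (intro R.cot.transfer_cong[OF M_mod as A.A.one_closed])
        (simp_all add: hoch_coface_def lenH B.ract_closed B.ract_smult_l cochainD(2)[OF f] counit_closed)
    also have "\<dots> = R.cot M (butlast as) (\<lambda>x hs. ract M (f hs) x) (last as \<cdot> \<one>\<^bsub>A\<^esub>)"
      by (rule R.cot_counit_last[OF M_mod B as A.A.one_closed])
    also have "\<dots> = ract M (to_A n f (butlast as)) (last as)"
      using to_A_ract[OF f l(2,1)] l by simp
    finally show ?thesis using 3 by (simp add: hoch_coface_def lenA)
  qed
qed

lemma to_A_cobdry:
  assumes f: "f \<in> carrier (CH n)"
  shows "to_A (Suc n) (hoch_cobdry K H (left_twist M) n f) = hoch_cobdry K A M n (to_A n f)"
proof (rule extensionalityI[where A = "tuples A (Suc n)"])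
  note f' = f[folded left_twist_cochains]
  fix as assume as: "as \<in> tuples A (Suc n)"
  let ?c = "\<lambda>i hs. hoch_coface H (left_twist M) i f hs"
  have cl: "?c i hs \<in> carrier M" if "i \<in> {0..Suc n}" "hs \<in> tuples H (Suc n)" for i hs
    using LT.coface_closed[OF f' that(2), of i] that(1) by simp
  have fs: "(\<Oplus>\<^bsub>left_twist M\<^esub>i\<in>I. g i) = (\<Oplus>\<^bsub>M\<^esub>i\<in>I. g i)" for I :: "nat set" and g
    by (simp add: finsum_def finprod_def)
  have "to_A (Suc n) (hoch_cobdry K H (left_twist M) n f) as
      = R.cot M as (\<lambda>x hs. ract M (hoch_cobdry K H (left_twist M) n f hs) x) \<one>\<^bsub>A\<^esub>"
    using as by (simp add: to_A_def)
  also have "\<dots> = R.cot M as (\<lambda>x hs. \<Oplus>\<^bsub>M\<^esub>i\<in>{0..Suc n}. sgn_pow K i \<odot>\<^bsub>M\<^esub> ract M (?c i hs) x) \<one>\<^bsub>A\<^esub>"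
  proof (rule R.cot.transfer_cong[OF M_mod as A.A.one_closed])
    fix x hs assume x: "x \<in> carrier A" and hs: "hs \<in> tuples H (Suc n)"
    show "(\<Oplus>\<^bsub>M\<^esub>i\<in>{0..Suc n}. sgn_pow K i \<odot>\<^bsub>M\<^esub> ract M (?c i hs) x) \<in> carrier M"
      using cl[OF _ hs] x by (intro B.M.M.finsum_closed) (auto simp: B.ract_closed)
    have "ract M (hoch_cobdry K H (left_twist M) n f hs) x
        = ract M (\<Oplus>\<^bsub>M\<^esub>i\<in>{0..Suc n}. sgn_pow K i \<odot>\<^bsub>M\<^esub> ?c i hs) x"
      by (simp add: LT.cobdry_sum[OF f' hs] fs)
    also have "\<dots> = (\<Oplus>\<^bsub>M\<^esub>i\<in>{0..Suc n}. ract M (sgn_pow K i \<odot>\<^bsub>M\<^esub> ?c i hs) x)"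
      using cl[OF _ hs] by (intro lin_finsum[OF M_mod M_mod bilinD(1)[OF ract_bilin x]]) simp_all
    also have "\<dots> = (\<Oplus>\<^bsub>M\<^esub>i\<in>{0..Suc n}. sgn_pow K i \<odot>\<^bsub>M\<^esub> ract M (?c i hs) x)"
      using cl[OF _ hs] x by (intro B.M.M.finsum_cong') (auto simp: B.ract_closed B.ract_smult_l)
    finally show "ract M (hoch_cobdry K H (left_twist M) n f hs) x
        = (\<Oplus>\<^bsub>M\<^esub>i\<in>{0..Suc n}. sgn_pow K i \<odot>\<^bsub>M\<^esub> ract M (?c i hs) x)" .
  qed
  also have "\<dots> = (\<Oplus>\<^bsub>M\<^esub>i\<in>{0..Suc n}. sgn_pow K i \<odot>\<^bsub>M\<^esub> R.cot M as (\<lambda>x hs. ract M (?c i hs) x) \<one>\<^bsub>A\<^esub>)"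
    using cl by (intro R.cot.transfer_sum[OF M_mod _ _ as A.A.one_closed]) (simp_all add: B.ract_closed)
  also have "\<dots> = (\<Oplus>\<^bsub>M\<^esub>i\<in>{0..Suc n}. sgn_pow K i \<odot>\<^bsub>M\<^esub> hoch_coface A M i (to_A n f) as)"
    using B.coface_closed[OF to_A_closed[OF f] as]
    by (intro B.M.M.finsum_cong') (auto simp: cot_coface[OF f as])
  also have "\<dots> = hoch_cobdry K A M n (to_A n f) as"
    by (rule B.cobdry_sum[OF to_A_closed[OF f] as, symmetric])
  finally show "to_A (Suc n) (hoch_cobdry K H (left_twist M) n f) as = hoch_cobdry K A M n (to_A n f) as" .
qed (simp_all add: to_A_def hoch_cobdry_def)

lemma to_H_cobdry:
  assumes g: "g \<in> carrier (CA n)"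
  shows "hoch_cobdry K H (left_twist M) n (to_H n g) = to_H (Suc n) (hoch_cobdry K A M n g)"
proof -
  have "hoch_cobdry K H (left_twist M) n (to_H n g) \<in> carrier (CH (Suc n))"
    using LT.cobdry_closed[of "to_H n g" n] to_H_closed[OF g] unfolding left_twist_cochains .
  from to_H_to_A[OF this] show ?thesis
    by (simp add: to_A_cobdry[OF to_H_closed[OF g]] to_A_to_H[OF g])
qed

text \<open>
  \<open>to_H\<close> is an isomorphism of complexes.
\<close>

lemma cohomology_iso:
  "mod_isomorphic K (hoch_cohomology K A M n) (hoch_cohomology K H (left_twist M) n)"
  unfolding hoch_cohomology_def left_twist_cochains
proof (rule subquot_isomorphic[OF CA'_mod CH'_mod to_H_lin to_H_bij CA'_mod CH'_mod to_H_lin])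
  show "hoch_cobdry K A M n g \<in> carrier (CA (Suc n))"
    and "hoch_cobdry K H (left_twist M) n (to_H n g) = to_H (Suc n) (hoch_cobdry K A M n g)"
    if "g \<in> carrier (CA n)" for g
    by (rule B.cobdry_closed[OF that], rule to_H_cobdry[OF that])
  show "inj_on (to_H (Suc n)) (carrier (CA (Suc n)))"
    using to_H_bij by (auto simp: bij_betw_def)
  let ?N = "if n = 0 then {\<zero>\<^bsub>CA 0\<^esub>} else hoch_cobdry K A M (n - 1) ` carrier (CA (n - 1))"
  interpret C': module K "CA 0" by (rule CA'_mod)
  show "?N \<subseteq> carrier (CA n)"
    using B.cobdry_closed[of _ "n - 1"] by (cases n) auto
  show "(if n = 0 then {\<zero>\<^bsub>CH 0\<^esub>} else hoch_cobdry K H (left_twist M) (n - 1) ` carrier (CH (n - 1)))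
      = to_H n ` ?N"
  proof (cases n)
    case 0
    then show ?thesis using lin_zero[OF CA'_mod CH'_mod to_H_lin, of 0] by simp
  next
    case (Suc m)
    have "carrier (CH m) = to_H m ` carrier (CA m)" using to_H_bij[of m] by (simp add: bij_betw_def)
    then show ?thesis using Suc by (simp add: image_image to_H_cobdry)
  qed
qed

end

section \<open>Homology and cohomology of Galois objects\<close>

theorem theorem7p1:
  fixes K :: "('k, 'r) ring_scheme"
    and H :: "('k, 'h, 's) module_scheme"
    and comult :: "'h \<Rightarrow> ('h \<times> 'h \<Rightarrow> 'k) set"
    and counit :: "'h \<Rightarrow> 'k"
    and antipode :: "'h \<Rightarrow> 'h"
    and A :: "('k, 'a, 't) module_scheme"
    and coact :: "'a \<Rightarrow> ('h \<times> 'a \<Rightarrow> 'k) set"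
  assumes "hopf_algebra K H comult counit antipode"
    and "left_galois_object K H comult counit antipode A coact"
  shows "\<exists>(F' :: ('k, 'm, 'a) bimodule \<Rightarrow> ('k, 'm, 'h) bimodule) Fm'
          (F'' :: ('k, 'm, 'a) bimodule \<Rightarrow> ('k, 'm, 'h) bimodule) Fm''.
      bimod_functor K A H F' Fm' \<and> bimod_functor K A H F'' Fm'' \<and>
      (\<forall>M. alg_bimodule K A M \<longrightarrow> (\<forall>n.
         mod_isomorphic K (hoch_homology K A M n) (hoch_homology K H (F' M) n) \<and>
         mod_isomorphic K (hoch_cohomology K A M n) (hoch_cohomology K H (F'' M) n)))"
proof -
  interpret left_galois_object K H comult counit antipode A coact by fact
  have "mod_isomorphic K (hoch_homology K A M n) (hoch_homology K H (right_twist M) n) \<and>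
      mod_isomorphic K (hoch_cohomology K A M n) (hoch_cohomology K H (left_twist M) n)"
    if "alg_bimodule K A M" for M :: "('k, 'm, 'a) bimodule" and n
    using galois_bimodule.intro[OF left_galois_object_axioms that]
    by (intro conjI galois_bimodule.homology_iso galois_bimodule.cohomology_iso)
  then show ?thesis
    by (intro exI[of _ right_twist] exI[of _ left_twist] exI[of _ "\<lambda>M N f. f"] conjI
      right_twist_functor left_twist_functor) blast
qed

end
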